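(* Assume the regularity, growth, tail and moment assumptions (A1)–(A4) listed in the context. Then $$\mathrm{TV}\bigl(\tilde q_{h}(\cdot,0),q(\cdot,0)\bigr)\le C_4\Bigl(d\,\varepsilon_{\mathrm{Jac}}+\sqrt{d}\,\varepsilon_{\mathrm{score}}+d\,\frac{1+2\sqrt{\log T}}{T^{2}}\Bigr),$$ where $C_4=\max\{\tfrac12 G_{\infty}C_M,\,C_D\}$, with $$C_M=\max\Bigl\{C_3,\ \sqrt{C_2+2\sqrt{2S_0^4+2S_1^4C_1}}\;C_3^{1/2}\Bigr\},\qquad C_D=\bigl(C_r+\sqrt{C_1}\bigr)\sqrt{C_2+2\sqrt{2S_0^4+2S_1^4C_1}}.$$
   Context: Setting. Let $x_0\in\mathbb{R}^d$ have density $q(\cdot,0)$ and, for $t\in[0,1]$, let $x_t\,|\,x_0\sim\mathcal N(\alpha(t)x_0,\sigma^2(t)I)$ with differentiable noise schedules $\alpha,\sigma\ge 0$; $q(\cdot,t)$ is the density of $x_t$. Put $f(t)=\frac{\mathrm d\log\alpha(t)}{\mathrm dt}$, $g^2(t)=\frac{\mathrm d\sigma^2(t)}{\mathrm dt}-2\frac{\mathrm d\log\alpha(t)}{\mathrm dt}\sigma^2(t)$. The exact score is $s(x,t)=\nabla_x\log q(x,t)$; $s_\theta(x,t)$ is a given learned score. $J$ denotes the Jacobian in $x$, $\nabla\cdot$ the divergence in $x$, $\|\cdot\|$ the Euclidean norm, $\|\cdot\|_{\mathrm{op}}$ the operator norm. The density $q$ satisfies $\partial_t q+\nabla\cdot(qv)=0$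 with $v(x,t)=f(t)x-\frac12g^2(t)s(x,t)$. Sampler. Let $T$ be a positive integer, $h=1/T$, $t_n=nh$, $t_{n-\frac12}=(n-\frac12)h$, $B(t,x)=-\frac12g^2(t)s_\theta(x,t)$. For $n=T,\dots,1$ the sampler is $\tilde x_n^*=\tilde x_n\exp(\int_{t_n}^{t_{n-1/2}}f(s)\,\mathrm ds)$, $k_1=-B(t_n,\tilde x_n^* )$, $k_2=-B(t_{n-\frac12},\tilde x_n^*+\frac h2k_1)$, $\tilde x_n^{**}=\tilde x_n^*+hk_2$, $\tilde x_{n-1}=\tilde x_n^{**}\exp(\int_{t_{n-1/2}}^{t_{n-1}}f(s)\,\mathrm ds)$. A single sampler step is interpreted as the (backward) time-$h$ flow of a modified vector field $\tilde v_h(x,t)=f(t)x-\frac12g^2(t)s_\theta(x,t)+O(h^2)$, and $\tilde q_h(\cdot,t)$, the marginal density at time $t$ of the numerical sampler, satisfies $\partial_t\tilde q_h+\nabla\cdot(\tilde q_h\tilde v_h)=0$ on $[0,1]$ with $\tilde q_h(\cdot,1)=q(\cdot,1)$. Define $r(x,t)=\frac1{h^2}\bigl(\tilde v_h(x,t)-f(t)x+\frac12g^2(t)s_\theta(x,t)\bigr)$ and $\tilde s(x,t)=\nabla_x\log\tilde q_h(x,t)$. Let $R_T=2\sqrt{\log T}$ and $\Omega_T=\{x\in\mathbb R^d:\|x\|\le R_T\sqrt d\}$. Assumptions. (A1) $f,g\in C^2([0,1])$ and $g^2(t)\le G_\infty$ for all $t\in[0,1]$, for a finite constant $G_\infty>0$.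 (A2) $s_\theta,s,\tilde s$ are twice continuously differentiable in $(x,t)$ and there are $S_0,S_1,L_1>0$ with $\|s_\theta(x,t)\|,\|s(x,t)\|,\|\tilde s(x,t)\|\le S_0+S_1\|x\|$, $\|Js_\theta(x,t)\|_{\mathrm{op}}\le L_1$ and $\|Js(x,t)\|_{\mathrm{op}}\le L_1$ for all $x\in\mathbb R^d$, $t\in[0,1]$. (A3) $\mathbb P_{\xi\sim q(\cdot,t)}(\xi\notin\Omega_T)+\mathbb P_{\xi\sim\tilde q_h(\cdot,t)}(\xi\notin\Omega_T)\le T^{-4}$ for all $t\in[0,1]$; and there is $C_1<\infty$ with $\mathbb E_{\xi\sim q(\cdot,t)}[\|\xi\|^k]\le C_1d^{k/2}$ and $\mathbb E_{\xi\sim\tilde q_h(\cdot,t)}[\|\xi\|^k]\le C_1d^{k/2}$ for $k\in\{1,2,3,4\}$, $t\in[0,1]$. (A4) There is $C_2>0$ such that for all $t\in[0,1]$, $(\mathbb E_{\xi\sim q(\cdot,t)}[\|s(\xi,t)\|^2\mathbf 1_{\Omega_T}(\xi)])^{1/2}\le C_2\sqrt d$ and $(\mathbb E_{\xi\sim\tilde q_h(\cdot,t)}[\|\tilde s(\xi,t)\|^2\mathbf 1_{\Omega_T}(\xi)])^{1/2}\le C_2\sqrt d$. Further constants. $C_3>0$ is a constant with $\mathbb E_{\xi\sim\tilde q_h(\cdot,t)}[\zeta(\xi)]\le C_3\,\mathbb E_{\xi\sim q(\cdot,t)}[\zeta(\xi)]$ for every nonnegative $\zeta$ for which the expectations exist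 (uniformly bounded Radon–Nikodym derivative). $C_r>0$ is a constant, depending on $r$, with $\|r(x,t)\|\le C_r(1+\|x\|)$ and $|\nabla\cdot r(x,t)|\le C_r(1+\|x\|)$ for all $x\in\mathbb R^d$, $t\in[0,1]$. Error metrics. $\varepsilon_{\mathrm{score}}=\sqrt{\sup_{t\in[0,1]}\mathbb E_{\xi\sim q(\cdot,t)}[\|s_\theta(\xi,t)-s(\xi,t)\|^2]}$, $\varepsilon_{\mathrm{Jac}}=\sup_{t\in[0,1]}\mathbb E_{\xi\sim q(\cdot,t)}[\|Js_\theta(\xi,t)-Js(\xi,t)\|_{\mathrm{op}}]$. Total variation: $\mathrm{TV}(p,q)=\frac12\int_{\mathbb R^d}|p(x)-q(x)|\,\mathrm dx$. *)

theory Defs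
  imports "HOL-Probability.Probability"
begin

section \<open>Differential operators\<close>

definition op_norm :: "real^'n^'n \<Rightarrow> real" where
  "op_norm A = onorm (\<lambda>v. A *v v)"

definition divergence :: "(real^'n \<Rightarrow> real^'n) \<Rightarrow> real^'n \<Rightarrow> real" where
  "divergence F x = trace (jacobian F (at x))"

(* Derivatives are taken relative to S, so at boundary points of a closed time interval
   they are one-sided. *)
definition C2_on :: "'a set \<Rightarrow> ('a::real_normed_vector \<Rightarrow> 'b::real_normed_vector) \<Rightarrow> bool" where
  "C2_on S F \<longleftrightarrow>
     (\<exists>(D :: 'a \<Rightarrow> 'a \<Rightarrow>\<^sub>L 'b) (D2 :: 'a \<Rightarrow> 'a \<Rightarrow>\<^sub>L ('a \<Rightarrow>\<^sub>L 'b)).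
        (\<forall>p\<in>S. (F has_derivative blinfun_apply (D p)) (at p within S)) \<and>
        (\<forall>p\<in>S. (D has_derivative blinfun_apply (D2 p)) (at p within S)) \<and>
        continuous_on S D2)"

abbreviation C2_space_time :: "(real^'n \<Rightarrow> real \<Rightarrow> real^'n) \<Rightarrow> bool" where
  "C2_space_time F \<equiv> C2_on (UNIV \<times> {0..1}) (\<lambda>(x, t). F x t)"

section \<open>Densities, scores and the continuity equation\<close>

definition law :: "(real^'n \<Rightarrow> real) \<Rightarrow> (real^'n) measure" where
  "law p = density lborel (\<lambda>x. ennreal (p x))"

abbreviation expect :: "(real^'n \<Rightarrow> real) \<Rightarrow> (real^'n \<Rightarrow> real) \<Rightarrow> real" where
  "expect p \<phi> \<equiv> (\<integral>x. \<phi> x \<partial>law p)"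

definition TV :: "(real^'n \<Rightarrow> real) \<Rightarrow> (real^'n \<Rightarrow> real) \<Rightarrow> real" where
  "TV p q = 1/2 * (\<integral>x. \<bar>p x - q x\<bar> \<partial>lborel)"

(* Positivity is what makes log q meaningful; ln is total in HOL. *)
definition is_score :: "(real^'n \<Rightarrow> real \<Rightarrow> real) \<Rightarrow> (real^'n \<Rightarrow> real \<Rightarrow> real^'n) \<Rightarrow> bool" where
  "is_score q s \<longleftrightarrow>
     (\<forall>t\<in>{0..1}. \<forall>x. q x t > 0 \<and> (GDERIV (\<lambda>y. ln (q y t)) x :> s x t))"

(* Classical solutions. The explicit differentiability is needed because the total function
   frechet_derivative, and hence divergence, is unspecified elsewhere. *)
definition continuity_equation ::
    "(real^'n \<Rightarrow> real \<Rightarrow> real) \<Rightarrow> (real^'n \<Rightarrow> real \<Rightarrow> real^'n) \<Rightarrow> bool" where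
  "continuity_equation q v \<longleftrightarrow>
     (\<forall>t\<in>{0..1}. \<forall>x.
        (\<lambda>y. q y t *\<^sub>R v y t) differentiable (at x) \<and>
        ((\<lambda>\<tau>. q x \<tau>) has_real_derivative - divergence (\<lambda>y. q y t *\<^sub>R v y t) x)
          (at t within {0..1}))"

section \<open>The forward process\<close>

(* The normal law with mean m and covariance sd^2 I; it is the point mass at m if sd = 0. *)
definition gaussian :: "real^'n \<Rightarrow> real \<Rightarrow> (real^'n) measure" where
  "gaussian m sd =
     distr (law (\<lambda>z. \<Prod>i\<in>UNIV. std_normal_density (z $ i))) borel (\<lambda>z. m + sd *\<^sub>R z)"

(* X t has density q(.,t), and gaussian (alpha t x0) (sigma t) is a regular conditional
   distribution of X t given X 0 = x0. *)
definition forward_process ::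
    "'w measure \<Rightarrow> (real \<Rightarrow> 'w \<Rightarrow> real^'n) \<Rightarrow> (real \<Rightarrow> real) \<Rightarrow> (real \<Rightarrow> real) \<Rightarrow>
     (real^'n \<Rightarrow> real \<Rightarrow> real) \<Rightarrow> bool" where
  "forward_process M X \<alpha> \<sigma> q \<longleftrightarrow>
     prob_space M \<and>
     (\<forall>t\<in>{0..1}. distributed M lborel (X t) (\<lambda>x. ennreal (q x t))) \<and>
     (\<forall>t\<in>{0..1}. \<forall>A\<in>sets borel. \<forall>B\<in>sets borel.
        emeasure M {\<omega>\<in>space M. X 0 \<omega> \<in> A \<and> X t \<omega> \<in> B} =
        (\<integral>\<^sup>+x0. emeasure (gaussian (\<alpha> t *\<^sub>R x0) (\<sigma> t)) B * indicator A x0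
           \<partial>law (\<lambda>x. q x 0)))"

(* sigma itself need not be differentiable at 0, where it may behave like a square root;
   sigma^2 is differentiable on the whole interval. *)
definition noise_schedule ::
    "(real \<Rightarrow> real) \<Rightarrow> (real \<Rightarrow> real) \<Rightarrow> (real \<Rightarrow> real) \<Rightarrow> (real \<Rightarrow> real) \<Rightarrow> bool" where
  "noise_schedule \<alpha> \<sigma> f g \<longleftrightarrow>
     \<alpha> differentiable_on {0..1} \<and> \<sigma> differentiable_on {0<..1} \<and>
     (\<forall>t\<in>{0..1}.
        \<alpha> t > 0 \<and> \<sigma> t \<ge> 0 \<and>
        ((\<lambda>\<tau>. ln (\<alpha> \<tau>)) has_real_derivative f t) (at t within {0..1}) \<and>
        (\<exists>D. ((\<lambda>\<tau>. (\<sigma> \<tau>)\<^sup>2) has_real_derivative D) (at t within {0..1}) \<and>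
             (g t)\<^sup>2 = D - 2 * f t * (\<sigma> t)\<^sup>2))"

definition pf_field ::
    "(real \<Rightarrow> real) \<Rightarrow> (real \<Rightarrow> real) \<Rightarrow> (real^'n \<Rightarrow> real \<Rightarrow> real^'n) \<Rightarrow>
     real^'n \<Rightarrow> real \<Rightarrow> real^'n" where
  "pf_field f g s x t = f t *\<^sub>R x - (1/2 * (g t)\<^sup>2) *\<^sub>R s x t"

section \<open>The sampler\<close>

definition B_field ::
    "(real \<Rightarrow> real) \<Rightarrow> (real^'n \<Rightarrow> real \<Rightarrow> real^'n) \<Rightarrow> real \<Rightarrow> real^'n \<Rightarrow> real^'n" where
  "B_field g s\<^sub>\<theta> t x = - ((1/2 * (g t)\<^sup>2) *\<^sub>R s\<^sub>\<theta> x t)"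

(* The map from the iterate at time n h to the iterate at time (n-1) h. The interval integrals
   are oriented: both run backwards in time. *)
definition sampler_step ::
    "(real \<Rightarrow> real) \<Rightarrow> (real \<Rightarrow> real) \<Rightarrow> (real^'n \<Rightarrow> real \<Rightarrow> real^'n) \<Rightarrow> real \<Rightarrow>
     nat \<Rightarrow> real^'n \<Rightarrow> real^'n" where
  "sampler_step f g s\<^sub>\<theta> h n x =
     (let t\<^sub>n = real n * h;
          t\<^sub>m = (real n - 1/2) * h;
          t\<^sub>p = (real n - 1) * h;
          x1 = exp (LBINT u=t\<^sub>n..t\<^sub>m. f u) *\<^sub>R x;
          k1 = - B_field g s\<^sub>\<theta> t\<^sub>n x1;
          k2 = - B_field g s\<^sub>\<theta> t\<^sub>m (x1 + (h/2) *\<^sub>R k1);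
          x2 = x1 + h *\<^sub>R k2
      in exp (LBINT u=t\<^sub>m..t\<^sub>p. f u) *\<^sub>R x2)"

(* sampler_iterate step T k is the iterate with index T - k, as a function of the initial
   value, whose index is T. *)
primrec sampler_iterate :: "(nat \<Rightarrow> 'a \<Rightarrow> 'a) \<Rightarrow> nat \<Rightarrow> nat \<Rightarrow> 'a \<Rightarrow> 'a" where
  "sampler_iterate step T 0 x = x"
| "sampler_iterate step T (Suc k) x = step (T - k) (sampler_iterate step T k x)"

(* On [a,b], Phi t x is the position at time t of a trajectory of the field w that is at x at
   the final time b; the backward flow from b to a is the given map. *)
definition backward_flow ::
    "(real^'n \<Rightarrow> real \<Rightarrow> real^'n) \<Rightarrow> real \<Rightarrow> real \<Rightarrow> (real^'n \<Rightarrow> real^'n) \<Rightarrow>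
     (real \<Rightarrow> real^'n \<Rightarrow> real^'n) \<Rightarrow> bool" where
  "backward_flow w a b step \<Phi> \<longleftrightarrow>
     (\<forall>t\<in>{a..b}. \<Phi> t \<in> borel_measurable borel) \<and>
     (\<forall>x. \<Phi> b x = x \<and> \<Phi> a x = step x \<and>
        (\<forall>t\<in>{a..b}. ((\<lambda>\<tau>. \<Phi> \<tau> x) has_vector_derivative w (\<Phi> t x) t) (at t within {a..b})))"

(* Each of the T steps is the backward flow of w, and qh(.,t) is the density at time t of the
   sampler, interpolated by these flows and started at time 1 from the density p. *)
definition sampler_marginals ::
    "(nat \<Rightarrow> real^'n \<Rightarrow> real^'n) \<Rightarrow> nat \<Rightarrow> (real^'n \<Rightarrow> real \<Rightarrow> real^'n) \<Rightarrow>
     (real^'n \<Rightarrow> real) \<Rightarrow> (real^'n \<Rightarrow> real \<Rightarrow> real) \<Rightarrow> bool" where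
  "sampler_marginals step T w p qh \<longleftrightarrow>
     (\<exists>\<Phi>. \<forall>n\<in>{1..T}.
        backward_flow w ((real n - 1) / real T) (real n / real T) (step n) (\<Phi> n) \<and>
        (\<forall>t\<in>{(real n - 1) / real T..real n / real T}.
           distr (law p) borel (\<lambda>x. \<Phi> n t (sampler_iterate step T (T - n) x)) =
           law (\<lambda>x. qh x t)))"

definition residual ::
    "(real \<Rightarrow> real) \<Rightarrow> (real \<Rightarrow> real) \<Rightarrow> (real^'n \<Rightarrow> real \<Rightarrow> real^'n) \<Rightarrow> real \<Rightarrow>
     (real^'n \<Rightarrow> real \<Rightarrow> real^'n) \<Rightarrow> real^'n \<Rightarrow> real \<Rightarrow> real^'n" where
  "residual f g s\<^sub>\<theta> h w x t =
     (1 / h\<^sup>2) *\<^sub>R (w x t - f t *\<^sub>R x + (1/2 * (g t)\<^sup>2) *\<^sub>R s\<^sub>\<theta> x t)"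

section \<open>Truncation set and error metrics\<close>

definition R_trunc :: "nat \<Rightarrow> real" where
  "R_trunc T = 2 * sqrt (ln (real T))"

definition \<Omega>_trunc :: "nat \<Rightarrow> (real^'n) set" where
  "\<Omega>_trunc T = {x. norm x \<le> R_trunc T * sqrt (real CARD('n))}"

definition eps_score ::
    "(real^'n \<Rightarrow> real \<Rightarrow> real) \<Rightarrow> (real^'n \<Rightarrow> real \<Rightarrow> real^'n) \<Rightarrow>
     (real^'n \<Rightarrow> real \<Rightarrow> real^'n) \<Rightarrow> real" where
  "eps_score q s\<^sub>\<theta> s =
     sqrt (SUP t\<in>{0..1}. expect (\<lambda>x. q x t) (\<lambda>x. (norm (s\<^sub>\<theta> x t - s x t))\<^sup>2))"

definition eps_Jac ::
    "(real^'n \<Rightarrow> real \<Rightarrow> real) \<Rightarrow> (real^'n \<Rightarrow> real \<Rightarrow> real^'n) \<Rightarrow>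
     (real^'n \<Rightarrow> real \<Rightarrow> real^'n) \<Rightarrow> real" where
  "eps_Jac q s\<^sub>\<theta> s =
     (SUP t\<in>{0..1}. expect (\<lambda>x. q x t)
        (\<lambda>x. op_norm (jacobian (\<lambda>y. s\<^sub>\<theta> y t) (at x) - jacobian (\<lambda>y. s y t) (at x))))"

end

theory Submission
  imports Defs
begin

text \<open>
Write \<open>v\<close> for the exact field, \<open>v\<^sub>h\<close> for the modified one and \<open>w = v\<^sub>h - v\<close>, so that
\<open>w = -g\<^sup>2/2 (s\<^sub>\<theta> - s) + h\<^sup>2 r\<close>. Subtracting the two continuity equations shows that
\<open>q\<^sub>h - q\<close> is transported by \<open>v\<close> with source \<open>-\<nabla>\<cdot>(q\<^sub>h w)\<close>. Transport does not increase the
\<open>L\<^sup>1\<close> norm and the two densities agree at time 1, so the total variation at time 0 is at most half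
of \<open>sup\<^sub>t \<integral>|\<nabla>\<cdot>(q\<^sub>h w)|\<close> (\<open>continuity_equation_L1_stability\<close>). Linear growth of the scores and
the moment bounds make every integral absolutely convergent on the whole space, so that integration
by parts holds without cutoffs.

Since \<open>\<nabla>\<cdot>(q\<^sub>h w) = q\<^sub>h (\<nabla>\<cdot>w + s\<^sub>h \<bullet> w)\<close> with \<open>s\<^sub>h\<close> the score of \<open>q\<^sub>h\<close>, the source is an
expectation under \<open>q\<^sub>h\<close>. In its score part the divergence is a trace, at most \<open>d\<close> times the operator
norm, and the inner product is handled by Cauchy-Schwarz; the bounded density ratio moves both to
\<open>q\<close> (\<open>expect_source_bound\<close>). The factor needed from Cauchy-Schwarz is
\<open>E|s\<^sub>h|\<^sup>2 \<le> A d\<close> with \<open>A = 2 sqrt (2 S\<^sub>0^4 + 2 S\<^sub>1^4 C\<^sub>1)\<close>. It follows from linear growth and the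
moments, and the constant \<open>K\<close> of the theorem satisfies \<open>K\<^sup>2 = C\<^sub>2 + A\<close>.

The residual part is the delicate one: with \<open>R = 2 sqrt (ln T)\<close> it requires
\<open>1 + E|x| + E(|s\<^sub>h| (1 + |x|)) \<le> 2 K d (1 + R)\<close>, although \<open>C\<^sub>r\<close> may be arbitrarily large compared
with all the other constants. Three facts give it (\<open>residual_moment_bound\<close>).
First, if \<open>C\<^sub>1^(1/4) d (1 + R) \<ge> T\<^sup>2\<close>, the claimed bound is at least 1 and holds trivially; this uses
\<open>A sqrt C\<^sub>1 \<ge> 1\<close>, a form of the Cramer-Rao inequality. Otherwise \<open>C\<^sub>1\<close> is small enough for the tail
to make everything outside the truncation set a lower order term. Second, on the truncation set
\<open>E|s\<^sub>h|\<^sup>2\<close> is at most \<open>d\<close> times the minimum of \<open>C\<^sub>2\<^sup>2\<close> and \<open>A\<close>, and since \<open>K\<^sup>2\<close> is a sum the score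
moment uses up only a part of \<open>K\<close>. Third, \<open>A d \<ge> 1/2\<close>: a density whose score grows slowly has
heavy tails, and a smaller \<open>A\<close> would contradict the tail bound \<open>T^(-4) = exp (-R\<^sup>2)\<close>
(\<open>tail_lower_bound\<close>). This lower bound on \<open>K\<close> absorbs \<open>1 + E|x|\<close>.
\<close>

section \<open>Integration by parts on the whole space\<close>

lemma integral_Cauchy_Schwarz:
  fixes u v :: "'a \<Rightarrow> real"
  assumes [measurable]: "u \<in> borel_measurable M" "v \<in> borel_measurable M"
    and u2: "integrable M (\<lambda>x. (u x)\<^sup>2)" and v2: "integrable M (\<lambda>x. (v x)\<^sup>2)"
  shows "integrable M (\<lambda>x. u x * v x)"
    and "(\<integral>x. \<bar>u x * v x\<bar> \<partial>M) \<le> sqrt (\<integral>x. (u x)\<^sup>2 \<partial>M) * sqrt (\<integral>x. (v x)\<^sup>2 \<partial>M)"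
proof -
  have "\<bar>u x * v x\<bar> \<le> (u x)\<^sup>2 + (v x)\<^sup>2" for x
  proof -
    have "0 \<le> (\<bar>u x\<bar> - \<bar>v x\<bar>)\<^sup>2" by simp
    then have "2 * \<bar>u x * v x\<bar> \<le> (u x)\<^sup>2 + (v x)\<^sup>2"
      by (simp add: power2_diff abs_mult)
    then show ?thesis by (smt (verit) abs_ge_zero)
  qed
  then show int: "integrable M (\<lambda>x. u x * v x)"
    by (intro Bochner_Integration.integrable_bound[OF Bochner_Integration.integrable_add[OF u2 v2]]) auto
  define a where "a = (\<integral>x. (u x)\<^sup>2 \<partial>M)"
  define b where "b = (\<integral>x. (v x)\<^sup>2 \<partial>M)"
  define c where "c = (\<integral>x. \<bar>u x * v x\<bar> \<partial>M)"
  have a0: "a \<ge> 0" and b0: "b \<ge> 0" and c0: "c \<ge> 0"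
    by (auto simp: a_def b_def c_def)
  have quad: "0 \<le> l\<^sup>2 * a - 2 * l * c + b" for l
  proof -
    have "0 \<le> (\<integral>x. (l * \<bar>u x\<bar> - \<bar>v x\<bar>)\<^sup>2 \<partial>M)" by simp
    also have "(\<lambda>x. (l * \<bar>u x\<bar> - \<bar>v x\<bar>)\<^sup>2) = (\<lambda>x. l\<^sup>2 * (u x)\<^sup>2 - 2 * l * \<bar>u x * v x\<bar> + (v x)\<^sup>2)"
      by (auto simp: power2_diff power_mult_distrib abs_mult)
    also have "(\<integral>x. l\<^sup>2 * (u x)\<^sup>2 - 2 * l * \<bar>u x * v x\<bar> + (v x)\<^sup>2 \<partial>M) = l\<^sup>2 * a - 2 * l * c + b"
      using u2 v2 integrable_abs[OF int] by (simp add: a_def b_def c_def)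
    finally show ?thesis .
  qed
  have "c\<^sup>2 \<le> a * b"
  proof (cases "a = 0")
    case True
    have "c = 0"
    proof (rule ccontr)
      assume "c \<noteq> 0"
      then show False using quad[of "(b + 1) / (2 * c)"] True by simp
    qed
    then show ?thesis using True by simp
  next
    case False
    then have "a > 0" using a0 by simp
    have "0 \<le> a * ((c / a)\<^sup>2 * a - 2 * (c / a) * c + b)"
      using quad[of "c / a"] a0 by (simp only: mult_nonneg_nonneg)
    also have "\<dots> = a * b - c\<^sup>2"
      using False by (simp add: field_simps power2_eq_square)
    finally show ?thesis by simp
  qed
  then show "c \<le> sqrt a * sqrt b"
    by (metis real_le_rsqrt real_sqrt_mult)
qed

text \<open>Translation invariance makes the integral of \<open>H (x + e) - H x\<close> vanish. By Fubini the same integral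
is the average over \<open>s \<in> [0,1]\<close> of the integrals of the translates \<open>D (x + s e)\<close>, which are all
equal. Integrability of \<open>H\<close> thus takes the place of decay at infinity.\<close>

lemma integral_line_derivative_eq_0:
  fixes H D :: "'a::euclidean_space \<Rightarrow> real"
  assumes H: "integrable lborel H" and D: "integrable lborel D"
    and ftc: "\<And>x. ((\<lambda>s. D (x + s *\<^sub>R e)) has_integral (H (x + e) - H x)) {0..1}"
  shows "(\<integral>x. D x \<partial>lborel) = 0"
proof -
  define F where "F = (\<lambda>(s::real, x). indicator {0..1} s * D (x + s *\<^sub>R e))"
  have [measurable]: "D \<in> borel_measurable borel" using borel_measurable_integrable[OF D] by simp
  have [measurable]: "H \<in> borel_measurable borel" using borel_measurable_integrable[OF H] by simp
  have shift: "integrable lborel (\<lambda>x. g (x + a))" "(\<integral>x. g (x + a) \<partial>lborel) = (\<integral>x. g x \<partial>lborel)"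
    if g: "integrable lborel g" for g :: "'a \<Rightarrow> real" and a
  proof -
    have [measurable]: "g \<in> borel_measurable borel" using borel_measurable_integrable[OF g] by simp
    have eq: "distr lborel borel ((+) a) = lborel" by (rule lborel_distr_plus)
    have "integrable (distr lborel borel ((+) a)) g" using g eq by simp
    then show "integrable lborel (\<lambda>x. g (x + a))"
      by (subst (asm) integrable_distr_eq) (auto simp: add.commute)
    have "(\<integral>x. g x \<partial>lborel) = (\<integral>x. g x \<partial>distr lborel borel ((+) a))" using eq by simp
    also have "\<dots> = (\<integral>x. g (x + a) \<partial>lborel)" by (subst integral_distr) (auto simp: add.commute)
    finally show "(\<integral>x. g (x + a) \<partial>lborel) = (\<integral>x. g x \<partial>lborel)" by simp
  qed
  have Fm[measurable]: "F \<in> borel_measurable (lborel \<Otimes>\<^sub>M lborel)"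
    unfolding F_def by measurable
  have intF: "integrable (lborel \<Otimes>\<^sub>M lborel) F"
  proof (rule lborel_pair.Fubini_integrable)
    have "(\<lambda>s. \<integral>x. norm (F (s, x)) \<partial>lborel) = (\<lambda>s. indicator {0..1} s * (\<integral>x. \<bar>D x\<bar> \<partial>lborel))"
      using shift(2)[OF integrable_abs[OF D]] by (auto simp: F_def abs_mult)
    then show "integrable lborel (\<lambda>s. \<integral>x. norm (F (s, x)) \<partial>lborel)" by simp
    show "AE s in lborel. integrable lborel (\<lambda>x. F (s, x))"
      using shift(1)[OF D] by (auto simp: F_def)
  qed auto
  have "(\<integral>x. (\<integral>s. F (s, x) \<partial>lborel) \<partial>lborel) = (\<integral>s. (\<integral>x. F (s, x) \<partial>lborel) \<partial>lborel)"
    using lborel_pair.Fubini_integral[of "\<lambda>s x. F (s, x)"] intF by simp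
  also have "(\<lambda>s. \<integral>x. F (s, x) \<partial>lborel) = (\<lambda>s. indicator {0..1} s * (\<integral>x. D x \<partial>lborel))"
    using shift(2)[OF D] by (auto simp: F_def)
  finally have 1: "(\<integral>x. (\<integral>s. F (s, x) \<partial>lborel) \<partial>lborel) = (\<integral>x. D x \<partial>lborel)" by simp
  have "AE x in lborel. (\<integral>s. F (s, x) \<partial>lborel) = H (x + e) - H x"
  proof -
    have "AE x in lborel. integrable lborel (\<lambda>s. F (s, x))"
      using lborel_pair.AE_integrable_snd[of "\<lambda>s x. F (s, x)"] intF by simp
    then show ?thesis
    proof eventually_elim
      case (elim x)
      have "((\<lambda>s. F (s, x)) has_integral (\<integral>s. F (s, x) \<partial>lborel)) UNIV"
        by (rule has_integral_integral_lborel[OF elim])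
      moreover have "((\<lambda>s. F (s, x)) has_integral (H (x + e) - H x)) UNIV"
        using ftc[of x] unfolding has_integral_restrict_UNIV[of "{0..1}", symmetric]
        by (rule has_integral_eq[rotated]) (auto simp: F_def indicator_def)
      ultimately show ?case by (rule has_integral_unique)
    qed
  qed
  then have "(\<integral>x. (\<integral>s. F (s, x) \<partial>lborel) \<partial>lborel) = (\<integral>x. H (x + e) - H x \<partial>lborel)"
    by (intro integral_cong_AE) auto
  also have "\<dots> = 0" using shift[OF H] H by simp
  finally show ?thesis using 1 by simp
qed

text \<open>The exceptional set \<open>N\<close> serves for a weight with a kink along a sphere, which a line meets at most
twice.\<close>

lemma integral_line_derivative_eq_0_off_finite:
  fixes H D :: "'a::euclidean_space \<Rightarrow> real"
  assumes H: "integrable lborel H" and D: "integrable lborel D"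
    and cont: "continuous_on UNIV H"
    and fin: "\<And>x. finite {s. x + s *\<^sub>R e \<in> N}"
    and deriv: "\<And>x. x \<notin> N \<Longrightarrow> ((\<lambda>s. H (x + s *\<^sub>R e)) has_real_derivative D x) (at 0)"
  shows "(\<integral>x. D x \<partial>lborel) = 0"
proof (rule integral_line_derivative_eq_0[OF H D, of e])
  fix x
  have "((\<lambda>s. D (x + s *\<^sub>R e)) has_integral (H (x + 1 *\<^sub>R e) - H (x + 0 *\<^sub>R e))) {0..1}"
  proof (rule fundamental_theorem_of_calculus_interior_strong[OF fin[of x]])
    fix s assume s: "s \<in> {0<..<1} - {s. x + s *\<^sub>R e \<in> N}"
    have "((\<lambda>u. H ((x + s *\<^sub>R e) + u *\<^sub>R e)) has_real_derivative D (x + s *\<^sub>R e)) (at 0)"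
      using s by (intro deriv) auto
    then have "((\<lambda>u. H (x + u *\<^sub>R e)) has_real_derivative D (x + s *\<^sub>R e)) (at s)"
      unfolding DERIV_at_within_shift[of _ _ s 0] using DERIV_shift[of "\<lambda>u. H (x + u *\<^sub>R e)" _ 0 s]
      by (simp add: algebra_simps)
    then show "((\<lambda>s. H (x + s *\<^sub>R e)) has_vector_derivative D (x + s *\<^sub>R e)) (at s)"
      by (simp add: has_real_derivative_iff_has_vector_derivative)
  next
    show "continuous_on {0..1} (\<lambda>s. H (x + s *\<^sub>R e))"
      by (intro continuous_on_compose2[OF cont] continuous_intros) auto
  qed auto
  then show "((\<lambda>s. D (x + s *\<^sub>R e)) has_integral (H (x + e) - H x)) {0..1}" by simp
qed

lemma borel_measurable_line_derivative:
  fixes H D :: "'a::euclidean_space \<Rightarrow> real"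
  assumes [measurable]: "H \<in> borel_measurable borel"
    and deriv: "\<And>x. ((\<lambda>s. H (x + s *\<^sub>R e)) has_real_derivative D x) (at 0)"
  shows "D \<in> borel_measurable borel"
proof (rule borel_measurable_LIMSEQ_real)
  fix x
  have "((\<lambda>s. (H (x + s *\<^sub>R e) - H x) / s) \<longlongrightarrow> D x) (at 0)"
    using deriv[of x] by (simp add: DERIV_def)
  moreover have "filterlim (\<lambda>k. inverse (real (Suc k))) (at 0) sequentially"
    by (intro filterlim_atI LIMSEQ_inverse_real_of_nat) auto
  ultimately show "(\<lambda>k. (H (x + inverse (real (Suc k)) *\<^sub>R e) - H x) / inverse (real (Suc k))) \<longlonglongrightarrow> D x"
    by (rule filterlim_compose)
qed simp

text \<open>Rounding the time down to a multiple of \<open>1 / (k + 1)\<close> makes the function a countable case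
distinction over measurable functions of \<open>x\<close>; continuity in time gives the limit.\<close>

lemma borel_measurable_caratheodory:
  fixes F :: "real \<Rightarrow> 'a::euclidean_space \<Rightarrow> real"
  assumes meas: "\<And>t. F t \<in> borel_measurable borel"
    and cont: "\<And>x. continuous_on UNIV (\<lambda>t. F t x)"
  shows "(\<lambda>(t, x). F t x) \<in> borel_measurable (borel \<Otimes>\<^sub>M borel)"
proof (rule borel_measurable_LIMSEQ_real)
  fix k :: nat
  have [measurable]: "F t \<in> borel_measurable borel" for t by (rule meas)
  have "(\<lambda>z. F (real_of_int \<lfloor>real (Suc k) * fst z\<rfloor> / real (Suc k)) (snd z))
      \<in> borel_measurable (borel \<Otimes>\<^sub>M (borel :: 'a measure))"
    by (rule measurable_compose_countable[where f = "\<lambda>i z. F (real_of_int i / real (Suc k)) (snd z)"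
          and g = "\<lambda>z. \<lfloor>real (Suc k) * fst z\<rfloor>"]) measurable
  then show "(\<lambda>(t, x). F (real_of_int \<lfloor>real (Suc k) * t\<rfloor> / real (Suc k)) x)
      \<in> borel_measurable (borel \<Otimes>\<^sub>M (borel :: 'a measure))"
    by (simp add: split_beta')
next
  fix z :: "real \<times> 'a"
  obtain t x where z: "z = (t, x)" by force
  have "(\<lambda>k. real_of_int \<lfloor>real (Suc k) * t\<rfloor> / real (Suc k)) \<longlonglongrightarrow> t"
  proof (rule LIMSEQ_I)
    have b: "\<bar>real_of_int \<lfloor>real (Suc k) * t\<rfloor> / real (Suc k) - t\<bar> \<le> inverse (real (Suc k))" for k
    proof -
      have "real_of_int \<lfloor>real (Suc k) * t\<rfloor> / real (Suc k) - t
          = (real_of_int \<lfloor>real (Suc k) * t\<rfloor> - real (Suc k) * t) / real (Suc k)"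
        by (simp add: field_simps)
      moreover have "\<bar>real_of_int \<lfloor>real (Suc k) * t\<rfloor> - real (Suc k) * t\<bar> \<le> 1" by linarith
      ultimately show ?thesis
        by (simp add: abs_div_pos divide_right_mono inverse_eq_divide del: of_nat_Suc)
    qed
    fix r :: real assume "r > 0"
    then have "eventually (\<lambda>k. inverse (real (Suc k)) < r) sequentially"
      using order_tendstoD(2)[OF LIMSEQ_inverse_real_of_nat] by blast
    then show "\<exists>no. \<forall>n\<ge>no. norm (real_of_int \<lfloor>real (Suc n) * t\<rfloor> / real (Suc n) - t) < r"
      using b unfolding eventually_sequentially real_norm_def by (meson le_less_trans)
  qed
  then show "(\<lambda>k. (case z of (t, x) \<Rightarrow> F (real_of_int \<lfloor>real (Suc k) * t\<rfloor> / real (Suc k)) x))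
      \<longlonglongrightarrow> (case z of (t, x) \<Rightarrow> F t x)"
    unfolding z using cont[of x] continuous_on_tendsto_compose[of UNIV "\<lambda>t. F t x" _ t sequentially]
    by simp
qed

text \<open>Difference quotients are of the previous form once \<open>F\<close> is extended to all times by its values at
the end points of the interval. The indicator removes the end points, where the extended function
has no two-sided derivative.\<close>

lemma borel_measurable_time_derivative:
  fixes F D :: "real \<Rightarrow> 'a::euclidean_space \<Rightarrow> real"
  assumes meas: "\<And>t. t \<in> {0..1} \<Longrightarrow> F t \<in> borel_measurable borel"
    and deriv: "\<And>t x. t \<in> {0..1} \<Longrightarrow> ((\<lambda>t. F t x) has_real_derivative D t x) (at t within {0..1})"
  shows "(\<lambda>(t, x). indicator {0<..<1} t * D t x) \<in> borel_measurable (borel \<Otimes>\<^sub>M borel)"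
proof -
  \<comment> \<open>the nearest point of the unit interval\<close>
  define c where "c = (\<lambda>t::real. max 0 (min 1 t))"
  have c: "c t \<in> {0..1}" for t by (auto simp: c_def)
  have cc: "continuous_on UNIV c" unfolding c_def by (intro continuous_intros)
  have contF: "continuous_on {0..1} (\<lambda>t. F t x)" for x
    using deriv DERIV_continuous unfolding continuous_on_eq_continuous_within by blast
  have G[measurable]: "(\<lambda>(t, x). F (c t) x) \<in> borel_measurable (borel \<Otimes>\<^sub>M borel)"
  proof (rule borel_measurable_caratheodory)
    show "F (c t) \<in> borel_measurable borel" for t by (rule meas[OF c])
    show "continuous_on UNIV (\<lambda>t. F (c t) x)" for x
      using c by (intro continuous_on_compose2[OF contF cc]) auto
  qed
  have G2[measurable]: "(\<lambda>(t, x). F (c (t + a)) x) \<in> borel_measurable (borel \<Otimes>\<^sub>M borel)" for a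
  proof -
    have "(\<lambda>z. (fst z + a, snd z)) \<in> borel \<Otimes>\<^sub>M borel \<rightarrow>\<^sub>M borel \<Otimes>\<^sub>M (borel :: 'a measure)" by measurable
    from measurable_compose[OF this G] show ?thesis by (simp add: split_beta')
  qed
  show ?thesis
  proof (rule borel_measurable_LIMSEQ_real)
    fix k :: nat
    show "(\<lambda>(t, x). indicator {0<..<1} t *
          ((F (c (t + inverse (real (Suc k)))) x - F (c t) x) / inverse (real (Suc k))))
        \<in> borel_measurable (borel \<Otimes>\<^sub>M (borel :: 'a measure))"
      using G2[of "inverse (real (Suc k))"] G by (simp add: split_beta') measurable
  next
    fix z :: "real \<times> 'a"
    obtain t x where z: "z = (t, x)" by force
    show "(\<lambda>k. case z of (t, x) \<Rightarrow> indicator {0<..<1} t *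
          ((F (c (t + inverse (real (Suc k)))) x - F (c t) x) / inverse (real (Suc k))))
        \<longlonglongrightarrow> (case z of (t, x) \<Rightarrow> indicator {0<..<1} t * D t x)"
    proof (cases "t \<in> {0<..<1}")
      case True
      have "((\<lambda>t. F t x) has_real_derivative D t x) (at t)"
        using deriv[of t x] True at_within_Icc_at[of 0 t 1] by simp
      moreover have "\<forall>\<^sub>F u in nhds t. F u x = F (c u) x"
        using True by (intro eventually_nhds_in_open[of "{0<..<1}", THEN eventually_mono])
          (auto simp: c_def)
      ultimately have "((\<lambda>t. F (c t) x) has_real_derivative D t x) (at t)"
        using DERIV_cong_ev[of t t "\<lambda>t. F t x" "\<lambda>t. F (c t) x" "D t x" "D t x"] by simp
      then have "((\<lambda>a. (F (c (t + a)) x - F (c t) x) / a) \<longlongrightarrow> D t x) (at 0)"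
        by (simp add: DERIV_def)
      moreover have "filterlim (\<lambda>k. inverse (real (Suc k))) (at 0) sequentially"
        by (intro filterlim_atI LIMSEQ_inverse_real_of_nat) auto
      ultimately have "(\<lambda>k. (F (c (t + inverse (real (Suc k)))) x - F (c t) x) / inverse (real (Suc k)))
          \<longlonglongrightarrow> D t x"
        by (rule filterlim_compose)
      then show ?thesis using True by (simp add: z)
    qed (simp add: z)
  qed
qed

section \<open>Divergence, Jacobian and operator norm\<close>

lemma divergence_eq_sum:
  assumes "(F has_derivative F') (at x)"
  shows "divergence F x = (\<Sum>i\<in>UNIV. F' (axis i 1) $ i)"
  using frechet_derivative_at[OF assms]
  by (simp add: divergence_def trace_def jacobian_def matrix_def)

lemma divergence_add:
  assumes "F differentiable (at x)" "G differentiable (at x)"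
  shows "divergence (\<lambda>y. F y + G y) x = divergence F x + divergence G x"
proof -
  obtain F' G' where d: "(F has_derivative F') (at x)" "(G has_derivative G') (at x)"
    using assms unfolding differentiable_def by blast
  show ?thesis
    unfolding divergence_eq_sum[OF has_derivative_add[OF d]] divergence_eq_sum[OF d(1)]
      divergence_eq_sum[OF d(2)] by (simp add: sum.distrib)
qed

lemma divergence_mult:
  assumes p: "GDERIV p x :> p'" and F: "F differentiable (at x)"
  shows "divergence (\<lambda>y. p y *\<^sub>R F y) x = p x * divergence F x + p' \<bullet> F x"
proof -
  obtain F' where d: "(F has_derivative F') (at x)"
    using F unfolding differentiable_def by blast
  have "((\<lambda>y. p y *\<^sub>R F y) has_derivative (\<lambda>h. p x *\<^sub>R F' h + (h \<bullet> p') *\<^sub>R F x)) (at x)"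
    using has_derivative_scaleR[OF p[unfolded gderiv_def] d] .
  from divergence_eq_sum[OF this] show ?thesis
    by (simp add: divergence_eq_sum[OF d] sum.distrib sum_distrib_left inner_vec_def[of p' "F x"]
        inner_axis' )
qed

lemma divergence_cmult:
  assumes "F differentiable (at x)"
  shows "divergence (\<lambda>y. c *\<^sub>R F y) x = c * divergence F x"
  using divergence_mult[OF _ assms, of "\<lambda>_. c" 0] by (simp add: GDERIV_const)

lemma divergence_id: "divergence (\<lambda>y. y) (x :: real^'n) = real CARD('n)"
  by (simp add: divergence_eq_sum[OF has_derivative_ident])

lemma abs_component_le_op_norm: "\<bar>(A :: real^'n^'n) $ i $ j\<bar> \<le> op_norm A"
proof -
  have "\<bar>A $ i $ j\<bar> = \<bar>(A *v axis j 1) $ i\<bar>"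
    by (simp add: matrix_vector_mult_basis column_def)
  also have "\<dots> \<le> norm (A *v axis j 1)" by (rule component_le_norm_cart)
  also have "\<dots> \<le> op_norm A * norm (axis j (1::real) :: real^'n)"
    unfolding op_norm_def by (rule onorm) (simp add: matrix_vector_mul_bounded_linear)
  finally show ?thesis by simp
qed

lemma abs_trace_le_op_norm: "\<bar>trace (A :: real^'n^'n)\<bar> \<le> real CARD('n) * op_norm A"
proof -
  have "\<bar>trace A\<bar> \<le> (\<Sum>i\<in>UNIV. \<bar>A $ i $ i\<bar>)" unfolding trace_def by (rule sum_abs)
  also have "\<dots> \<le> (\<Sum>i\<in>(UNIV::'n set). op_norm A)" by (intro sum_mono abs_component_le_op_norm)
  finally show ?thesis by simp
qed

lemma has_real_derivative_component:
  assumes "(F has_derivative F') (at x)"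
  shows "((\<lambda>r. (F (x + r *\<^sub>R e) :: real^'n) $ i) has_real_derivative F' e $ i) (at 0)"
proof -
  have l: "((\<lambda>r::real. x + r *\<^sub>R e) has_derivative (\<lambda>r. r *\<^sub>R e)) (at 0)"
    by (auto intro!: derivative_eq_intros)
  have "((\<lambda>r. F (x + r *\<^sub>R e)) has_derivative (\<lambda>r. F' (r *\<^sub>R e))) (at 0)"
    using has_derivative_compose[OF l, of F F'] assms by simp
  then have "((\<lambda>r. F (x + r *\<^sub>R e) $ i) has_derivative (\<lambda>r. F' (r *\<^sub>R e) $ i)) (at 0)"
    by (rule bounded_linear.has_derivative[OF bounded_linear_vec_nth])
  then show ?thesis
    using linear_scale[OF has_derivative_linear[OF assms], of _ e]
    by (simp add: has_field_derivative_def mult_commute_abs)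
qed

lemma borel_measurable_jacobian_diag:
  fixes F :: "real^'n \<Rightarrow> real^'n"
  assumes diff: "\<And>x. F differentiable (at x)"
  shows "(\<lambda>x. jacobian F (at x) $ i $ i) \<in> borel_measurable borel"
    and "((\<lambda>r. F (x + r *\<^sub>R axis i 1) $ i) has_real_derivative jacobian F (at x) $ i $ i) (at 0)"
    and "continuous_on UNIV (\<lambda>x. F x $ i)"
proof -
  have contF: "continuous_on UNIV F"
    using diff by (meson continuous_at_imp_continuous_on differentiable_imp_continuous_within)
  show cont: "continuous_on UNIV (\<lambda>x. F x $ i)"
    by (intro continuous_intros contF)
  have deriv: "((\<lambda>r. F (x + r *\<^sub>R axis i 1) $ i) has_real_derivative jacobian F (at x) $ i $ i) (at 0)" for x
    using has_real_derivative_component[OF frechet_derivative_works[THEN iffD1, OF diff], of x "axis i 1" i]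
    by (simp add: jacobian_def matrix_def)
  then show "((\<lambda>r. F (x + r *\<^sub>R axis i 1) $ i) has_real_derivative jacobian F (at x) $ i $ i) (at 0)" .
  show "(\<lambda>x. jacobian F (at x) $ i $ i) \<in> borel_measurable borel"
    by (rule borel_measurable_line_derivative[OF borel_measurable_continuous_onI[OF cont] deriv])
qed

lemma borel_measurable_divergence:
  assumes "\<And>x. F differentiable (at x)"
  shows "divergence F \<in> borel_measurable borel"
proof -
  have "divergence F = (\<lambda>x. \<Sum>i\<in>UNIV. jacobian F (at x) $ i $ i)"
    by (auto simp: divergence_def trace_def)
  then show ?thesis using borel_measurable_jacobian_diag(1)[OF assms] by simp
qed

text \<open>Only the diagonal of the Jacobian matters: each term of the divergence integrates to zero separately,
along its own coordinate axis.\<close>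

lemma integral_divergence_eq_0:
  fixes F :: "real^'n \<Rightarrow> real^'n"
  assumes diff: "\<And>x. F differentiable (at x)" and g: "integrable lborel g"
    and F: "\<And>x i. \<bar>F x $ i\<bar> \<le> g x"
    and J: "\<And>x i. \<bar>jacobian F (at x) $ i $ i\<bar> \<le> g x"
  shows "integrable lborel (divergence F)" "(\<integral>x. divergence F x \<partial>lborel) = 0"
proof -
  note m = borel_measurable_jacobian_diag(1)[OF diff]
    and deriv = borel_measurable_jacobian_diag(2)[OF diff]
    and cont = borel_measurable_jacobian_diag(3)[OF diff]
  have int: "integrable lborel (\<lambda>x. jacobian F (at x) $ i $ i)" for i
    by (rule Bochner_Integration.integrable_bound[OF g]) (use m order_trans[OF J abs_ge_self] in auto)
  have "integrable lborel (\<lambda>x. F x $ i)" for i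
    by (rule Bochner_Integration.integrable_bound[OF g])
      (use borel_measurable_continuous_onI[OF cont] order_trans[OF F abs_ge_self] in auto)
  then have z: "(\<integral>x. jacobian F (at x) $ i $ i \<partial>lborel) = 0" for i
    by (rule integral_line_derivative_eq_0_off_finite[OF _ int cont, of _ "axis i 1" "{}"]) (auto intro: deriv)
  have eq: "divergence F = (\<lambda>x. \<Sum>i\<in>UNIV. jacobian F (at x) $ i $ i)"
    by (auto simp: divergence_def trace_def)
  show "integrable lborel (divergence F)" unfolding eq using int by simp
  show "(\<integral>x. divergence F x \<partial>lborel) = 0" unfolding eq using int z by simp
qed

lemma gderiv_of_ln:
  assumes "\<And>y. p y > 0" "GDERIV (\<lambda>y. ln (p y)) x :> v"
  shows "GDERIV p x :> p x *\<^sub>R v"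
proof -
  have "GDERIV (\<lambda>y. exp (ln (p y))) x :> exp (ln (p x)) *\<^sub>R v"
    by (rule GDERIV_DERIV_compose[OF assms(2)]) simp
  then show ?thesis using assms(1) by simp
qed

lemma gderiv_imp_continuous:
  assumes "\<And>x. GDERIV p x :> D x"
  shows "continuous_on UNIV p"
  using assms unfolding gderiv_def
  by (meson continuous_at_imp_continuous_on has_derivative_continuous)

lemma jacobian_mult_diag:
  assumes p: "GDERIV p x :> p'" and F: "F differentiable (at x)"
  shows "jacobian (\<lambda>y. p y *\<^sub>R F y) (at x) $ i $ i = p x * jacobian F (at x) $ i $ i + p' $ i * F x $ i"
proof -
  obtain F' where d: "(F has_derivative F') (at x)"
    using F unfolding differentiable_def by blast
  have "((\<lambda>y. p y *\<^sub>R F y) has_derivative (\<lambda>h. p x *\<^sub>R F' h + (h \<bullet> p') *\<^sub>R F x)) (at x)"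
    using has_derivative_scaleR[OF p[unfolded gderiv_def] d] .
  from frechet_derivative_at[OF this, symmetric] frechet_derivative_at[OF d, symmetric] show ?thesis
    by (simp add: jacobian_def matrix_def inner_axis')
qed

lemma jacobian_diff:
  assumes "F differentiable (at x)" "G differentiable (at x)"
  shows "jacobian (\<lambda>y. F y - G y) (at x) = jacobian F (at x) - jacobian G (at x)"
proof -
  obtain F' G' where d: "(F has_derivative F') (at x)" "(G has_derivative G') (at x)"
    using assms unfolding differentiable_def by blast
  show ?thesis
    using frechet_derivative_at[OF has_derivative_diff[OF d], symmetric]
      frechet_derivative_at[OF d(1), symmetric] frechet_derivative_at[OF d(2), symmetric]
    by (simp add: jacobian_def matrix_def vec_eq_iff)
qed

lemma differentiable_cancel_scaleR:
  assumes "GDERIV p x :> p'" "p x \<noteq> 0" "(\<lambda>y. p y *\<^sub>R F y) differentiable (at x)"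
    and "\<And>y. p y \<noteq> 0"
  shows "F differentiable (at x)"
proof -
  have "p differentiable (at x)" using assms(1) unfolding gderiv_def differentiable_def by blast
  then have "(\<lambda>y. inverse (p y) *\<^sub>R (p y *\<^sub>R F y)) differentiable (at x)"
    using assms(2) by (intro differentiable_scaleR[OF differentiable_inverse assms(3)])
  then show ?thesis using assms(4) by simp
qed

lemma op_norm_diff_le: "op_norm (A - B) \<le> op_norm A + op_norm (B :: real^'n^'n)"
proof -
  have bl: "bounded_linear (\<lambda>v. A *v v)" for A :: "real^'n^'n" by (rule matrix_vector_mul_bounded_linear)
  have "op_norm (A - B) \<le> onorm (\<lambda>v. A *v v) + onorm (\<lambda>v. - (B *v v))"
    unfolding op_norm_def matrix_vector_mult_diff_rdistrib
    using onorm_triangle[OF bl[of A] bounded_linear_minus[OF bl[of B]]] by simp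
  then show ?thesis by (simp add: op_norm_def onorm_neg)
qed

lemma op_norm_nonneg: "op_norm (A :: real^'n^'n) \<ge> 0"
  unfolding op_norm_def by (intro onorm_pos_le matrix_vector_mul_bounded_linear)

section \<open>Stability in \<open>L\<^sup>1\<close> of the continuity equation\<close>

text \<open>The function \<open>B = sqrt ((a - b)\<^sup>2 + (\<epsilon> b)\<^sup>2)\<close> replaces \<open>|a - b|\<close>. Smoothing by a multiple of
\<open>b\<close> rather than by a constant keeps \<open>B\<close> positively homogeneous of degree one in \<open>(a, b)\<close>, so by
Euler's identity \<open>B\<close> solves every transport equation that both \<open>a\<close> and \<open>b\<close> solve, without a
remainder involving the divergence of the field; it is also integrable whenever \<open>a\<close> and \<open>b\<close> are.\<close>

lemma smoothed_distance_has_derivative: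
  fixes a b :: "'a::real_normed_vector \<Rightarrow> real"
  assumes "(a has_derivative a') (at x within S)" "(b has_derivative b') (at x within S)"
    and "b x > 0" "\<epsilon> > 0"
  defines "B \<equiv> \<lambda>y. sqrt ((a y - b y)\<^sup>2 + (\<epsilon> * b y)\<^sup>2)"
  shows "(B has_derivative (\<lambda>h. (a x - b x) / B x * (a' h - b' h) + \<epsilon> * (\<epsilon> * b x / B x) * b' h)) (at x within S)"
proof -
  have pos: "(a x - b x)\<^sup>2 + (\<epsilon> * b x)\<^sup>2 > 0" using assms by (intro add_nonneg_pos) auto
  have "((\<lambda>y. (a y - b y)\<^sup>2 + (\<epsilon> * b y)\<^sup>2) has_derivative
      (\<lambda>h. 2 * ((a x - b x) * (a' h - b' h) + \<epsilon> * (\<epsilon> * b x) * b' h))) (at x within S)"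
    by (auto intro!: derivative_eq_intros assms(1,2) simp: algebra_simps power2_eq_square)
  from DERIV_compose_FDERIV[OF DERIV_real_sqrt[OF pos] this] show ?thesis
    unfolding B_def
  proof (rule has_derivative_eq_rhs)
    have alg: "2 * (u * v + \<epsilon> * w * z) * (inverse r / 2) = u / r * v + \<epsilon> * (w / r) * z" for u v w z r :: real
      by (cases "r = 0") (simp_all add: field_simps)
    show "(\<lambda>h. 2 * ((a x - b x) * (a' h - b' h) + \<epsilon> * (\<epsilon> * b x) * b' h) *
        (inverse (sqrt ((a x - b x)\<^sup>2 + (\<epsilon> * b x)\<^sup>2)) / 2)) =
      (\<lambda>h. (a x - b x) / sqrt ((a x - b x)\<^sup>2 + (\<epsilon> * b x)\<^sup>2) * (a' h - b' h) +
        \<epsilon> * (\<epsilon> * b x / sqrt ((a x - b x)\<^sup>2 + (\<epsilon> * b x)\<^sup>2)) * b' h)"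
      by (rule ext, rule alg)
  qed
qed

text \<open>With \<open>B = sqrt ((q' - q)\<^sup>2 + (\<epsilon> q)\<^sup>2)\<close> one has
\<open>\<partial>\<^sub>t B + \<nabla>\<cdot>(B v) = -\<theta> \<nabla>\<cdot>(q' (v' - v))\<close> where \<open>\<theta> = (q' - q) / B\<close> lies in \<open>[-1, 1]\<close>.
Integrated over space and time the flux \<open>\<nabla>\<cdot>(B v)\<close> disappears, so the integral of \<open>B\<close> at time 0
exceeds the one at time 1, which is \<open>\<epsilon>\<close> times a mass, by at most \<open>M\<close>. Then \<open>\<epsilon>\<close> tends to 0.

The growth conditions and second moments provide the integrable majorants: a multiple of
\<open>(q + q') (1 + |x|)\<^sup>2\<close> dominates \<open>\<partial>\<^sub>t q\<close>, \<open>\<partial>\<^sub>t q'\<close>, \<open>B v\<close> and its partial derivatives.\<close>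

lemma continuity_equation_L1_stability:
  fixes q q' :: "real^'n \<Rightarrow> real \<Rightarrow> real" and v v' s s' :: "real^'n \<Rightarrow> real \<Rightarrow> real^'n"
  assumes score: "is_score q s" "is_score q' s'"
    and ce: "continuity_equation q v" "continuity_equation q' v'"
    and terminal: "\<And>x. q' x 1 = q x 1"
    and moment: "\<And>t. t \<in> {0..1} \<Longrightarrow> integrable lborel (\<lambda>x. q x t * (1 + norm x)\<^sup>2)"
      "\<And>t. t \<in> {0..1} \<Longrightarrow> integrable lborel (\<lambda>x. q' x t * (1 + norm x)\<^sup>2)"
      "\<And>t. t \<in> {0..1} \<Longrightarrow> (\<integral>x. q x t * (1 + norm x)\<^sup>2 \<partial>lborel) \<le> C"
      "\<And>t. t \<in> {0..1} \<Longrightarrow> (\<integral>x. q' x t * (1 + norm x)\<^sup>2 \<partial>lborel) \<le> C"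
    and growth: "\<And>t x. t \<in> {0..1} \<Longrightarrow> norm (s x t) \<le> C * (1 + norm x)"
      "\<And>t x. t \<in> {0..1} \<Longrightarrow> norm (s' x t) \<le> C * (1 + norm x)"
      "\<And>t x. t \<in> {0..1} \<Longrightarrow> norm (v x t) \<le> C * (1 + norm x)"
      "\<And>t x. t \<in> {0..1} \<Longrightarrow> norm (v' x t) \<le> C * (1 + norm x)"
      "\<And>t x i. t \<in> {0..1} \<Longrightarrow> \<bar>jacobian (\<lambda>y. v y t) (at x) $ i $ i\<bar> \<le> C"
      "\<And>t x. t \<in> {0..1} \<Longrightarrow> \<bar>divergence (\<lambda>y. v' y t) x\<bar> \<le> C * (1 + norm x)"
    and source: "\<And>t. t \<in> {0..1} \<Longrightarrow>
        integrable lborel (divergence (\<lambda>y. q' y t *\<^sub>R (v' y t - v y t)))"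
      "\<And>t. t \<in> {0..1} \<Longrightarrow>
        (\<integral>x. \<bar>divergence (\<lambda>y. q' y t *\<^sub>R (v' y t - v y t)) x\<bar> \<partial>lborel) \<le> M"
  shows "(\<integral>x. \<bar>q' x 0 - q x 0\<bar> \<partial>lborel) \<le> M"
proof -
  have C: "C \<ge> 0" using order_trans[OF norm_ge_zero growth(1)[of 0 0]] by simp
  have pos: "q x t > 0" "q' x t > 0" if "t \<in> {0..1}" for x t
    using score that unfolding is_score_def by auto
  have gq: "GDERIV (\<lambda>y. q y t) x :> q x t *\<^sub>R s x t"
    and gq': "GDERIV (\<lambda>y. q' y t) x :> q' x t *\<^sub>R s' x t" if "t \<in> {0..1}" for x t
    using score that unfolding is_score_def by (auto intro!: gderiv_of_ln)
  have tq: "((\<lambda>\<tau>. q x \<tau>) has_real_derivative - divergence (\<lambda>y. q y t *\<^sub>R v y t) x) (at t within {0..1})"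
    and tq': "((\<lambda>\<tau>. q' x \<tau>) has_real_derivative - divergence (\<lambda>y. q' y t *\<^sub>R v' y t) x) (at t within {0..1})"
    if "t \<in> {0..1}" for x t
    using ce that unfolding continuity_equation_def by auto
  have dv: "(\<lambda>y. v y t) differentiable (at x)" and dv': "(\<lambda>y. v' y t) differentiable (at x)"
    if t: "t \<in> {0..1}" for x t
  proof -
    have 1: "(\<lambda>y. q y t *\<^sub>R v y t) differentiable (at x)" "(\<lambda>y. q' y t *\<^sub>R v' y t) differentiable (at x)"
      using ce t unfolding continuity_equation_def by auto
    have nz: "q y t \<noteq> 0" "q' y t \<noteq> 0" for y using pos[OF t, of y] by linarith+
    show "(\<lambda>y. v y t) differentiable (at x)"
      by (rule differentiable_cancel_scaleR[OF gq[OF t] nz(1) 1(1) nz(1)])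
    show "(\<lambda>y. v' y t) differentiable (at x)"
      by (rule differentiable_cancel_scaleR[OF gq'[OF t] nz(2) 1(2) nz(2)])
  qed
  have cq: "continuous_on UNIV (\<lambda>x. q x t)" "continuous_on UNIV (\<lambda>x. q' x t)" if "t \<in> {0..1}" for t
    using gderiv_imp_continuous[OF gq[OF that]] gderiv_imp_continuous[OF gq'[OF that]] by auto
  define N where "N = real CARD('n)"
  have N: "N \<ge> 1" by (simp add: N_def Suc_leI)
  define Q where "Q = (N + 1) * C + C\<^sup>2"
  have Q: "Q \<ge> 0" using C N by (simp add: Q_def)
  have w1: "1 + norm x \<le> (1 + norm x)\<^sup>2" "1 \<le> (1 + norm x)\<^sup>2" for x :: "real^'n"
    by (auto simp: power2_eq_square algebra_simps)
  define \<mu> where "\<mu> = (\<lambda>x t. (q x t + q' x t) * (1 + norm x)\<^sup>2)"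
  have \<mu>: "integrable lborel (\<lambda>x. \<mu> x t)" "(\<integral>x. \<mu> x t \<partial>lborel) \<le> 2 * C" if "t \<in> {0..1}" for t
    using moment[OF that] by (auto simp: \<mu>_def distrib_right)
  have inner_le: "\<bar>a \<bullet> b\<bar> \<le> C\<^sup>2 * (1 + norm x)\<^sup>2"
    if "norm a \<le> C * (1 + norm x)" "norm b \<le> C * (1 + norm x)" for a b x :: "real^'n"
  proof -
    have "\<bar>a \<bullet> b\<bar> \<le> norm a * norm b" by (rule Cauchy_Schwarz_ineq2)
    also have "\<dots> \<le> (C * (1 + norm x)) * (C * (1 + norm x))"
      using that C by (intro mult_mono) auto
    finally show ?thesis by (simp add: power2_eq_square mult_ac)
  qed
  have tq_le: "\<bar>divergence (\<lambda>y. q y t *\<^sub>R v y t) x\<bar> \<le> q x t * (Q * (1 + norm x)\<^sup>2)" if t: "t \<in> {0..1}" for x t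
  proof -
    have "\<bar>divergence (\<lambda>y. v y t) x\<bar> \<le> (\<Sum>i\<in>UNIV. \<bar>jacobian (\<lambda>y. v y t) (at x) $ i $ i\<bar>)"
      unfolding divergence_def trace_def by (rule sum_abs)
    also have "\<dots> \<le> (\<Sum>i\<in>(UNIV :: 'n set). C)" by (intro sum_mono growth(5)[OF t])
    finally have "\<bar>divergence (\<lambda>y. v y t) x\<bar> \<le> N * C" by (simp add: N_def)
    also have "\<dots> \<le> (N * C) * (1 + norm x)\<^sup>2"
      using mult_left_mono[OF w1(2)[of x], of "N * C"] N C by simp
    finally have "\<bar>divergence (\<lambda>y. v y t) x + s x t \<bullet> v x t\<bar> \<le> (N * C) * (1 + norm x)\<^sup>2 + C\<^sup>2 * (1 + norm x)\<^sup>2"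
      using inner_le[OF growth(1)[OF t, of x] growth(3)[OF t, of x]] by linarith
    also have "\<dots> \<le> Q * (1 + norm x)\<^sup>2"
      using C by (simp add: Q_def distrib_right[symmetric] mult_right_mono)
    finally have "q x t * \<bar>divergence (\<lambda>y. v y t) x + s x t \<bullet> v x t\<bar> \<le> q x t * (Q * (1 + norm x)\<^sup>2)"
      using pos(1)[OF t, of x] by (intro mult_left_mono) auto
    moreover have "divergence (\<lambda>y. q y t *\<^sub>R v y t) x = q x t * (divergence (\<lambda>y. v y t) x + s x t \<bullet> v x t)"
      using divergence_mult[OF gq[OF t] dv[OF t]] by (simp add: distrib_left)
    ultimately show ?thesis using pos(1)[OF t, of x] by (simp add: abs_mult)
  qed
  have tq'_le: "\<bar>divergence (\<lambda>y. q' y t *\<^sub>R v' y t) x\<bar> \<le> q' x t * (Q * (1 + norm x)\<^sup>2)" if t: "t \<in> {0..1}" for x t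
  proof -
    have "C * (1 + norm x) \<le> C * (1 + norm x)\<^sup>2" using w1(1)[of x] C by (intro mult_left_mono) auto
    then have "\<bar>divergence (\<lambda>y. v' y t) x + s' x t \<bullet> v' x t\<bar> \<le> C * (1 + norm x)\<^sup>2 + C\<^sup>2 * (1 + norm x)\<^sup>2"
      using inner_le[OF growth(2)[OF t, of x] growth(4)[OF t, of x]] growth(6)[OF t, of x] by linarith
    also have "\<dots> = (C + C\<^sup>2) * (1 + norm x)\<^sup>2" by (simp add: distrib_right)
    also have "\<dots> \<le> Q * (1 + norm x)\<^sup>2"
      using C N by (intro mult_right_mono) (auto simp: Q_def distrib_right)
    finally have "q' x t * \<bar>divergence (\<lambda>y. v' y t) x + s' x t \<bullet> v' x t\<bar> \<le> q' x t * (Q * (1 + norm x)\<^sup>2)"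
      using pos(2)[OF t, of x] by (intro mult_left_mono) auto
    moreover have "divergence (\<lambda>y. q' y t *\<^sub>R v' y t) x = q' x t * (divergence (\<lambda>y. v' y t) x + s' x t \<bullet> v' x t)"
      using divergence_mult[OF gq'[OF t] dv'[OF t]] by (simp add: distrib_left)
    ultimately show ?thesis using pos(2)[OF t, of x] by (simp add: abs_mult)
  qed
  have intq: "integrable lborel (\<lambda>x. q x t)" "integrable lborel (\<lambda>x. q' x t)" if t: "t \<in> {0..1}" for t
  proof -
    have le: "q x t \<le> \<mu> x t" "q' x t \<le> \<mu> x t" for x
    proof -
      have "(q x t + q' x t) * 1 \<le> \<mu> x t"
        unfolding \<mu>_def using pos[OF t, of x] w1(2)[of x] by (intro mult_left_mono) auto
      then show "q x t \<le> \<mu> x t" "q' x t \<le> \<mu> x t" using pos[OF t, of x] by auto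
    qed
    have "norm (q x t) \<le> norm (\<mu> x t)" "norm (q' x t) \<le> norm (\<mu> x t)" for x
      using le[of x] pos[OF t, of x] by auto
    then show "integrable lborel (\<lambda>x. q x t)" "integrable lborel (\<lambda>x. q' x t)"
      using borel_measurable_continuous_onI[OF cq(1)[OF t]] borel_measurable_continuous_onI[OF cq(2)[OF t]]
      by (auto intro!: Bochner_Integration.integrable_bound[OF \<mu>(1)[OF t]] AE_I2)
  qed
  have eps: "(\<integral>x. \<bar>q' x 0 - q x 0\<bar> \<partial>lborel) \<le> \<epsilon> * (\<integral>x. q x 1 \<partial>lborel) + M" if \<epsilon>: "0 < \<epsilon>" "\<epsilon> \<le> 1" for \<epsilon>
  proof -
    define B where "B = (\<lambda>x t. sqrt ((q' x t - q x t)\<^sup>2 + (\<epsilon> * q x t)\<^sup>2))"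
    define \<theta> where "\<theta> = (\<lambda>x t. (q' x t - q x t) / B x t)"
    define \<eta> where "\<eta> = (\<lambda>x t. \<epsilon> * q x t / B x t)"
    have Bpos: "B x t > 0" if "t \<in> {0..1}" for x t
      using pos[OF that, of x] \<epsilon> by (auto simp: B_def intro!: add_nonneg_pos)
    have B_ge: "\<bar>q' x t - q x t\<bar> \<le> B x t" "\<bar>\<epsilon> * q x t\<bar> \<le> B x t" for x t
      by (auto simp: B_def intro!: real_le_rsqrt)
    have \<theta>: "\<bar>\<theta> x t\<bar> \<le> 1" and \<eta>: "\<bar>\<eta> x t\<bar> \<le> 1" if "t \<in> {0..1}" for x t
      using B_ge[of x t] Bpos[OF that, of x] by (simp_all add: \<theta>_def \<eta>_def abs_divide)
    have B_eq: "B x t = \<theta> x t * (q' x t - q x t) + \<epsilon> * \<eta> x t * q x t" if "t \<in> {0..1}" for x t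
    proof -
      have "B x t * B x t = (q' x t - q x t)\<^sup>2 + (\<epsilon> * q x t)\<^sup>2" by (simp add: B_def)
      then have "B x t = ((q' x t - q x t)\<^sup>2 + (\<epsilon> * q x t)\<^sup>2) / B x t"
        using Bpos[OF that, of x] by (metis less_irrefl nonzero_mult_div_cancel_left)
      then show ?thesis by (simp add: \<theta>_def \<eta>_def add_divide_distrib power2_eq_square mult_ac)
    qed
    define gB where "gB = (\<lambda>x t. \<theta> x t *\<^sub>R (q' x t *\<^sub>R s' x t - q x t *\<^sub>R s x t) + (\<epsilon> * \<eta> x t) *\<^sub>R (q x t *\<^sub>R s x t))"
    have gB: "GDERIV (\<lambda>y. B y t) x :> gB x t" if t: "t \<in> {0..1}" for x t
      unfolding gderiv_def B_def
      by (rule has_derivative_eq_rhs[OF smoothed_distance_has_derivative[OF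
            gq'[OF t, unfolded gderiv_def] gq[OF t, unfolded gderiv_def] pos(1)[OF t] \<epsilon>(1)]])
        (simp add: gB_def \<theta>_def \<eta>_def B_def inner_add_right inner_diff_right mult.assoc)
    define D where "D = (\<lambda>t x. \<theta> x t * (divergence (\<lambda>y. q y t *\<^sub>R v y t) x - divergence (\<lambda>y. q' y t *\<^sub>R v' y t) x)
        - \<epsilon> * \<eta> x t * divergence (\<lambda>y. q y t *\<^sub>R v y t) x)"
    have tB: "((\<lambda>\<tau>. B x \<tau>) has_real_derivative D t x) (at t within {0..1})" if t: "t \<in> {0..1}" for x t
      unfolding has_field_derivative_def B_def
      by (rule has_derivative_eq_rhs[OF smoothed_distance_has_derivative[OF
            tq'[OF t, unfolded has_field_derivative_def] tq[OF t, unfolded has_field_derivative_def] pos(1)[OF t] \<epsilon>(1)]])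
        (auto simp: D_def \<theta>_def \<eta>_def B_def algebra_simps)
    have Bcont: "continuous_on UNIV (\<lambda>x. B x t)" if "t \<in> {0..1}" for t
      using gderiv_imp_continuous[OF gB[OF that]] .
    \<comment> \<open>Euler's identity for \<open>B\<close> makes the terms with the divergence of \<open>v\<close> cancel exactly.\<close>
    have transport: "D t x = - divergence (\<lambda>y. B y t *\<^sub>R v y t) x
        - \<theta> x t * divergence (\<lambda>y. q' y t *\<^sub>R (v' y t - v y t)) x" if t: "t \<in> {0..1}" for x t
    proof -
      let ?dv = "divergence (\<lambda>y. v y t) x"
      have dvm: "(\<lambda>y. - 1 *\<^sub>R v y t) differentiable (at x)"
        by (intro differentiable_scaleR differentiable_const dv[OF t])
      have dvd: "(\<lambda>y. v' y t - v y t) differentiable (at x)"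
        by (intro differentiable_diff dv[OF t] dv'[OF t])
      have "divergence (\<lambda>y. v' y t - v y t) x = divergence (\<lambda>y. v' y t + - 1 *\<^sub>R v y t) x" by simp
      also have "\<dots> = divergence (\<lambda>y. v' y t) x - ?dv"
        by (subst divergence_add[OF dv'[OF t] dvm]) (subst divergence_cmult[OF dv[OF t]], simp)
      finally have dd: "divergence (\<lambda>y. v' y t - v y t) x = divergence (\<lambda>y. v' y t) x - ?dv" .
      have "divergence (\<lambda>y. B y t *\<^sub>R v y t) x = B x t * ?dv + gB x t \<bullet> v x t"
        by (rule divergence_mult[OF gB[OF t] dv[OF t]])
      also have "\<dots> = \<theta> x t * (q' x t * ?dv + q' x t * (s' x t \<bullet> v x t)
          - (q x t * ?dv + q x t * (s x t \<bullet> v x t)))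
          + \<epsilon> * \<eta> x t * (q x t * ?dv + q x t * (s x t \<bullet> v x t))"
        by (subst B_eq[OF t]) (simp add: gB_def inner_add_left inner_diff_left algebra_simps)
      finally have 1: "divergence (\<lambda>y. B y t *\<^sub>R v y t) x = \<dots>" .
      have 2: "divergence (\<lambda>y. q y t *\<^sub>R v y t) x = q x t * ?dv + q x t * (s x t \<bullet> v x t)"
        using divergence_mult[OF gq[OF t] dv[OF t]] by simp
      have 3: "divergence (\<lambda>y. q' y t *\<^sub>R v' y t) x = q' x t * divergence (\<lambda>y. v' y t) x + q' x t * (s' x t \<bullet> v' x t)"
        using divergence_mult[OF gq'[OF t] dv'[OF t]] by simp
      have 4: "divergence (\<lambda>y. q' y t *\<^sub>R (v' y t - v y t)) x
          = q' x t * (divergence (\<lambda>y. v' y t) x - ?dv) + q' x t * (s' x t \<bullet> v' x t - s' x t \<bullet> v x t)"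
        using divergence_mult[OF gq'[OF t] dvd] by (simp add: dd inner_diff_right right_diff_distrib)
      show ?thesis unfolding D_def 1 2 3 4 by (simp add: algebra_simps)
    qed
    have Ble: "B x t \<le> 2 * (q x t + q' x t)" if t: "t \<in> {0..1}" for x t
    proof -
      have "B x t = \<bar>\<theta> x t * (q' x t - q x t) + \<epsilon> * \<eta> x t * q x t\<bar>"
        using B_eq[OF t, of x] Bpos[OF t, of x] by simp
      also have "\<dots> \<le> \<bar>\<theta> x t\<bar> * \<bar>q' x t - q x t\<bar> + (\<epsilon> * \<bar>\<eta> x t\<bar>) * q x t"
        using abs_triangle_ineq[of "\<theta> x t * (q' x t - q x t)" "\<epsilon> * \<eta> x t * q x t"] \<epsilon> pos[OF t, of x]
        by (simp add: abs_mult)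
      also have "\<dots> \<le> 1 * (q' x t + q x t) + (1 * 1) * q x t"
        using \<theta>[OF t, of x] \<eta>[OF t, of x] \<epsilon> pos[OF t, of x]
        by (intro add_mono mult_mono) auto
      finally show ?thesis using pos[OF t, of x] by simp
    qed
    have flux: "integrable lborel (divergence (\<lambda>y. B y t *\<^sub>R v y t))"
      "(\<integral>x. divergence (\<lambda>y. B y t *\<^sub>R v y t) x \<partial>lborel) = 0" if t: "t \<in> {0..1}" for t
    proof -
      have gle: "norm (gB x t) \<le> 2 * (q x t + q' x t) * (C * (1 + norm x))" for x
      proof -
        have a: "norm (q x t *\<^sub>R s x t) \<le> q x t * (C * (1 + norm x))"
          "norm (q' x t *\<^sub>R s' x t) \<le> q' x t * (C * (1 + norm x))"
          using growth(1,2)[OF t, of x] pos[OF t, of x] by (auto intro: mult_left_mono)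
        have "norm (gB x t) \<le> \<bar>\<theta> x t\<bar> * norm (q' x t *\<^sub>R s' x t - q x t *\<^sub>R s x t)
            + (\<epsilon> * \<bar>\<eta> x t\<bar>) * norm (q x t *\<^sub>R s x t)"
          unfolding gB_def using \<epsilon> by (intro norm_triangle_le) (simp add: abs_mult)
        also have "\<dots> \<le> 1 * (q' x t * (C * (1 + norm x)) + q x t * (C * (1 + norm x)))
            + (1 * 1) * (q x t * (C * (1 + norm x)))"
          using \<theta>[OF t, of x] \<eta>[OF t, of x] \<epsilon> a
          by (intro add_mono mult_mono norm_triangle_le_diff) auto
        also have "\<dots> \<le> 2 * (q x t + q' x t) * (C * (1 + norm x))"
        proof -
          have "0 \<le> q' x t * (C * (1 + norm x))" using pos[OF t, of x] C by simp
          then show ?thesis by (simp add: algebra_simps)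
        qed
        finally show ?thesis .
      qed
      define g where "g = (\<lambda>x. 2 * (C + C\<^sup>2) * \<mu> x t)"
      have "\<bar>(B x t *\<^sub>R v x t) $ i\<bar> \<le> g x" for x i
      proof -
        have "\<bar>(B x t *\<^sub>R v x t) $ i\<bar> \<le> (2 * (q x t + q' x t)) * (C * (1 + norm x))"
          using Ble[OF t, of x] Bpos[OF t, of x] order_trans[OF component_le_norm_cart growth(3)[OF t, of x], of i]
          by (simp add: abs_mult) (intro mult_mono; simp)
        also have "\<dots> \<le> (2 * (q x t + q' x t)) * ((C + C\<^sup>2) * (1 + norm x)\<^sup>2)"
          using pos[OF t, of x] C w1(1)[of x] by (intro mult_left_mono mult_mono) auto
        finally show ?thesis by (simp add: g_def \<mu>_def algebra_simps)
      qed
      moreover have "\<bar>jacobian (\<lambda>y. B y t *\<^sub>R v y t) (at x) $ i $ i\<bar> \<le> g x" for x i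
      proof -
        have "\<bar>jacobian (\<lambda>y. B y t *\<^sub>R v y t) (at x) $ i $ i\<bar>
            \<le> B x t * \<bar>jacobian (\<lambda>y. v y t) (at x) $ i $ i\<bar> + \<bar>gB x t $ i\<bar> * \<bar>v x t $ i\<bar>"
          unfolding jacobian_mult_diag[OF gB[OF t] dv[OF t]]
          using abs_triangle_ineq[of "B x t * jacobian (\<lambda>y. v y t) (at x) $ i $ i" "gB x t $ i * v x t $ i"]
            Bpos[OF t, of x] by (simp add: abs_mult)
        also have "\<dots> \<le> (2 * (q x t + q' x t)) * (C * (1 + norm x)\<^sup>2)
            + (2 * (q x t + q' x t) * (C * (1 + norm x))) * (C * (1 + norm x))"
        proof (intro add_mono mult_mono)
          have "C * 1 \<le> C * (1 + norm x)\<^sup>2" using w1(2)[of x] C by (intro mult_left_mono) auto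
          then show "\<bar>jacobian (\<lambda>y. v y t) (at x) $ i $ i\<bar> \<le> C * (1 + norm x)\<^sup>2"
            using growth(5)[OF t, of x i] by linarith
          show "\<bar>gB x t $ i\<bar> \<le> 2 * (q x t + q' x t) * (C * (1 + norm x))"
            by (rule order_trans[OF component_le_norm_cart gle])
          show "\<bar>v x t $ i\<bar> \<le> C * (1 + norm x)"
            by (rule order_trans[OF component_le_norm_cart growth(3)[OF t]])
        qed (use Ble[OF t] Bpos[OF t, of x] pos[OF t, of x] C in auto)
        also have "\<dots> = g x" by (simp add: g_def \<mu>_def algebra_simps power2_eq_square)
        finally show ?thesis .
      qed
      moreover have "(\<lambda>y. B y t *\<^sub>R v y t) differentiable (at x)" for x
        using gB[OF t, of x] dv[OF t, of x] unfolding gderiv_def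
        by (intro differentiable_scaleR) (auto simp: differentiable_def)
      moreover have "integrable lborel g" using \<mu>(1)[OF t] by (simp add: g_def)
      ultimately show "integrable lborel (divergence (\<lambda>y. B y t *\<^sub>R v y t))"
        "(\<integral>x. divergence (\<lambda>y. B y t *\<^sub>R v y t) x \<partial>lborel) = 0"
        using integral_divergence_eq_0[of "\<lambda>y. B y t *\<^sub>R v y t" g] by auto
    qed
    define f where "f = (\<lambda>(t, x). indicator {0<..<1} t * D t x)"
    have fm [measurable]: "f \<in> borel_measurable (borel \<Otimes>\<^sub>M borel)"
      unfolding f_def
      by (rule borel_measurable_time_derivative[where F = "\<lambda>t x. B x t"])
        (auto intro: borel_measurable_continuous_onI[OF Bcont] tB)
    have D_le: "\<bar>D t x\<bar> \<le> 2 * Q * \<mu> x t" if t: "t \<in> {0..1}" for t x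
    proof -
      let ?a = "divergence (\<lambda>y. q y t *\<^sub>R v y t) x" and ?b = "divergence (\<lambda>y. q' y t *\<^sub>R v' y t) x"
      have "\<bar>D t x\<bar> \<le> \<bar>\<theta> x t\<bar> * \<bar>?a - ?b\<bar> + (\<epsilon> * \<bar>\<eta> x t\<bar>) * \<bar>?a\<bar>"
        unfolding D_def using \<epsilon> abs_triangle_ineq4[of "\<theta> x t * (?a - ?b)" "\<epsilon> * \<eta> x t * ?a"]
        by (simp add: abs_mult)
      also have "\<dots> \<le> 1 * (\<bar>?a\<bar> + \<bar>?b\<bar>) + (1 * 1) * \<bar>?a\<bar>"
        using \<theta>[OF t, of x] \<eta>[OF t, of x] \<epsilon> by (intro add_mono mult_mono) auto
      also have "\<dots> \<le> 2 * (q x t * (Q * (1 + norm x)\<^sup>2)) + 2 * (q' x t * (Q * (1 + norm x)\<^sup>2))"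
        using tq_le[OF t, of x] tq'_le[OF t, of x] abs_ge_zero[of ?b] unfolding mult_1 by linarith
      finally show ?thesis by (simp add: \<mu>_def algebra_simps)
    qed
    have fx: "integrable lborel (\<lambda>x. f (t, x))" for t
    proof (cases "t \<in> {0<..<1}")
      case True
      then have t: "t \<in> {0..1}" by auto
      show ?thesis
      proof (rule Bochner_Integration.integrable_bound)
        show "integrable lborel (\<lambda>x. 2 * Q * \<mu> x t)" using \<mu>(1)[OF t] by simp
        show "(\<lambda>x. f (t, x)) \<in> borel_measurable lborel" using measurable_Pair2[OF fm, of t] by simp
        show "AE x in lborel. norm (f (t, x)) \<le> norm (2 * Q * \<mu> x t)"
          using True order_trans[OF D_le[OF t] abs_ge_self] by (intro AE_I2) (simp add: f_def)
      qed
    qed (simp add: f_def)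
    have intf: "integrable (lborel \<Otimes>\<^sub>M lborel) f"
    proof (rule lborel_pair.Fubini_integrable)
      have le: "(\<integral>x. norm (f (t, x)) \<partial>lborel) \<le> (4 * Q * C) * indicator {0<..<1} t" for t
      proof (cases "t \<in> {0<..<1}")
        case True
        then have t: "t \<in> {0..1}" by auto
        have "(\<integral>x. norm (f (t, x)) \<partial>lborel) \<le> (\<integral>x. 2 * Q * \<mu> x t \<partial>lborel)"
          using True D_le[OF t] \<mu>(1)[OF t] integrable_norm[OF fx[of t]]
          by (intro integral_mono) (auto simp: f_def)
        also have "\<dots> = 2 * Q * (\<integral>x. \<mu> x t \<partial>lborel)" by simp
        also have "\<dots> \<le> 2 * Q * (2 * C)" using \<mu>(2)[OF t] Q by (intro mult_left_mono) auto
        finally show ?thesis using True by simp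
      qed (simp add: f_def)
      show "integrable lborel (\<lambda>t. \<integral>x. norm (f (t, x)) \<partial>lborel)"
        by (rule Bochner_Integration.integrable_bound[of _ "\<lambda>t. (4 * Q * C) * indicator {0<..<1} t"])
          (use order_trans[OF le abs_ge_self] in auto)
    qed (use fx in auto)
    have ft: "AE x in lborel. (\<integral>t. f (t, x) \<partial>lborel) = B x 1 - B x 0"
    proof -
      have "AE x in lborel. integrable lborel (\<lambda>t. f (t, x))"
        using lborel_pair.AE_integrable_snd[of "\<lambda>t x. f (t, x)"] intf by simp
      then show ?thesis
      proof eventually_elim
        case (elim x)
        have "((\<lambda>t. f (t, x)) has_integral (\<integral>t. f (t, x) \<partial>lborel)) UNIV"
          by (rule has_integral_integral_lborel[OF elim])
        moreover have "((\<lambda>t. D t x) has_integral (B x 1 - B x 0)) {0..1}"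
          by (rule fundamental_theorem_of_calculus)
            (use tB in \<open>auto simp: has_real_derivative_iff_has_vector_derivative\<close>)
        then have "((\<lambda>t. if t \<in> {0..1} then D t x else 0) has_integral (B x 1 - B x 0)) UNIV"
          by (rule iffD2[OF has_integral_restrict_UNIV])
        then have "((\<lambda>t. f (t, x)) has_integral (B x 1 - B x 0)) UNIV"
          by (rule has_integral_spike[rotated 2, where S = "{0, 1}"]) (auto simp: f_def indicator_def)
        ultimately show ?case by (rule has_integral_unique)
      qed
    qed
    have intB: "integrable lborel (\<lambda>x. B x t)" if t: "t \<in> {0..1}" for t
    proof (rule Bochner_Integration.integrable_bound)
      show "integrable lborel (\<lambda>x. 2 * (q x t + q' x t))" using intq[OF t] by simp
      show "(\<lambda>x. B x t) \<in> borel_measurable lborel"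
        using borel_measurable_continuous_onI[OF Bcont[OF t]] by simp
      show "AE x in lborel. norm (B x t) \<le> norm (2 * (q x t + q' x t))"
        using Ble[OF t] Bpos[OF t] by (intro AE_I2) (simp add: abs_of_pos order_trans[OF _ abs_ge_self])
    qed
    have "- M = (\<integral>t. - M * indicator {0<..<1::real} t \<partial>lborel)" by simp
    also have "\<dots> \<le> (\<integral>t. (\<integral>x. f (t, x) \<partial>lborel) \<partial>lborel)"
    proof (rule Bochner_Integration.integral_mono)
      show "integrable lborel (\<lambda>t. - M * indicator {0<..<1::real} t)"
        by (intro integrable_mult_right integrable_real_indicator) simp_all
      show "integrable lborel (\<lambda>t. \<integral>x. f (t, x) \<partial>lborel)"
        by (rule lborel_pair.integrable_fst'[OF intf])
      show "- M * indicator {0<..<1::real} t \<le> (\<integral>x. f (t, x) \<partial>lborel)" for t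
      proof (cases "t \<in> {0<..<1}")
        case True
        then have t: "t \<in> {0..1}" by auto
        let ?w = "divergence (\<lambda>y. q' y t *\<^sub>R (v' y t - v y t))"
        have "0 \<le> D t x + divergence (\<lambda>y. B y t *\<^sub>R v y t) x + \<bar>?w x\<bar>" for x
        proof -
          have "\<theta> x t * ?w x \<le> \<bar>\<theta> x t\<bar> * \<bar>?w x\<bar>" unfolding abs_mult[symmetric] by (rule abs_ge_self)
          also have "\<dots> \<le> 1 * \<bar>?w x\<bar>" using \<theta>[OF t, of x] by (intro mult_right_mono) auto
          finally show ?thesis unfolding transport[OF t, of x] by linarith
        qed
        then have "0 \<le> (\<integral>x. f (t, x) + divergence (\<lambda>y. B y t *\<^sub>R v y t) x + \<bar>?w x\<bar> \<partial>lborel)"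
          using True by (intro Bochner_Integration.integral_nonneg) (simp add: f_def)
        also have "\<dots> = (\<integral>x. f (t, x) \<partial>lborel) + 0 + (\<integral>x. \<bar>?w x\<bar> \<partial>lborel)"
          unfolding flux(2)[OF t, symmetric]
          by (subst Bochner_Integration.integral_add)
            (intro Bochner_Integration.integrable_add integrable_abs fx flux(1)[OF t] source(1)[OF t]
              | subst Bochner_Integration.integral_add | rule refl)+
        finally have "- M \<le> (\<integral>x. f (t, x) \<partial>lborel)" using source(2)[OF t] by linarith
        then show ?thesis using True by simp
      qed (simp add: f_def)
    qed
    also have "\<dots> = (\<integral>x. (\<integral>t. f (t, x) \<partial>lborel) \<partial>lborel)"
      using lborel_pair.Fubini_integral[of "\<lambda>t x. f (t, x)"] intf by simp
    also have "\<dots> = (\<integral>x. B x 1 - B x 0 \<partial>lborel)"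
      using ft intB[of 0] intB[of 1] by (intro integral_cong_AE) auto
    finally have "(\<integral>x. B x 0 \<partial>lborel) \<le> (\<integral>x. B x 1 \<partial>lborel) + M"
      using intB[of 0] intB[of 1] by simp
    also have "(\<lambda>x. B x 1) = (\<lambda>x. \<epsilon> * q x 1)"
    proof
      fix x
      show "B x 1 = \<epsilon> * q x 1" using pos(1)[of 1 x] \<epsilon>(1) by (simp add: B_def terminal)
    qed
    finally have "(\<integral>x. B x 0 \<partial>lborel) \<le> \<epsilon> * (\<integral>x. q x 1 \<partial>lborel) + M" by simp
    moreover have "(\<integral>x. \<bar>q' x 0 - q x 0\<bar> \<partial>lborel) \<le> (\<integral>x. B x 0 \<partial>lborel)"
      using intq[of 0] intB[of 0] B_ge(1) by (intro integral_mono) auto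
    ultimately show ?thesis by linarith
  qed
  define m where "m = (\<integral>x. q x 1 \<partial>lborel)"
  show ?thesis
  proof (rule field_le_epsilon)
    fix e :: real assume e: "e > 0"
    define \<epsilon> where "\<epsilon> = min 1 (e / (\<bar>m\<bar> + 1))"
    have \<epsilon>: "0 < \<epsilon>" "\<epsilon> \<le> 1" using e by (auto simp: \<epsilon>_def)
    have "\<epsilon> * m \<le> \<epsilon> * (\<bar>m\<bar> + 1)" using \<epsilon> by (intro mult_left_mono) auto
    also have "\<dots> \<le> (e / (\<bar>m\<bar> + 1)) * (\<bar>m\<bar> + 1)" by (intro mult_right_mono) (auto simp: \<epsilon>_def)
    also have "\<dots> = e" by (simp add: add_nonneg_eq_0_iff)
    finally show "(\<integral>x. \<bar>q' x 0 - q x 0\<bar> \<partial>lborel) \<le> M + e"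
      using eps[OF \<epsilon>] unfolding m_def by linarith
  qed
qed

section \<open>A quadratic inequality\<close>

text \<open>In the application \<open>z\<^sup>2 = A d\<close>, \<open>Z\<^sup>2 = K\<^sup>2 d\<close>, and \<open>k\<close> bounds the score on the truncation set. As
\<open>Z\<^sup>2\<close> contains both \<open>z\<^sup>2\<close> and \<open>k\<close>, twice \<open>Z\<close> exceeds \<open>k\<close> by more than 1 as soon as \<open>z\<close> is
not small. After squaring, the claim is concave in \<open>k\<close>, so the end points 0 and \<open>z\<close> suffice.\<close>

lemma quadratic_absorption:
  fixes z k Z :: real
  assumes z: "z \<ge> 7/10" and k: "0 \<le> k" "k \<le> z" and Z: "Z \<ge> 0" "z\<^sup>2 + k \<le> Z\<^sup>2"
  shows "1 + k + 3/20 + z / 4 \<le> 2 * Z"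
proof -
  define c where "c = 23/20 + z / 4"
  have g0: "c\<^sup>2 \<le> 4 * z\<^sup>2"
  proof -
    have "c\<^sup>2 \<le> (2 * z)\<^sup>2" using z by (intro power_mono) (auto simp: c_def)
    then show ?thesis by (simp add: power_mult_distrib)
  qed
  have gz: "(c + z)\<^sup>2 \<le> 4 * z\<^sup>2 + 4 * z"
  proof -
    have "0 \<le> (z - 7/10) * (39 * z + 31)" using z by (intro mult_nonneg_nonneg) auto
    also have "\<dots> \<le> 39 * (z * z) + 18 * z - 529/25" using z by (simp add: algebra_simps)
    finally have "0 \<le> 39 * (z * z) + 18 * z - 529/25" .
    moreover have "16 * ((4 * z\<^sup>2 + 4 * z) - (c + z)\<^sup>2) = 39 * (z * z) + 18 * z - 529/25"
      by (simp add: c_def power2_eq_square algebra_simps)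
    ultimately show ?thesis by simp
  qed
  \<comment> \<open>\<open>g\<close> lies above the chord through its values at 0 and \<open>z\<close>.\<close>
  define g where "g = 4 * z\<^sup>2 + 4 * k - (c + k)\<^sup>2"
  have "z * g = (z - k) * (4 * z\<^sup>2 - c\<^sup>2) + k * (4 * z\<^sup>2 + 4 * z - (c + z)\<^sup>2) + z * (k * (z - k))"
    by (simp add: g_def power2_eq_square algebra_simps)
  moreover have "0 \<le> (z - k) * (4 * z\<^sup>2 - c\<^sup>2)"
    by (rule mult_nonneg_nonneg) (use g0 k in linarith)+
  moreover have "0 \<le> k * (4 * z\<^sup>2 + 4 * z - (c + z)\<^sup>2)"
    by (rule mult_nonneg_nonneg) (use gz k in linarith)+
  moreover have "0 \<le> z * (k * (z - k))"
    by (intro mult_nonneg_nonneg) (use k z in linarith)+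
  ultimately have "0 \<le> z * g" by linarith
  then have "0 \<le> g" using z mult_pos_neg[of z g] by linarith
  then have "(c + k)\<^sup>2 \<le> 4 * z\<^sup>2 + 4 * k" unfolding g_def by linarith
  also have "\<dots> \<le> 4 * Z\<^sup>2" using Z(2) by linarith
  also have "\<dots> = (2 * Z)\<^sup>2" by (simp add: power_mult_distrib)
  finally have "c + k \<le> 2 * Z" by (rule power2_le_imp_le) (use Z(1) in linarith)
  then show ?thesis unfolding c_def by linarith
qed

section \<open>Positive densities with a score of linear growth\<close>

text \<open>Both the exact and the numerical marginal at a fixed time are of this kind. The name \<open>d\<close> for the
dimension is a parameter because the dimension itself depends on the type only.\<close>

locale score_density =
  fixes p :: "real^'n \<Rightarrow> real" and s :: "real^'n \<Rightarrow> real^'n" and d S\<^sub>0 S\<^sub>1 C\<^sub>1 :: real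
  assumes d: "d = real CARD('n)"
    and pos: "p x > 0"
    and score: "GDERIV (\<lambda>y. ln (p y)) x :> s x"
    and cont_score: "continuous_on UNIV s"
    and S0: "S\<^sub>0 \<ge> 0" and S1: "S\<^sub>1 \<ge> 0"
    and growth: "norm (s x) \<le> S\<^sub>0 + S\<^sub>1 * norm x"
    and prob: "prob_space (law p)"
    and moment4: "integrable (law p) (\<lambda>x. norm x ^ 4)"
    and moment4_le: "expect p (\<lambda>x. norm x ^ 4) \<le> C\<^sub>1 * d\<^sup>2"
begin

sublocale prob_space "law p" by (rule prob)

definition A :: real where "A = 2 * sqrt (2 * S\<^sub>0 ^ 4 + 2 * S\<^sub>1 ^ 4 * C\<^sub>1)"

lemma d_ge_1: "d \<ge> 1" by (simp add: d Suc_leI)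

lemma gderiv: "GDERIV p x :> p x *\<^sub>R s x"
  by (rule gderiv_of_ln[OF pos score])

lemma cont: "continuous_on UNIV p"
  by (rule gderiv_imp_continuous[OF gderiv])

lemma measurable_p [measurable]: "p \<in> borel_measurable borel"
  using cont by (rule borel_measurable_continuous_onI)

lemma measurable_s [measurable]: "s \<in> borel_measurable borel"
  using cont_score by (rule borel_measurable_continuous_onI)

lemma sets_law [simp, measurable_cong]: "sets (law p) = sets borel"
  by (simp add: law_def)

lemma space_law [simp]: "space (law p) = UNIV"
  by (simp add: law_def)

lemma prob_UNIV [simp]: "prob UNIV = 1"
  using prob_space by simp

lemma integrable_law:
  fixes \<phi> :: "real^'n \<Rightarrow> real"
  assumes "\<phi> \<in> borel_measurable borel"
  shows "integrable (law p) \<phi> \<longleftrightarrow> integrable lborel (\<lambda>x. p x * \<phi> x)"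
  unfolding law_def using assms pos less_imp_le by (subst integrable_real_density) auto

lemma expect_law:
  fixes \<phi> :: "real^'n \<Rightarrow> real"
  assumes "\<phi> \<in> borel_measurable borel"
  shows "expect p \<phi> = (\<integral>x. p x * \<phi> x \<partial>lborel)"
  unfolding law_def using assms pos less_imp_le by (subst integral_real_density) auto

lemma integrable_growth:
  fixes \<phi> :: "real^'n \<Rightarrow> real"
  assumes [measurable]: "\<phi> \<in> borel_measurable borel" and le: "\<And>x. \<bar>\<phi> x\<bar> \<le> c * (1 + norm x) ^ 4"
  shows "integrable (law p) \<phi>"
proof (rule Bochner_Integration.integrable_bound)
  show "integrable (law p) (\<lambda>x. 8 * \<bar>c\<bar> * (1 + norm x ^ 4))"
    using moment4 by simp
  have "\<bar>\<phi> x\<bar> \<le> 8 * \<bar>c\<bar> * (1 + norm x ^ 4)" for x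
  proof -
    define r where "r = norm x"
    have sq: "(1 + u)\<^sup>2 \<le> 2 * (1 + u\<^sup>2)" for u :: real
      using zero_le_power2[of "1 - u"] by (simp add: power2_eq_square algebra_simps)
    have "(1 + r) ^ 4 = ((1 + r)\<^sup>2)\<^sup>2" by simp
    also have "\<dots> \<le> (2 * (1 + r\<^sup>2))\<^sup>2" by (intro power_mono sq) auto
    also have "\<dots> = 4 * (1 + r\<^sup>2)\<^sup>2" by (simp only: power_mult_distrib) simp
    also have "\<dots> \<le> 4 * (2 * (1 + (r\<^sup>2)\<^sup>2))" using sq[of "r\<^sup>2"] by linarith
    finally have "(1 + r) ^ 4 \<le> 8 * (1 + r ^ 4)" by simp
    then have "\<bar>c\<bar> * (1 + r) ^ 4 \<le> \<bar>c\<bar> * (8 * (1 + r ^ 4))" by (intro mult_left_mono) auto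
    moreover have "c * (1 + r) ^ 4 \<le> \<bar>c\<bar> * (1 + r) ^ 4"
      by (intro mult_right_mono) auto
    ultimately show ?thesis using le[of x] by (simp add: r_def mult.assoc mult.left_commute)
  qed
  then show "AE x in law p. norm (\<phi> x) \<le> norm (8 * \<bar>c\<bar> * (1 + norm x ^ 4))"
    by (auto simp: abs_mult)
qed simp

lemma integrable_growth':
  fixes \<phi> :: "real^'n \<Rightarrow> real"
  assumes "\<phi> \<in> borel_measurable borel" and "\<And>x. \<bar>\<phi> x\<bar> \<le> c * (1 + norm x) ^ k" and "k \<le> 4"
  shows "integrable (law p) \<phi>"
proof (rule integrable_growth[OF assms(1)])
  fix x :: "real^'n"
  have "c * (1 + norm x) ^ k \<le> \<bar>c\<bar> * (1 + norm x) ^ k"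
    by (intro mult_right_mono) auto
  also have "\<dots> \<le> \<bar>c\<bar> * (1 + norm x) ^ 4"
    using assms(3) by (intro mult_left_mono power_increasing) auto
  finally show "\<bar>\<phi> x\<bar> \<le> \<bar>c\<bar> * (1 + norm x) ^ 4" using assms(2)[of x] by linarith
qed

lemma integrable_norm: "integrable (law p) (\<lambda>x. norm x)"
  by (rule integrable_growth'[of _ 1 1]) auto

lemma integrable_norm_sq: "integrable (law p) (\<lambda>x. (norm x)\<^sup>2)"
  by (rule integrable_growth'[of _ 1 2]) (auto intro!: power_mono)

lemma integrable_score_sq: "integrable (law p) (\<lambda>x. (norm (s x))\<^sup>2)"
proof (rule integrable_growth'[of _ "(S\<^sub>0 + S\<^sub>1)\<^sup>2" 2])
  fix x
  have "norm (s x) \<le> (S\<^sub>0 + S\<^sub>1) * (1 + norm x)"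
    using growth[of x] S1 mult_nonneg_nonneg[OF S0 norm_ge_zero[of x]]
    by (simp add: distrib_left distrib_right)
  then show "\<bar>(norm (s x))\<^sup>2\<bar> \<le> (S\<^sub>0 + S\<^sub>1)\<^sup>2 * (1 + norm x)\<^sup>2"
    unfolding power_mult_distrib[symmetric] by (simp add: power_mono)
qed auto

lemma norm_sq_moment: "(expect p (\<lambda>x. (norm x)\<^sup>2))\<^sup>2 \<le> C\<^sub>1 * d\<^sup>2"
proof -
  have "expect p (\<lambda>x. \<bar>(norm x)\<^sup>2 * 1\<bar>) \<le> sqrt (expect p (\<lambda>x. ((norm x)\<^sup>2)\<^sup>2)) * sqrt (expect p (\<lambda>x. 1\<^sup>2))"
    using moment4 by (intro integral_Cauchy_Schwarz) auto
  then have "expect p (\<lambda>x. (norm x)\<^sup>2) \<le> sqrt (expect p (\<lambda>x. norm x ^ 4))"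
    using prob_space by simp
  then have "(expect p (\<lambda>x. (norm x)\<^sup>2))\<^sup>2 \<le> (sqrt (expect p (\<lambda>x. norm x ^ 4)))\<^sup>2"
    by (intro power_mono) auto
  also have "\<dots> \<le> C\<^sub>1 * d\<^sup>2" using moment4_le by simp
  finally show ?thesis .
qed

lemma C1_nonneg: "C\<^sub>1 \<ge> 0"
proof -
  have "0 \<le> C\<^sub>1 * d\<^sup>2" by (rule order_trans[OF _ norm_sq_moment]) simp
  then show ?thesis using d_ge_1 by (simp add: zero_le_mult_iff)
qed

lemma expect_norm_sq: "expect p (\<lambda>x. (norm x)\<^sup>2) \<le> sqrt C\<^sub>1 * d"
proof -
  have "expect p (\<lambda>x. (norm x)\<^sup>2) \<le> sqrt (C\<^sub>1 * d\<^sup>2)"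
    using norm_sq_moment by (rule real_le_rsqrt)
  then show ?thesis using d_ge_1 by (simp add: real_sqrt_mult)
qed

lemma A_nonneg: "A \<ge> 0"
  using S0 S1 C1_nonneg by (auto simp: A_def)

text \<open>\<open>A\<close> is the form in which the constants of the theorem enter; this quadratic mean inequality turns it
into the bound that the growth of the score produces.\<close>

lemma A_lower: "2 * S\<^sub>0\<^sup>2 + 2 * S\<^sub>1\<^sup>2 * sqrt C\<^sub>1 \<le> A"
proof -
  have "(S\<^sub>0\<^sup>2 + S\<^sub>1\<^sup>2 * sqrt C\<^sub>1)\<^sup>2 \<le> 2 * (S\<^sub>0\<^sup>2)\<^sup>2 + 2 * (S\<^sub>1\<^sup>2 * sqrt C\<^sub>1)\<^sup>2"
    using zero_le_power2[of "S\<^sub>0\<^sup>2 - S\<^sub>1\<^sup>2 * sqrt C\<^sub>1"] by (simp only: power2_eq_square algebra_simps)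
  also have "\<dots> = 2 * S\<^sub>0 ^ 4 + 2 * S\<^sub>1 ^ 4 * C\<^sub>1"
    using C1_nonneg by (simp add: power_mult_distrib)
  finally have "S\<^sub>0\<^sup>2 + S\<^sub>1\<^sup>2 * sqrt C\<^sub>1 \<le> sqrt (2 * S\<^sub>0 ^ 4 + 2 * S\<^sub>1 ^ 4 * C\<^sub>1)"
    by (rule real_le_rsqrt)
  then show ?thesis unfolding A_def by linarith
qed

lemma expect_score_sq: "expect p (\<lambda>x. (norm (s x))\<^sup>2) \<le> A * d"
proof -
  have "(norm (s x))\<^sup>2 \<le> 2 * S\<^sub>0\<^sup>2 + 2 * S\<^sub>1\<^sup>2 * (norm x)\<^sup>2" for x
  proof -
    have "(norm (s x))\<^sup>2 \<le> (S\<^sub>0 + S\<^sub>1 * norm x)\<^sup>2" using growth by (intro power_mono) auto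
    also have "\<dots> \<le> 2 * S\<^sub>0\<^sup>2 + 2 * (S\<^sub>1 * norm x)\<^sup>2"
      using zero_le_power2[of "S\<^sub>0 - S\<^sub>1 * norm x"] by (simp only: power2_eq_square algebra_simps)
    finally show ?thesis by (simp add: power_mult_distrib)
  qed
  then have "expect p (\<lambda>x. (norm (s x))\<^sup>2) \<le> expect p (\<lambda>x. 2 * S\<^sub>0\<^sup>2 + 2 * S\<^sub>1\<^sup>2 * (norm x)\<^sup>2)"
    using integrable_score_sq integrable_norm_sq by (intro integral_mono) auto
  also have "\<dots> = 2 * S\<^sub>0\<^sup>2 + 2 * S\<^sub>1\<^sup>2 * expect p (\<lambda>x. (norm x)\<^sup>2)"
    using integrable_norm_sq by (simp add: prob_space)
  also have "\<dots> \<le> 2 * S\<^sub>0\<^sup>2 * d + 2 * S\<^sub>1\<^sup>2 * (sqrt C\<^sub>1 * d)"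
    using expect_norm_sq mult_left_mono[OF d_ge_1, of "2 * S\<^sub>0\<^sup>2"]
    by (intro add_mono mult_left_mono) auto
  also have "\<dots> = (2 * S\<^sub>0\<^sup>2 + 2 * S\<^sub>1\<^sup>2 * sqrt C\<^sub>1) * d" by (simp add: algebra_simps)
  also have "\<dots> \<le> A * d" using A_lower d_ge_1 by (intro mult_right_mono) auto
  finally show ?thesis .
qed

lemma abs_inner_score_le: "\<bar>x \<bullet> s x\<bar> \<le> norm x * (S\<^sub>0 + S\<^sub>1 * norm x)"
  using Cauchy_Schwarz_ineq2[of x "s x"] growth[of x] mult_left_mono[OF growth[of x] norm_ge_zero[of x]]
  by linarith

lemma shifted_second_moment:
  "integrable lborel (\<lambda>x. p x * (1 + norm x)\<^sup>2)"
  "(\<integral>x. p x * (1 + norm x)\<^sup>2 \<partial>lborel) \<le> 2 + 2 * (sqrt C\<^sub>1 * d)"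
  "expect p (\<lambda>x. (1 + norm x)\<^sup>2) \<le> 2 + 2 * (sqrt C\<^sub>1 * d)"
proof -
  have int: "integrable (law p) (\<lambda>x. (1 + norm x)\<^sup>2)"
    by (rule integrable_growth'[of _ 1 2]) auto
  then show "integrable lborel (\<lambda>x. p x * (1 + norm x)\<^sup>2)" by (subst (asm) integrable_law) auto
  have "expect p (\<lambda>x. (1 + norm x)\<^sup>2) \<le> expect p (\<lambda>x. 2 + 2 * (norm x)\<^sup>2)"
  proof (rule Bochner_Integration.integral_mono[OF int])
    show "(1 + norm x)\<^sup>2 \<le> 2 + 2 * (norm x)\<^sup>2" for x :: "real^'n"
      using zero_le_power2[of "1 - norm x"] by (simp add: power2_eq_square algebra_simps)
  qed (use integrable_norm_sq in simp)
  also have "\<dots> = 2 + 2 * expect p (\<lambda>x. (norm x)\<^sup>2)" using integrable_norm_sq by simp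
  also have "\<dots> \<le> 2 + 2 * (sqrt C\<^sub>1 * d)" using expect_norm_sq by linarith
  finally show le: "expect p (\<lambda>x. (1 + norm x)\<^sup>2) \<le> 2 + 2 * (sqrt C\<^sub>1 * d)" .
  then show "(\<integral>x. p x * (1 + norm x)\<^sup>2 \<partial>lborel) \<le> 2 + 2 * (sqrt C\<^sub>1 * d)"
    by (subst (asm) expect_law) auto
qed

lemma integral_p: "integrable lborel p" "(\<integral>x. p x \<partial>lborel) = 1"
  using integrable_law[of "\<lambda>_. 1"] expect_law[of "\<lambda>_. 1"] by auto

text \<open>This rules out \<open>T = 1\<close> in the theorem, where the truncation set is a single point.\<close>

lemma prob_compl_singleton: "prob (- {a}) = 1"
proof -
  have "AE x in law p. x \<in> - {a}"
    unfolding law_def using AE_lborel_singleton[of a] by (subst AE_density) auto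
  then show ?thesis by (subst prob_eq_1) auto
qed

section \<open>Lower bounds forced by integration by parts\<close>

text \<open>The divergence theorem for the field \<open>p(x) w(|x|\<^sup>2) x\<close>, divided by \<open>p\<close>: the gradient of \<open>p\<close> is
\<open>p s\<close>. The weight may have a kink on the sphere \<open>|x|\<^sup>2 = c\<close>.\<close>

lemma radial_integration_by_parts:
  fixes w w' :: "real \<Rightarrow> real"
  assumes w_cont: "continuous_on UNIV w" and w'_meas [measurable]: "w' \<in> borel_measurable borel"
    and w_deriv: "\<And>u. u \<noteq> c \<Longrightarrow> u \<ge> 0 \<Longrightarrow> (w has_real_derivative w' u) (at u)"
    and w_le: "\<And>u. u \<ge> 0 \<Longrightarrow> \<bar>w u\<bar> \<le> W" and w'_le: "\<And>u. u \<ge> 0 \<Longrightarrow> u * \<bar>w' u\<bar> \<le> W"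
  defines "\<phi> \<equiv> \<lambda>x :: real^'n. w ((norm x)\<^sup>2) * (d + x \<bullet> s x) + 2 * (norm x)\<^sup>2 * w' ((norm x)\<^sup>2)"
  shows "integrable (law p) \<phi>" "expect p \<phi> = 0"
proof -
  have W: "W \<ge> 0" using w_le[of 0] by simp
  have [measurable]: "w \<in> borel_measurable borel"
    using w_cont by (rule borel_measurable_continuous_onI)
  define \<phi>\<^sub>i where "\<phi>\<^sub>i = (\<lambda>i x. w ((norm x)\<^sup>2) * (1 + x $ i * s x $ i) + 2 * (x $ i)\<^sup>2 * w' ((norm x)\<^sup>2))"
  have \<phi>_sum: "\<phi> = (\<lambda>x. \<Sum>i\<in>UNIV. \<phi>\<^sub>i i x)"
  proof
    fix x :: "real^'n"
    have n: "(norm x)\<^sup>2 = (\<Sum>i\<in>UNIV. (x $ i)\<^sup>2)"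
      unfolding power2_norm_eq_inner inner_vec_def by (simp add: power2_eq_square)
    have "(\<Sum>i\<in>UNIV. \<phi>\<^sub>i i x) = w ((norm x)\<^sup>2) * (\<Sum>i\<in>UNIV. 1 + x $ i * s x $ i)
        + 2 * (\<Sum>i\<in>UNIV. (x $ i)\<^sup>2) * w' ((norm x)\<^sup>2)"
      unfolding \<phi>\<^sub>i_def sum.distrib[of "\<lambda>i. w ((norm x)\<^sup>2) * (1 + x $ i * s x $ i)"]
      by (simp only: sum_distrib_left sum_distrib_right)
    also have "\<dots> = \<phi> x"
      unfolding \<phi>_def n[symmetric] by (simp add: sum.distrib inner_vec_def d)
    finally show "\<phi> x = (\<Sum>i\<in>UNIV. \<phi>\<^sub>i i x)" by simp
  qed
  have [measurable]: "(\<lambda>x. x $ i) \<in> borel_measurable (borel :: (real^'n) measure)" for i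
    by (intro borel_measurable_continuous_onI continuous_intros)
  have [measurable]: "(\<lambda>x. s x $ i) \<in> borel_measurable borel" for i
    by (intro borel_measurable_continuous_onI continuous_intros cont_score)
  have meas_i [measurable]: "\<phi>\<^sub>i i \<in> borel_measurable borel" for i unfolding \<phi>\<^sub>i_def by measurable
  define Q where "Q = W * (3 + S\<^sub>0 + S\<^sub>1)"
  have bound: "\<bar>\<phi>\<^sub>i i x\<bar> \<le> Q * (1 + norm x) ^ 2" for i x
  proof -
    define r where "r = norm x"
    have r: "r \<ge> 0" "\<bar>x $ i\<bar> \<le> r" "\<bar>s x $ i\<bar> \<le> S\<^sub>0 + S\<^sub>1 * r"
      using component_le_norm_cart[of x i] order_trans[OF component_le_norm_cart[of "s x" i] growth[of x]]
      by (auto simp: r_def)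
    have "\<bar>x $ i * s x $ i\<bar> \<le> r * (S\<^sub>0 + S\<^sub>1 * r)"
      unfolding abs_mult using r by (intro mult_mono) auto
    then have "\<bar>1 + x $ i * s x $ i\<bar> \<le> 1 + r * (S\<^sub>0 + S\<^sub>1 * r)" by linarith
    then have "\<bar>w (r\<^sup>2) * (1 + x $ i * s x $ i)\<bar> \<le> W * (1 + r * (S\<^sub>0 + S\<^sub>1 * r))"
      unfolding abs_mult[of "w (r\<^sup>2)"] using W w_le[of "r\<^sup>2"] by (intro mult_mono) auto
    moreover have "\<bar>2 * (x $ i)\<^sup>2 * w' (r\<^sup>2)\<bar> \<le> 2 * W"
    proof -
      have "(x $ i)\<^sup>2 \<le> r\<^sup>2" using r by (metis abs_le_square_iff abs_of_nonneg)
      then have "(x $ i)\<^sup>2 * \<bar>w' (r\<^sup>2)\<bar> \<le> r\<^sup>2 * \<bar>w' (r\<^sup>2)\<bar>" by (intro mult_right_mono) auto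
      then show ?thesis using w'_le[of "r\<^sup>2"] by (simp add: abs_mult)
    qed
    ultimately have "\<bar>\<phi>\<^sub>i i x\<bar> \<le> W * (3 + S\<^sub>0 * r + S\<^sub>1 * r\<^sup>2)"
      unfolding \<phi>\<^sub>i_def r_def[symmetric] by (simp add: algebra_simps power2_eq_square)
    also have "3 + S\<^sub>0 * r + S\<^sub>1 * r\<^sup>2 \<le> (3 + S\<^sub>0 + S\<^sub>1) * (1 + r)\<^sup>2"
    proof -
      have "1 \<le> (1 + r)\<^sup>2" "r \<le> (1 + r)\<^sup>2" "r\<^sup>2 \<le> (1 + r)\<^sup>2"
        using r by (auto simp: power2_eq_square algebra_simps)
      then have "3 * 1 + S\<^sub>0 * r + S\<^sub>1 * r\<^sup>2 \<le> 3 * (1 + r)\<^sup>2 + S\<^sub>0 * (1 + r)\<^sup>2 + S\<^sub>1 * (1 + r)\<^sup>2"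
        using S0 S1 by (intro add_mono mult_left_mono) auto
      then show ?thesis by (simp only: distrib_right mult_1_right)
    qed
    finally show ?thesis using W by (simp add: Q_def r_def mult.assoc mult_left_mono)
  qed
  have int_i: "integrable (law p) (\<phi>\<^sub>i i)" for i
    by (rule integrable_growth'[OF meas_i bound]) simp
  then show "integrable (law p) \<phi>" unfolding \<phi>_sum by simp
  have "expect p (\<phi>\<^sub>i i) = 0" for i
  proof -
    define H where "H = (\<lambda>x. p x * (w ((norm x)\<^sup>2) * x $ i))"
    have "integrable lborel H"
    proof -
      have "integrable (law p) (\<lambda>x. w ((norm x)\<^sup>2) * x $ i)"
      proof (rule integrable_growth'[of _ W 1])
        show "\<bar>w ((norm x)\<^sup>2) * x $ i\<bar> \<le> W * (1 + norm x) ^ 1" for x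
        proof -
          have "\<bar>w ((norm x)\<^sup>2) * x $ i\<bar> \<le> W * norm x"
            unfolding abs_mult using W w_le component_le_norm_cart[of x i] by (intro mult_mono) auto
          then show ?thesis using W by (simp add: algebra_simps)
        qed
      qed auto
      then show ?thesis unfolding H_def by (subst (asm) integrable_law) auto
    qed
    moreover have "integrable lborel (\<lambda>x. p x * \<phi>\<^sub>i i x)"
      using int_i by (subst (asm) integrable_law) auto
    moreover have "continuous_on UNIV H"
      unfolding H_def by (intro continuous_intros cont continuous_on_compose2[OF w_cont]) auto
    moreover have "finite {r. x + r *\<^sub>R axis i 1 \<in> {x. (norm x)\<^sup>2 = c}}" for x :: "real^'n"
    proof (rule finite_subset)
      have "r + x $ i \<in> {sqrt (c - (norm x)\<^sup>2 + (x $ i)\<^sup>2), - sqrt (c - (norm x)\<^sup>2 + (x $ i)\<^sup>2)}"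
        if "(norm (x + r *\<^sub>R axis i 1))\<^sup>2 = c" for r
      proof -
        have "c = (norm x)\<^sup>2 + 2 * r * x $ i + r\<^sup>2"
          using that unfolding power2_norm_eq_inner
          by (simp add: inner_axis inner_axis' algebra_simps power2_eq_square)
        then have "(r + x $ i)\<^sup>2 = c - (norm x)\<^sup>2 + (x $ i)\<^sup>2"
          by (simp add: power2_eq_square algebra_simps)
        then have "\<bar>r + x $ i\<bar> = sqrt (c - (norm x)\<^sup>2 + (x $ i)\<^sup>2)"
          by (metis real_sqrt_abs)
        then show ?thesis by auto
      qed
      then show "{r. x + r *\<^sub>R axis i 1 \<in> {x. (norm x)\<^sup>2 = c}} \<subseteq>
          (\<lambda>v. v - x $ i) ` {sqrt (c - (norm x)\<^sup>2 + (x $ i)\<^sup>2), - sqrt (c - (norm x)\<^sup>2 + (x $ i)\<^sup>2)}"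
        by (force simp: image_iff)
    qed simp
    moreover have "((\<lambda>r. H (x + r *\<^sub>R axis i 1)) has_real_derivative p x * \<phi>\<^sub>i i x) (at 0)"
      if "x \<notin> {x. (norm x)\<^sup>2 = c}" for x
    proof -
      let ?l = "\<lambda>r::real. x + r *\<^sub>R axis i (1::real)"
      have l: "(?l has_derivative (\<lambda>r. r *\<^sub>R axis i 1)) (at 0)"
        by (auto intro!: derivative_eq_intros)
      have 1: "((\<lambda>r. p (?l r)) has_real_derivative p x * s x $ i) (at 0)"
      proof -
        have "((\<lambda>r. p (?l r)) has_derivative (\<lambda>r. (r *\<^sub>R axis i 1) \<bullet> (p x *\<^sub>R s x))) (at 0)"
          using has_derivative_compose[OF l, of p "\<lambda>h. h \<bullet> (p x *\<^sub>R s x)"] gderiv[of x, unfolded gderiv_def]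
          by (simp only: scaleR_zero_left add_0_right)
        moreover have "(\<lambda>r. (r *\<^sub>R axis i 1) \<bullet> (p x *\<^sub>R s x)) = (*) (p x * s x $ i)"
          by (auto simp: inner_axis')
        ultimately show ?thesis by (simp add: has_field_derivative_def)
      qed
      have 2: "((\<lambda>r. (norm (?l r))\<^sup>2) has_real_derivative 2 * x $ i) (at 0)"
        unfolding power2_norm_eq_inner
        by (simp add: inner_axis inner_axis' algebra_simps) (auto intro!: derivative_eq_intros)
      have 3: "((\<lambda>r. w ((norm (?l r))\<^sup>2)) has_real_derivative w' ((norm x)\<^sup>2) * (2 * x $ i)) (at 0)"
        using that by (intro DERIV_chain2[OF _ 2]) (auto intro: w_deriv)
      have 4: "((\<lambda>r. ?l r $ i) has_real_derivative 1) (at 0)"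
        by (auto intro!: derivative_eq_intros)
      show ?thesis unfolding H_def
        by (rule DERIV_cong[OF DERIV_mult[OF 1 DERIV_mult[OF 3 4]]])
          (simp add: \<phi>\<^sub>i_def algebra_simps power2_eq_square)
    qed
    ultimately have "(\<integral>x. p x * \<phi>\<^sub>i i x \<partial>lborel) = 0"
      by (rule integral_line_derivative_eq_0_off_finite)
    then show ?thesis by (subst expect_law) auto
  qed
  then show "expect p \<phi> = 0" unfolding \<phi>_sum using int_i by simp
qed

text \<open>The constant weight \<open>w = 1\<close> gives \<open>E (x \<bullet> s) = -d\<close>; Cauchy-Schwarz does the rest.\<close>

lemma cramer_rao: "d\<^sup>2 \<le> expect p (\<lambda>x. (norm x)\<^sup>2) * expect p (\<lambda>x. (norm (s x))\<^sup>2)"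
proof -
  have ibp: "integrable (law p) (\<lambda>x. d + x \<bullet> s x)" "expect p (\<lambda>x. d + x \<bullet> s x) = 0"
    using radial_integration_by_parts[of "\<lambda>_. 1" "\<lambda>_. 0" 0 1] by auto
  have int: "integrable (law p) (\<lambda>x. x \<bullet> s x)"
    using Bochner_Integration.integrable_diff[OF ibp(1), of "\<lambda>_. d"] by simp
  have "d = - expect p (\<lambda>x. x \<bullet> s x)" using ibp int by (simp add: prob_space)
  also have "\<dots> \<le> expect p (\<lambda>x. \<bar>x \<bullet> s x\<bar>)"
    using integral_abs_bound[of "law p" "\<lambda>x. x \<bullet> s x"] by linarith
  also have "\<dots> \<le> expect p (\<lambda>x. \<bar>norm x * norm (s x)\<bar>)"
  proof (rule integral_mono)
    show "integrable (law p) (\<lambda>x. \<bar>norm x * norm (s x)\<bar>)"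
      by (intro integrable_abs integral_Cauchy_Schwarz(1) integrable_norm_sq integrable_score_sq) auto
  qed (use int Cauchy_Schwarz_ineq2 in auto)
  also have "\<dots> \<le> sqrt (expect p (\<lambda>x. (norm x)\<^sup>2)) * sqrt (expect p (\<lambda>x. (norm (s x))\<^sup>2))"
    by (intro integral_Cauchy_Schwarz integrable_norm_sq integrable_score_sq) auto
  finally have "d\<^sup>2 \<le> (sqrt (expect p (\<lambda>x. (norm x)\<^sup>2)) * sqrt (expect p (\<lambda>x. (norm (s x))\<^sup>2)))\<^sup>2"
    using d_ge_1 by (intro power_mono) auto
  then show ?thesis by (simp add: power_mult_distrib)
qed

lemma A_times_sqrt_C1: "1 \<le> A * sqrt C\<^sub>1"
proof -
  have "d\<^sup>2 \<le> (sqrt C\<^sub>1 * d) * (A * d)"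
    using C1_nonneg d_ge_1
    by (intro order_trans[OF cramer_rao] mult_mono expect_norm_sq expect_score_sq) auto
  then have "d\<^sup>2 * 1 \<le> d\<^sup>2 * (A * sqrt C\<^sub>1)" by (simp add: power2_eq_square mult_ac)
  then show ?thesis using d_ge_1 by (subst (asm) mult_le_cancel_left_pos) auto
qed

text \<open>A score of slow linear growth forces heavy tails. The weight grows like \<open>exp (l |x|\<^sup>2 / 2)\<close> inside the
ball of radius \<open>\<rho>\<close> and decays like \<open>\<rho>\<^sup>2 / |x|\<^sup>2\<close> outside. The rate \<open>l\<close> is chosen by completing the
square such that the integrand of \<open>radial_integration_by_parts\<close> is at least \<open>d / 2\<close> times the weight
inside, whatever the direction of the score. The decay outside compensates the growth of \<open>x \<bullet> s\<close>,
so the integrand is bounded below there. As the expectation is 0, the mass outside cannot be too small.\<close>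

lemma tail_lower_bound:
  fixes \<rho> :: real
  assumes \<rho>: "\<rho> > 0"
  defines "l \<equiv> S\<^sub>1 + S\<^sub>0\<^sup>2 / (2 * d)" and "\<pi> \<equiv> prob (- {x. norm x \<le> \<rho>})"
  shows "d / 2 * exp (- (l * \<rho>\<^sup>2 / 2)) * (1 - \<pi>) \<le> \<pi> * (1 + S\<^sub>0 * \<rho> + S\<^sub>1 * \<rho>\<^sup>2)"
proof -
  have l0: "l \<ge> 0" using S1 d_ge_1 by (simp add: l_def)
  define w where "w = (\<lambda>u. if u \<le> \<rho>\<^sup>2 then exp (l * (u - \<rho>\<^sup>2) / 2) else \<rho>\<^sup>2 / u)"
  define w' where "w' = (\<lambda>u. if u \<le> \<rho>\<^sup>2 then l / 2 * exp (l * (u - \<rho>\<^sup>2) / 2) else - \<rho>\<^sup>2 / u\<^sup>2)"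
  have \<rho>2: "\<rho>\<^sup>2 > 0" using \<rho> by simp
  have e1: "exp (l * (u - \<rho>\<^sup>2) / 2) \<le> 1" if "u \<le> \<rho>\<^sup>2" for u
    using that l0 by (simp add: mult_nonneg_nonpos)
  define \<phi> where "\<phi> = (\<lambda>x. w ((norm x)\<^sup>2) * (d + x \<bullet> s x) + 2 * (norm x)\<^sup>2 * w' ((norm x)\<^sup>2))"
  have ibp: "integrable (law p) \<phi>" "expect p \<phi> = 0"
  proof -
    have w_cont: "continuous_on UNIV w"
    proof -
      have "continuous_on ({..\<rho>\<^sup>2} \<union> {\<rho>\<^sup>2..}) w"
        unfolding w_def using \<rho>2
        by (intro continuous_on_cases continuous_intros) auto
      moreover have "{..\<rho>\<^sup>2} \<union> {\<rho>\<^sup>2..} = UNIV" by auto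
      ultimately show ?thesis by simp
    qed
    have w'_meas: "w' \<in> borel_measurable borel" unfolding w'_def by measurable
    have w_deriv: "(w has_real_derivative w' u) (at u)" if "u \<noteq> \<rho>\<^sup>2" "u \<ge> 0" for u
    proof (cases "u < \<rho>\<^sup>2")
      case True
      have "((\<lambda>u. exp (l * (u - \<rho>\<^sup>2) / 2)) has_real_derivative w' u) (at u)"
        using True by (auto simp: w'_def intro!: derivative_eq_intros)
      moreover have "\<forall>\<^sub>F v in nhds u. exp (l * (v - \<rho>\<^sup>2) / 2) = w v"
        using True by (intro eventually_nhds_in_open[of "{..<\<rho>\<^sup>2}", THEN eventually_mono]) (auto simp: w_def)
      ultimately show ?thesis by (subst DERIV_cong_ev[OF refl _ refl]) (auto elim: eventually_mono)
    next
      case False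
      then have "u > \<rho>\<^sup>2" using that by linarith
      then have u: "u > \<rho>\<^sup>2" "u > 0" using \<rho>2 by linarith+
      have "((\<lambda>u. \<rho>\<^sup>2 / u) has_real_derivative w' u) (at u)"
        using u by (auto simp: w'_def power2_eq_square intro!: derivative_eq_intros)
      moreover have "\<forall>\<^sub>F v in nhds u. \<rho>\<^sup>2 / v = w v"
        using u by (intro eventually_nhds_in_open[of "{\<rho>\<^sup>2<..}", THEN eventually_mono]) (auto simp: w_def)
      ultimately show ?thesis by (subst DERIV_cong_ev[OF refl _ refl]) (auto elim: eventually_mono)
    qed
    have w_le: "\<bar>w u\<bar> \<le> 1 + l * \<rho>\<^sup>2" if "u \<ge> 0" for u
    proof -
      have "\<bar>w u\<bar> \<le> 1" using e1[of u] \<rho>2 that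
        by (auto simp: w_def divide_le_eq_1)
      then show ?thesis using l0 by (simp add: add_increasing2)
    qed
    have w'_le: "u * \<bar>w' u\<bar> \<le> 1 + l * \<rho>\<^sup>2" if "u \<ge> 0" for u
    proof (cases "u \<le> \<rho>\<^sup>2")
      case True
      have "u * \<bar>w' u\<bar> = u * (l / 2) * exp (l * (u - \<rho>\<^sup>2) / 2)"
        using True l0 by (simp add: w'_def abs_mult)
      also have "\<dots> \<le> \<rho>\<^sup>2 * l * 1"
        using True e1[of u] that l0 by (intro mult_mono) auto
      finally show ?thesis by (simp add: mult.commute)
    next
      case False
      then have "u * \<bar>w' u\<bar> = \<rho>\<^sup>2 / u" using \<rho>2 by (simp add: w'_def power2_eq_square abs_mult)
      also have "\<dots> \<le> 1" using False \<rho>2 that by (auto simp: divide_le_eq_1)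
      finally show ?thesis using l0 by (simp add: add_increasing2)
    qed
    show "integrable (law p) \<phi>" "expect p \<phi> = 0"
      unfolding \<phi>_def using radial_integration_by_parts[OF w_cont w'_meas w_deriv w_le w'_le] by auto
  qed
  define \<beta> where "\<beta> = d / 2 * exp (- (l * \<rho>\<^sup>2 / 2))"
  define \<gamma> where "\<gamma> = 1 + S\<^sub>0 * \<rho> + S\<^sub>1 * \<rho>\<^sup>2"
  let ?I = "{x::real^'n. norm x \<le> \<rho>}"
  have inner: "x \<bullet> s x \<ge> - (S\<^sub>0 * norm x + S\<^sub>1 * (norm x)\<^sup>2)" for x
    using abs_inner_score_le[of x] by (simp add: algebra_simps power2_eq_square)
  have inside: "\<beta> \<le> \<phi> x" if "norm x \<le> \<rho>" for x
  proof -
    define r where "r = norm x"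
    have r: "r \<ge> 0" "r\<^sup>2 \<le> \<rho>\<^sup>2" using that \<rho> by (auto simp: r_def intro: power_mono)
    have "d / 2 \<le> d / 2 + (d - S\<^sub>0 * r)\<^sup>2 / (2 * d)" using d_ge_1 by simp
    also have "\<dots> = d + l * r\<^sup>2 - (S\<^sub>0 * r + S\<^sub>1 * r\<^sup>2)"
      using d_ge_1 by (simp add: l_def field_simps power2_eq_square)
    also have "\<dots> \<le> d + l * r\<^sup>2 + x \<bullet> s x" using inner[of x] by (simp add: r_def)
    finally have "d / 2 \<le> d + l * r\<^sup>2 + x \<bullet> s x" .
    moreover have "exp (- (l * \<rho>\<^sup>2 / 2)) \<le> w (r\<^sup>2)"
      using r l0 by (simp add: w_def algebra_simps)
    ultimately have "d / 2 * exp (- (l * \<rho>\<^sup>2 / 2)) \<le> (d + l * r\<^sup>2 + x \<bullet> s x) * w (r\<^sup>2)"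
      using d_ge_1 by (intro mult_mono) auto
    also have "\<dots> = \<phi> x"
      using r by (simp add: \<phi>_def w_def w'_def r_def algebra_simps)
    finally show ?thesis by (simp add: \<beta>_def)
  qed
  have outside: "- \<gamma> \<le> \<phi> x" if "\<not> norm x \<le> \<rho>" for x
  proof -
    define r where "r = norm x"
    have r: "r > \<rho>" "r\<^sup>2 > \<rho>\<^sup>2" "r > 0" using that \<rho> by (auto simp: r_def intro: power_strict_mono)
    have "\<rho>\<^sup>2 / r\<^sup>2 \<le> 1" using r by simp
    moreover have "S\<^sub>0 * (\<rho> / r) * \<rho> \<le> S\<^sub>0 * 1 * \<rho>"
      using S0 \<rho> r by (intro mult_mono) auto
    ultimately have "- \<gamma> \<le> - (\<rho>\<^sup>2 / r\<^sup>2) - S\<^sub>0 * (\<rho> / r) * \<rho> - S\<^sub>1 * \<rho>\<^sup>2"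
      unfolding \<gamma>_def by linarith
    also have "\<dots> = \<rho>\<^sup>2 / r\<^sup>2 * (- 1 - (S\<^sub>0 * r + S\<^sub>1 * r\<^sup>2))"
      using r by (simp add: field_simps power2_eq_square)
    also have "\<dots> \<le> \<rho>\<^sup>2 / r\<^sup>2 * (d - 2 + x \<bullet> s x)"
      using inner[of x] d_ge_1 by (intro mult_left_mono) (auto simp: r_def)
    also have "\<dots> = \<phi> x"
      using r by (simp add: \<phi>_def w_def w'_def r_def[symmetric] field_simps power2_eq_square)
    finally show ?thesis .
  qed
  have "\<beta> * (1 - \<pi>) - \<gamma> * \<pi> = expect p (\<lambda>x. \<beta> - (\<beta> + \<gamma>) * indicator (- ?I) x)"
    by (simp add: prob_space \<pi>_def emeasure_eq_measure algebra_simps)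
  also have "\<dots> \<le> expect p \<phi>"
  proof (rule integral_mono[OF _ ibp(1)])
    show "integrable (law p) (\<lambda>x. \<beta> - (\<beta> + \<gamma>) * indicator (- ?I) x)"
      by (simp add: emeasure_eq_measure)
  qed (use inside outside in \<open>auto simp: indicator_def\<close>)
  finally show ?thesis using ibp(2) by (simp add: \<beta>_def \<gamma>_def mult.commute)
qed

section \<open>Moments of the score and the truncation set\<close>

text \<open>With \<open>R = 2 sqrt (ln T)\<close> the tail bound is \<open>exp (-R\<^sup>2)\<close>.\<close>

context
  fixes T :: nat and R :: real
  assumes T: "T \<ge> 2" and R: "R = 2 * sqrt (ln (real T))"
    and tail: "prob (- {x. norm x \<le> R * sqrt d}) \<le> 1 / real T ^ 4"
begin

private lemma ln_T: "ln (real T) \<ge> 2/3"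
proof -
  have "ln 2 \<le> ln (real T)" by (rule ln_mono) (use T in auto)
  then show ?thesis using ln2_ge_two_thirds by linarith
qed

private lemma R_sq: "R\<^sup>2 = 4 * ln (real T)"
proof -
  have "(sqrt (ln (real T)))\<^sup>2 = ln (real T)" using ln_T by (intro real_sqrt_pow2) linarith
  then show ?thesis unfolding R power_mult_distrib by simp
qed

private lemma R_ge: "R \<ge> 8/5"
proof -
  have "(4/5)\<^sup>2 \<le> ln (real T)" using ln_T by (simp add: power2_eq_square)
  then have "4/5 \<le> sqrt (ln (real T))" by (rule real_le_rsqrt)
  then show ?thesis unfolding R by simp
qed

text \<open>If \<open>A d < 1/2\<close>, the rate in \<open>tail_lower_bound\<close> satisfies \<open>l \<rho>\<^sup>2 / 2 \<le> R\<^sup>2 / 4 = ln T\<close> for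
\<open>\<rho> = R sqrt d\<close>. The mass outside the truncation set would then be at least a constant times
\<open>1 / (T (1 + ln T))\<close>, which exceeds \<open>1 / T^4\<close> for all \<open>T \<ge> 2\<close>. The bound on \<open>S\<^sub>1\<close> in terms of \<open>A\<close> comes
from the Cramer-Rao inequality.\<close>

lemma A_d_ge_half: "A * d \<ge> 1/2"
proof (rule ccontr)
  assume "\<not> A * d \<ge> 1/2"
  then have Ad: "A * d < 1/2" by simp
  have d1: "d \<ge> 1" by (rule d_ge_1)
  have A0: "A \<ge> 0" by (rule A_nonneg)
  define \<rho> where "\<rho> = R * sqrt d"
  define \<pi> where "\<pi> = prob (- {x. norm x \<le> \<rho>})"
  have \<rho>: "\<rho> > 0" using R_ge d1 by (simp add: \<rho>_def)
  have \<rho>2: "\<rho>\<^sup>2 = R\<^sup>2 * d" using d1 by (simp add: \<rho>_def power_mult_distrib)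
  have S0_sq: "S\<^sub>0\<^sup>2 * d \<le> 1/4"
  proof -
    have "2 * S\<^sub>0\<^sup>2 \<le> A" 
    proof -
      have "0 \<le> 2 * S\<^sub>1\<^sup>2 * sqrt C\<^sub>1" using C1_nonneg by simp
      then show ?thesis using A_lower by linarith
    qed
    then have "2 * S\<^sub>0\<^sup>2 * d \<le> A * d" using d1 by (intro mult_right_mono) auto
    then show ?thesis using Ad by linarith
  qed
  \<comment> \<open>\<open>71/200\<close> is slightly above \<open>1 / (2 sqrt 2)\<close>.\<close>
  have S1d: "S\<^sub>1 * d \<le> 71/200"
  proof -
    have "2 * S\<^sub>1\<^sup>2 * sqrt C\<^sub>1 \<le> A" 
      using A_lower zero_le_power2[of S\<^sub>0] by linarith
    then have "A * (2 * S\<^sub>1\<^sup>2 * sqrt C\<^sub>1) \<le> A * A" using A0 by (intro mult_left_mono) auto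
    moreover have "2 * S\<^sub>1\<^sup>2 * 1 \<le> 2 * S\<^sub>1\<^sup>2 * (A * sqrt C\<^sub>1)"
      using A_times_sqrt_C1 by (intro mult_left_mono) auto
    ultimately have "2 * S\<^sub>1\<^sup>2 \<le> A\<^sup>2" by (simp add: power2_eq_square mult_ac)
    then have "2 * S\<^sub>1\<^sup>2 * d\<^sup>2 \<le> A\<^sup>2 * d\<^sup>2" by (rule mult_right_mono) simp
    then have "2 * (S\<^sub>1 * d)\<^sup>2 \<le> (A * d)\<^sup>2" by (simp add: power_mult_distrib)
    also have "\<dots> \<le> (1/2)\<^sup>2" using Ad A0 d1 by (intro power_mono) auto
    finally have "(S\<^sub>1 * d)\<^sup>2 \<le> (71/200)\<^sup>2" by (simp add: power2_eq_square)
    then show ?thesis by (rule power2_le_imp_le) simp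
  qed
  define l where "l = S\<^sub>1 + S\<^sub>0\<^sup>2 / (2 * d)"
  have "S\<^sub>0\<^sup>2 \<le> 1/4"
    using S0_sq mult_left_mono[OF d1, of "S\<^sub>0\<^sup>2"] by simp
  then have "S\<^sub>1 * d / 2 + S\<^sub>0\<^sup>2 / 4 \<le> 1/4" using S1d by linarith
  then have "(S\<^sub>1 * d / 2 + S\<^sub>0\<^sup>2 / 4) * R\<^sup>2 \<le> 1/4 * R\<^sup>2" by (rule mult_right_mono) simp
  moreover have "l * \<rho>\<^sup>2 / 2 = (S\<^sub>1 * d / 2 + S\<^sub>0\<^sup>2 / 4) * R\<^sup>2"
  proof -
    have "l * d = S\<^sub>1 * d + S\<^sub>0\<^sup>2 / 2" using d1 by (simp add: l_def distrib_right)
    moreover have "l * \<rho>\<^sup>2 / 2 = (l * d) * R\<^sup>2 / 2" by (simp add: \<rho>2 mult_ac)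
    ultimately show ?thesis by (simp add: distrib_right add_divide_distrib)
  qed
  ultimately have "l * \<rho>\<^sup>2 / 2 \<le> ln (real T)" using R_sq by linarith
  then have "exp (- (l * \<rho>\<^sup>2 / 2)) \<ge> exp (- ln (real T))" by simp
  then have e: "exp (- (l * \<rho>\<^sup>2 / 2)) \<ge> 1 / real T" using T by (simp add: exp_minus inverse_eq_divide)
  have T2: "real T \<ge> 2" using T by simp
  have T4: "real T ^ 4 \<ge> 2 ^ 4" using T2 by (intro power_mono) auto
  then have "1 / real T ^ 4 \<le> 1/16" using T2 by (simp add: divide_simps)
  then have pi: "\<pi> \<le> 1/16" "\<pi> \<le> 1 / real T ^ 4" "\<pi> \<ge> 0" using tail by (auto simp: \<pi>_def \<rho>_def)
  define \<gamma> where "\<gamma> = 1 + S\<^sub>0 * \<rho> + S\<^sub>1 * \<rho>\<^sup>2"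
  have \<gamma>: "\<gamma> \<le> 3/2 + 48/25 * ln (real T)" "\<gamma> \<ge> 0"
  proof -
    have "S\<^sub>0 * \<rho> \<le> R / 2"
    proof -
      have "S\<^sub>0 * sqrt d \<le> sqrt (1/4)"
        using S0_sq d1 S0 by (intro real_le_rsqrt) (simp add: power_mult_distrib)
      then have "S\<^sub>0 * sqrt d \<le> 1/2" by (simp add: real_sqrt_divide)
      then have "(S\<^sub>0 * sqrt d) * R \<le> 1/2 * R" using R_ge by (intro mult_right_mono) auto
      then show ?thesis by (simp add: \<rho>_def mult_ac)
    qed
    moreover have "R / 2 \<le> (1 + ln (real T)) / 2"
      using arith_geo_mean_sqrt[of 1 "ln (real T)"] ln_T by (simp add: R)
    moreover have "S\<^sub>1 * \<rho>\<^sup>2 \<le> 71/50 * ln (real T)"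
      using mult_right_mono[OF S1d, of "R\<^sup>2"] ln_T by (simp add: \<rho>2 R_sq mult_ac)
    ultimately show "\<gamma> \<le> 3/2 + 48/25 * ln (real T)" by (simp add: \<gamma>_def)
    show "\<gamma> \<ge> 0" using S0 S1 \<rho> by (simp add: \<gamma>_def)
  qed
  have "1/2 * (1 / real T) * (15/16) \<le> d / 2 * exp (- (l * \<rho>\<^sup>2 / 2)) * (1 - \<pi>)"
    using e pi d1 T2 by (intro mult_mono) auto
  also have "\<dots> \<le> \<pi> * \<gamma>"
    using tail_lower_bound[OF \<rho>] by (simp add: l_def \<pi>_def \<gamma>_def)
  also have "\<dots> \<le> 1 / real T ^ 4 * (3/2 + 48/25 * (real T - 1))"
  proof (intro mult_mono)
    have "ln (real T) \<le> real T - 1" using T2 by (intro ln_le_minus_one) linarith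
    then show "\<gamma> \<le> 3/2 + 48/25 * (real T - 1)" using \<gamma>(1) by argo
  qed (use pi \<gamma> in auto)
  finally have "real T ^ 4 * (1/2 * (1 / real T) * (15/16)) \<le>
      real T ^ 4 * (1 / real T ^ 4 * (3/2 + 48/25 * (real T - 1)))"
    using T2 by (intro mult_left_mono) auto
  then have "15/32 * real T ^ 3 \<le> 3/2 + 48/25 * (real T - 1)"
    using T2 by (simp add: power4_eq_xxxx power3_eq_cube)
  \<comment> \<open>the tangent of the cube at 2\<close>
  moreover have "real T ^ 3 \<ge> 12 * real T - 16"
  proof -
    have "0 \<le> (real T - 2)\<^sup>2 * (real T + 4)" by simp
    also have "\<dots> = real T ^ 3 - 12 * real T + 16" by (simp add: power2_eq_square power3_eq_cube algebra_simps)
    finally show ?thesis by simp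
  qed
  ultimately show False using T2 by argo
qed

text \<open>Inside the truncation set \<open>1 + |x| \<le> 1 + R sqrt d\<close>, and the truncated second moment of the score is
at most \<open>k\<^sup>2\<close> with \<open>k\<close> below both \<open>C\<^sub>2 sqrt d\<close> and \<open>sqrt (A d)\<close>. Outside, Cauchy-Schwarz against
the tail probability yields a factor \<open>1 / T\<^sup>2\<close>, and the last hypothesis turns it into
\<open>\<tau> = 1 / (1 + R)\<close>; what remains there is a multiple of \<open>S\<^sub>0 + S\<^sub>1 C\<^sub>1^(1/4) \<le> sqrt A\<close>. Finally
\<open>quadratic_absorption\<close> collects the terms, its lower bound on \<open>z\<close> being \<open>A d \<ge> 1/2\<close>.\<close>

lemma residual_moment_bound:
  assumes C2: "C\<^sub>2 > 0"
    and trunc: "sqrt (expect p (\<lambda>x. (norm (s x))\<^sup>2 * indicator {x. norm x \<le> R * sqrt d} x)) \<le> C\<^sub>2 * sqrt d"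
    and nontriv: "sqrt (sqrt C\<^sub>1) * d * (1 + R) < (real T)\<^sup>2"
  shows "1 + expect p norm + expect p (\<lambda>x. norm (s x) * (1 + norm x))
      \<le> 2 * (sqrt (C\<^sub>2 + A) * d * (1 + R))"
proof -
  define a where "a = sqrt (sqrt C\<^sub>1)"
  have a: "a \<ge> 0" "a\<^sup>2 = sqrt C\<^sub>1" using C1_nonneg by (auto simp: a_def)
  have T2: "real T \<ge> 2" using T by simp
  have d1: "d \<ge> 1" by (rule d_ge_1)
  define D where "D = sqrt d"
  have D: "D \<ge> 1" "D\<^sup>2 = d" using d1 by (auto simp: D_def)
  define \<tau> where "\<tau> = 1 / (1 + R)"
  have \<tau>: "\<tau> > 0" "\<tau> \<le> 5/13" "\<tau> * (1 + R) = 1" using R_ge by (auto simp: \<tau>_def divide_simps)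
  have ad: "a * d / (real T)\<^sup>2 \<le> \<tau>"
    using nontriv R_ge T2 by (simp add: \<tau>_def a_def divide_simps mult_ac)
  let ?I = "{x::real^'n. norm x \<le> R * D}"
  let ?in = "indicator ?I :: real^'n \<Rightarrow> real" and ?out = "indicator (- ?I) :: real^'n \<Rightarrow> real"
  define \<pi> where "\<pi> = prob (- ?I)"
  have T4: "real T ^ 4 \<ge> 2 ^ 4" using T2 by (intro power_mono) auto
  then have "1 / real T ^ 4 \<le> 1/16" using T2 by (simp add: divide_simps)
  then have pi: "\<pi> \<le> 1/16" "\<pi> \<le> 1 / real T ^ 4" "\<pi> \<ge> 0" using tail by (auto simp: \<pi>_def D_def)
  have "sqrt \<pi> \<le> sqrt (1 / real T ^ 4)" using pi by simp
  also have "\<dots> = 1 / (real T)\<^sup>2"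
    using real_sqrt_abs[of "(real T)\<^sup>2"] by (simp add: real_sqrt_divide)
  finally have spi: "sqrt \<pi> \<le> 1 / (real T)\<^sup>2" .
  have out_sq: "expect p (\<lambda>x. (?out x)\<^sup>2) = \<pi>"
  proof -
    have "(\<lambda>x. (?out x)\<^sup>2) = ?out" by (auto simp: indicator_def)
    then show ?thesis by (simp add: \<pi>_def emeasure_eq_measure)
  qed
  have out_int: "integrable (law p) (\<lambda>x. (?out x)\<^sup>2)"
    by (rule integrable_growth'[of _ 1 0]) (auto simp: indicator_def)
  define m\<^sub>1 where "m\<^sub>1 = expect p (\<lambda>x. norm x * ?out x)"
  define m\<^sub>2 where "m\<^sub>2 = expect p (\<lambda>x. (norm x)\<^sup>2 * ?out x)"
  have int1: "integrable (law p) (\<lambda>x. norm x * ?out x)"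
    by (rule integrable_growth'[of _ 1 1]) (auto simp: indicator_def)
  have int2: "integrable (law p) (\<lambda>x. (norm x)\<^sup>2 * ?out x)"
    by (rule integrable_growth'[of _ 1 2]) (auto simp: indicator_def intro!: power_mono)
  have m1: "m\<^sub>1 \<le> a * D / (real T)\<^sup>2"
  proof -
    have "m\<^sub>1 = expect p (\<lambda>x. \<bar>norm x * ?out x\<bar>)"
      unfolding m\<^sub>1_def by (intro Bochner_Integration.integral_cong) (auto simp: indicator_def)
    also have "\<dots> \<le> sqrt (expect p (\<lambda>x. (norm x)\<^sup>2)) * sqrt (expect p (\<lambda>x. (?out x)\<^sup>2))"
      by (intro integral_Cauchy_Schwarz integrable_norm_sq out_int) auto
    also have "\<dots> \<le> sqrt (sqrt C\<^sub>1 * d) * (1 / (real T)\<^sup>2)"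
      unfolding out_sq using expect_norm_sq spi pi C1_nonneg d1 by (intro mult_mono) auto
    finally show ?thesis by (simp add: a_def D_def real_sqrt_mult)
  qed
  have m2: "m\<^sub>2 \<le> a * a * d / (real T)\<^sup>2"
  proof -
    have "m\<^sub>2 = expect p (\<lambda>x. \<bar>(norm x)\<^sup>2 * ?out x\<bar>)"
      unfolding m\<^sub>2_def by (intro Bochner_Integration.integral_cong) (auto simp: indicator_def)
    also have "\<dots> \<le> sqrt (expect p (\<lambda>x. ((norm x)\<^sup>2)\<^sup>2)) * sqrt (expect p (\<lambda>x. (?out x)\<^sup>2))"
      using moment4 by (intro integral_Cauchy_Schwarz out_int) auto
    also have "\<dots> \<le> sqrt (C\<^sub>1 * d\<^sup>2) * (1 / (real T)\<^sup>2)"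
      unfolding out_sq using moment4_le spi pi C1_nonneg by (intro mult_mono) auto
    also have "\<dots> = a * a * d / (real T)\<^sup>2"
      using d1 a by (simp add: real_sqrt_mult power2_eq_square)
    finally show ?thesis .
  qed
  have m1': "m\<^sub>1 \<le> \<tau>"
  proof -
    have "a * D / (real T)\<^sup>2 \<le> a * d / (real T)\<^sup>2"
      using D a by (intro divide_right_mono mult_left_mono) (auto simp: D(2)[symmetric] power2_eq_square)
    then show ?thesis using m1 ad by linarith
  qed
  have m1'': "m\<^sub>1 \<le> a * D / 4"
  proof -
    have "(2::real)\<^sup>2 \<le> (real T)\<^sup>2" using T2 by (intro power_mono) auto
    then have "a * D / (real T)\<^sup>2 \<le> a * D / 4" using a D T2 by (intro divide_left_mono) auto
    then show ?thesis using m1 by linarith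
  qed
  have m2': "m\<^sub>2 \<le> a * \<tau>"
    using m2 mult_left_mono[OF ad a(1)] by (simp add: mult.assoc)
  have norm_le: "expect p norm \<le> R * D + \<tau>"
  proof -
    have "expect p norm \<le> expect p (\<lambda>x. R * D + norm x * ?out x)"
    proof (rule Bochner_Integration.integral_mono)
      show "integrable (law p) (\<lambda>x. R * D + norm x * ?out x)" using int1 by simp
      show "norm x \<le> R * D + norm x * ?out x" for x :: "real^'n"
        using R_ge D by (auto simp: indicator_def)
    qed (rule integrable_norm)
    also have "\<dots> = R * D + m\<^sub>1" using int1 by (simp add: m\<^sub>1_def)
    finally show ?thesis using m1' by linarith
  qed
  define k where "k = sqrt (expect p (\<lambda>x. (norm (s x))\<^sup>2 * ?in x))"
  define z where "z = sqrt (A * d)"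
  have z: "z \<ge> 7/10"
  proof -
    have "(7/10)\<^sup>2 \<le> A * d" using A_d_ge_half by (simp add: power2_eq_square)
    then show ?thesis unfolding z_def by (rule real_le_rsqrt)
  qed
  have score_int: "integrable (law p) (\<lambda>x. (norm (s x))\<^sup>2 * ?in x)"
    by (rule Bochner_Integration.integrable_bound[OF integrable_score_sq]) (auto simp: indicator_def)
  have k: "0 \<le> k" "k \<le> z" "k \<le> C\<^sub>2 * D"
  proof -
    have "expect p (\<lambda>x. (norm (s x))\<^sup>2 * ?in x) \<le> expect p (\<lambda>x. (norm (s x))\<^sup>2)"
      using score_int integrable_score_sq by (intro Bochner_Integration.integral_mono) (auto simp: indicator_def)
    then show "k \<le> z" using expect_score_sq by (simp add: k_def z_def)
    show "k \<le> C\<^sub>2 * D" using trunc by (simp add: k_def D_def)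
  qed (simp add: k_def)
  have intS: "integrable (law p) (\<lambda>x. norm (s x) * ?in x)"
    by (intro integral_Cauchy_Schwarz(1) integrable_score_sq integrable_growth'[of _ 1 0]) (auto simp: indicator_def)
  have inside: "expect p (\<lambda>x. norm (s x) * ?in x) \<le> k"
  proof -
    have "expect p (\<lambda>x. norm (s x) * ?in x) = expect p (\<lambda>x. \<bar>(norm (s x) * ?in x) * 1\<bar>)"
      by (intro Bochner_Integration.integral_cong) (auto simp: indicator_def)
    also have "\<dots> \<le> sqrt (expect p (\<lambda>x. (norm (s x) * ?in x)\<^sup>2)) * sqrt (expect p (\<lambda>x. 1\<^sup>2))"
    proof (intro integral_Cauchy_Schwarz)
      show "integrable (law p) (\<lambda>x. (norm (s x) * ?in x)\<^sup>2)"
        by (rule Bochner_Integration.integrable_bound[OF integrable_score_sq]) (auto simp: indicator_def)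
    qed auto
    also have "(\<lambda>x. (norm (s x) * ?in x)\<^sup>2) = (\<lambda>x. (norm (s x))\<^sup>2 * ?in x)"
      by (auto simp: indicator_def)
    finally show ?thesis by (simp add: k_def)
  qed
  have "expect p (\<lambda>x. norm (s x) * (1 + norm x)) \<le>
      expect p (\<lambda>x. (1 + R * D) * (norm (s x) * ?in x)
        + (S\<^sub>0 * ?out x + (S\<^sub>0 + S\<^sub>1) * (norm x * ?out x) + S\<^sub>1 * ((norm x)\<^sup>2 * ?out x)))"
  proof (rule Bochner_Integration.integral_mono)
    show "integrable (law p) (\<lambda>x. norm (s x) * (1 + norm x))"
      by (intro integral_Cauchy_Schwarz(1) integrable_score_sq integrable_growth'[of _ 1 2]) auto
    show "integrable (law p) (\<lambda>x. (1 + R * D) * (norm (s x) * ?in x)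
        + (S\<^sub>0 * ?out x + (S\<^sub>0 + S\<^sub>1) * (norm x * ?out x) + S\<^sub>1 * ((norm x)\<^sup>2 * ?out x)))"
      using intS int1 int2 by (simp add: emeasure_eq_measure)
    show "norm (s x) * (1 + norm x) \<le> (1 + R * D) * (norm (s x) * ?in x)
        + (S\<^sub>0 * ?out x + (S\<^sub>0 + S\<^sub>1) * (norm x * ?out x) + S\<^sub>1 * ((norm x)\<^sup>2 * ?out x))" for x
    proof (cases "norm x \<le> R * D")
      case True
      then have "norm (s x) * (1 + norm x) \<le> norm (s x) * (1 + R * D)" by (intro mult_left_mono) auto
      then show ?thesis using True by (simp add: mult.commute)
    next
      case False
      have "norm (s x) * (1 + norm x) \<le> (S\<^sub>0 + S\<^sub>1 * norm x) * (1 + norm x)"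
        using growth[of x] by (intro mult_right_mono) auto
      then show ?thesis using False by (simp add: power2_eq_square algebra_simps)
    qed
  qed
  also have "\<dots> = (1 + R * D) * expect p (\<lambda>x. norm (s x) * ?in x)
        + (S\<^sub>0 * \<pi> + (S\<^sub>0 + S\<^sub>1) * m\<^sub>1 + S\<^sub>1 * m\<^sub>2)"
    using intS int1 int2 by (simp add: emeasure_eq_measure \<pi>_def m\<^sub>1_def m\<^sub>2_def)
  also have "\<dots> \<le> (1 + R * D) * k + (S\<^sub>0 * (1/16) + (S\<^sub>0 * \<tau> + S\<^sub>1 * (a * D / 4)) + S\<^sub>1 * (a * \<tau>))"
    unfolding distrib_right[of "S\<^sub>0"]
    using R_ge D S0 S1 inside pi m1' m1'' m2' by (intro add_mono mult_left_mono) auto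
  also have "\<dots> \<le> (1 + R * D) * k + 33/52 * ((S\<^sub>0 + S\<^sub>1 * a) * D)"
  proof -
    have "S\<^sub>0 * (1/16 + \<tau>) \<le> S\<^sub>0 * (33/52 * D)"
      using \<tau> D S0 by (intro mult_left_mono) auto
    moreover have "(S\<^sub>1 * a) * (D / 4 + \<tau>) \<le> (S\<^sub>1 * a) * (33/52 * D)"
      using \<tau> D S1 a by (intro mult_left_mono) auto
    ultimately show ?thesis by (simp add: algebra_simps)
  qed
  also have "\<dots> \<le> (1 + R * D) * k + 33/52 * z"
  proof -
    have "(S\<^sub>0 + S\<^sub>1 * a)\<^sup>2 \<le> 2 * S\<^sub>0\<^sup>2 + 2 * S\<^sub>1\<^sup>2 * a\<^sup>2"
      using zero_le_power2[of "S\<^sub>0 - S\<^sub>1 * a"] by (simp add: power2_eq_square algebra_simps)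
    also have "\<dots> \<le> A" using A_lower a(2) by simp
    finally have "S\<^sub>0 + S\<^sub>1 * a \<le> sqrt A" by (rule real_le_rsqrt)
    then have "(S\<^sub>0 + S\<^sub>1 * a) * D \<le> sqrt A * D" using D by (intro mult_right_mono) auto
    moreover have "sqrt A * D = z" by (simp add: z_def D_def real_sqrt_mult)
    ultimately show ?thesis by linarith
  qed
  finally have score_le: "expect p (\<lambda>x. norm (s x) * (1 + norm x)) \<le> (1 + R * D) * k + 33/52 * z" .
  define Z where "Z = sqrt (C\<^sub>2 + A) * D"
  have key: "1 + k + 3/20 + z / 4 \<le> 2 * Z"
  proof (rule quadratic_absorption[OF z k(1,2)])
    show "Z \<ge> 0" using D C2 A_nonneg by (simp add: Z_def)
    have "k \<le> C\<^sub>2 * d"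
    proof -
      have "C\<^sub>2 * D \<le> C\<^sub>2 * (D * D)" using C2 D by (intro mult_left_mono) auto
      then show ?thesis using k(3) D(2) by (simp add: power2_eq_square)
    qed
    moreover have "Z\<^sup>2 = C\<^sub>2 * d + A * d"
      using C2 A_nonneg D by (simp add: Z_def power_mult_distrib distrib_right)
    moreover have "z\<^sup>2 = A * d" using A_nonneg d1 by (simp add: z_def)
    ultimately show "z\<^sup>2 + k \<le> Z\<^sup>2" by linarith
  qed
  have "1 + expect p norm + expect p (\<lambda>x. norm (s x) * (1 + norm x))
      \<le> 1 + (R * D + \<tau>) + ((1 + R * D) * k + 33/52 * z)"
    using norm_le score_le by linarith
  also have "\<dots> = R * D * (1 + k) + (1 + \<tau> + k + 33/52 * z)" by (simp add: algebra_simps)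
  also have "\<dots> \<le> R * D * (1 + k) + (1 + \<tau> + k + 33/52 * z) * D"
    using mult_left_mono[OF D(1), of "1 + \<tau> + k + 33/52 * z"] \<tau> k z by simp
  also have "\<dots> = ((1 + k) * (1 + R) + (\<tau> + 33/52 * z) * (\<tau> * (1 + R))) * D"
    unfolding \<tau>(3) by (simp add: algebra_simps)
  also have "\<dots> = ((1 + k) + (\<tau> + 33/52 * z) * \<tau>) * (1 + R) * D" by (simp add: algebra_simps)
  also have "\<dots> \<le> (2 * Z) * (1 + R) * D"
  proof -
    have "(\<tau> + 33/52 * z) * \<tau> \<le> (5/13 + 33/52 * z) * (5/13)"
      using \<tau> z by (intro mult_mono) auto
    also have "\<dots> \<le> 3/20 + z / 4" using z by simp
    finally have "(1 + k) + (\<tau> + 33/52 * z) * \<tau> \<le> 2 * Z" using key by linarith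
    then show ?thesis using R_ge D by (intro mult_right_mono) auto
  qed
  also have "\<dots> = 2 * (sqrt (C\<^sub>2 + A) * D\<^sup>2 * (1 + R))"
    by (simp add: Z_def power2_eq_square)
  finally show ?thesis unfolding D(2) .
qed

end

section \<open>The source term of the continuity equation\<close>

text \<open>Division by \<open>p\<close> turns the divergence of \<open>p w\<close> into \<open>\<nabla>\<cdot>w + s \<bullet> w\<close>. In the application \<open>e\<close> is the
error of the learned score, \<open>r\<close> the residual of the sampler, \<open>\<gamma> = g\<^sup>2 / 2\<close> and \<open>\<kappa> = h\<^sup>2\<close>.\<close>

lemma expect_source_bound:
  fixes e r :: "real^'n \<Rightarrow> real^'n" and J :: "real^'n \<Rightarrow> real"
  assumes e: "\<And>x. e differentiable (at x)" and r: "\<And>x. r differentiable (at x)"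
    and e_growth: "\<And>x. norm (e x) \<le> c * (1 + norm x)"
    and e_sq: "expect p (\<lambda>x. (norm (e x))\<^sup>2) \<le> \<epsilon>\<^sup>2" and \<epsilon>: "\<epsilon> \<ge> 0"
    and J_int: "integrable (law p) J" and J: "\<And>x. \<bar>divergence e x\<bar> \<le> d * J x" and J_le: "expect p J \<le> j"
    and r_growth: "\<And>x. norm (r x) \<le> C * (1 + norm x)"
    and div_r: "\<And>x. \<bar>divergence r x\<bar> \<le> C * (1 + norm x)"
    and \<gamma>: "0 \<le> \<gamma>" "\<gamma> \<le> \<Gamma>" and \<kappa>: "0 \<le> \<kappa>"
  defines "w \<equiv> \<lambda>x. (- \<gamma>) *\<^sub>R e x + \<kappa> *\<^sub>R r x"
  shows "integrable lborel (divergence (\<lambda>x. p x *\<^sub>R w x))"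
    and "(\<integral>x. \<bar>divergence (\<lambda>x. p x *\<^sub>R w x) x\<bar> \<partial>lborel) \<le>
      \<Gamma> * (d * j + sqrt (A * d) * \<epsilon>)
      + \<kappa> * (C * (1 + expect p norm + expect p (\<lambda>x. norm (s x) * (1 + norm x))))"
proof -
  have dw: "w differentiable (at x)" for x
    unfolding w_def by (intro differentiable_add differentiable_scaleR differentiable_const e r)
  have cont_e: "continuous_on UNIV e"
    using e by (meson continuous_at_imp_continuous_on differentiable_imp_continuous_within)
  have [measurable]: "e \<in> borel_measurable borel" by (rule borel_measurable_continuous_onI[OF cont_e])
  have "continuous_on UNIV w"
    using dw by (meson continuous_at_imp_continuous_on differentiable_imp_continuous_within)
  then have [measurable]: "w \<in> borel_measurable borel" by (rule borel_measurable_continuous_onI)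
  have [measurable]: "divergence w \<in> borel_measurable borel" by (rule borel_measurable_divergence[OF dw])
  define \<phi> where "\<phi> = (\<lambda>x. divergence w x + s x \<bullet> w x)"
  have \<phi>m [measurable]: "\<phi> \<in> borel_measurable borel" unfolding \<phi>_def by measurable
  have div_eq: "divergence (\<lambda>x. p x *\<^sub>R w x) = (\<lambda>x. p x * \<phi> x)"
    using divergence_mult[OF gderiv dw] by (auto simp: \<phi>_def distrib_left)
  define S where "S = (\<lambda>x. norm (s x))"
  have [measurable]: "S \<in> borel_measurable borel" unfolding S_def by measurable
  define b where "b = (\<lambda>x. \<gamma> * (d * J x + S x * norm (e x)) + \<kappa> * (C * (1 + norm x + S x * (1 + norm x))))"
  have \<phi>_le: "\<bar>\<phi> x\<bar> \<le> b x" for x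
  proof -
    have de: "(\<lambda>x. (- \<gamma>) *\<^sub>R e x) differentiable (at x)" "(\<lambda>x. \<kappa> *\<^sub>R r x) differentiable (at x)"
      by (intro differentiable_scaleR differentiable_const e r)+
    have "divergence w x = (- \<gamma>) * divergence e x + \<kappa> * divergence r x"
      unfolding w_def by (subst divergence_add[OF de]) (simp only: divergence_cmult[OF e] divergence_cmult[OF r])
    then have "\<phi> x = (- \<gamma>) * (divergence e x + s x \<bullet> e x) + \<kappa> * (divergence r x + s x \<bullet> r x)"
      by (simp add: \<phi>_def w_def inner_add_right algebra_simps)
    also have "\<bar>\<dots>\<bar> \<le> \<bar>(- \<gamma>) * (divergence e x + s x \<bullet> e x)\<bar> + \<bar>\<kappa> * (divergence r x + s x \<bullet> r x)\<bar>"
      by (rule abs_triangle_ineq)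
    also have "\<dots> = \<gamma> * \<bar>divergence e x + s x \<bullet> e x\<bar> + \<kappa> * \<bar>divergence r x + s x \<bullet> r x\<bar>"
      using \<gamma> \<kappa> by (simp add: abs_mult)
    also have "\<dots> \<le> b x" unfolding b_def
    proof (intro add_mono mult_left_mono)
      show "\<bar>divergence e x + s x \<bullet> e x\<bar> \<le> d * J x + S x * norm (e x)"
        using J[of x] Cauchy_Schwarz_ineq2[of "s x" "e x"] unfolding S_def by linarith
      have "S x * norm (r x) \<le> S x * (C * (1 + norm x))"
        using r_growth by (intro mult_left_mono) (auto simp: S_def)
      then have "\<bar>divergence r x + s x \<bullet> r x\<bar> \<le> C * (1 + norm x) + S x * (C * (1 + norm x))"
        using div_r[of x] Cauchy_Schwarz_ineq2[of "s x" "r x"] unfolding S_def by linarith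
      then show "\<bar>divergence r x + s x \<bullet> r x\<bar> \<le> C * (1 + norm x + S x * (1 + norm x))"
        by (simp add: algebra_simps)
    qed (use \<gamma> \<kappa> in auto)
    finally show ?thesis .
  qed
  have EJ: "0 \<le> expect p J"
  proof (rule Bochner_Integration.integral_nonneg)
    fix x
    have "0 \<le> d * J x" using J[of x] by linarith
    then show "0 \<le> J x" using d_ge_1 by (simp add: zero_le_mult_iff)
  qed
  have S_sq: "integrable (law p) (\<lambda>x. (S x)\<^sup>2)" using integrable_score_sq by (simp add: S_def)
  have e_int: "integrable (law p) (\<lambda>x. (norm (e x))\<^sup>2)"
  proof (rule integrable_growth'[of _ "c\<^sup>2" 2])
    show "\<bar>(norm (e x))\<^sup>2\<bar> \<le> c\<^sup>2 * (1 + norm x)\<^sup>2" for x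
      unfolding power_mult_distrib[symmetric] using e_growth[of x] by (simp add: power_mono)
  qed auto
  have Se: "integrable (law p) (\<lambda>x. S x * norm (e x))"
    by (intro integral_Cauchy_Schwarz(1) S_sq e_int) auto
  have S1x: "integrable (law p) (\<lambda>x. S x * (1 + norm x))"
    by (intro integral_Cauchy_Schwarz(1) S_sq integrable_growth'[of _ 1 2]) auto
  have b_int: "integrable (law p) b"
    unfolding b_def using J_int Se S1x integrable_norm by simp
  have \<phi>_int: "integrable (law p) \<phi>"
    by (rule Bochner_Integration.integrable_bound[OF b_int]) (use \<phi>_le order_trans[OF \<phi>_le abs_ge_self] in auto)
  show "integrable lborel (divergence (\<lambda>x. p x *\<^sub>R w x))"
    unfolding div_eq using \<phi>_int by (subst (asm) integrable_law) auto
  have "(\<integral>x. \<bar>divergence (\<lambda>x. p x *\<^sub>R w x) x\<bar> \<partial>lborel) = expect p (\<lambda>x. \<bar>\<phi> x\<bar>)"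
    unfolding div_eq using pos by (subst expect_law) (auto simp: abs_mult less_imp_le)
  also have "\<dots> \<le> expect p b"
    using \<phi>_int b_int \<phi>_le by (intro Bochner_Integration.integral_mono) auto
  also have "\<dots> = \<gamma> * (d * expect p J + expect p (\<lambda>x. S x * norm (e x)))
      + \<kappa> * (C * (1 + expect p norm + expect p (\<lambda>x. S x * (1 + norm x))))"
    unfolding b_def using J_int Se S1x integrable_norm by simp
  also have "\<dots> \<le> \<Gamma> * (d * j + sqrt (A * d) * \<epsilon>)
      + \<kappa> * (C * (1 + expect p norm + expect p (\<lambda>x. S x * (1 + norm x))))"
  proof (intro add_right_mono mult_mono add_mono mult_left_mono)
    have "expect p (\<lambda>x. S x * norm (e x)) = expect p (\<lambda>x. \<bar>S x * norm (e x)\<bar>)"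
      by (simp add: S_def)
    also have "\<dots> \<le> sqrt (expect p (\<lambda>x. (S x)\<^sup>2)) * sqrt (expect p (\<lambda>x. (norm (e x))\<^sup>2))"
      by (intro integral_Cauchy_Schwarz S_sq e_int) auto
    also have "\<dots> \<le> sqrt (A * d) * sqrt (\<epsilon>\<^sup>2)"
      using expect_score_sq A_nonneg d_ge_1
      by (intro mult_mono real_sqrt_le_mono e_sq) (auto simp: S_def)
    finally show "expect p (\<lambda>x. S x * norm (e x)) \<le> sqrt (A * d) * \<epsilon>" using \<epsilon> by simp
    have "0 \<le> expect p (\<lambda>x. S x * norm (e x))" by (simp add: S_def)
    then show "0 \<le> d * expect p J + expect p (\<lambda>x. S x * norm (e x))" using EJ d_ge_1 by simp
  qed (use EJ \<gamma> J_le d_ge_1 in auto)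
  finally show "(\<integral>x. \<bar>divergence (\<lambda>x. p x *\<^sub>R w x) x\<bar> \<partial>lborel) \<le>
      \<Gamma> * (d * j + sqrt (A * d) * \<epsilon>)
      + \<kappa> * (C * (1 + expect p norm + expect p (\<lambda>x. norm (s x) * (1 + norm x))))"
    by (simp only: S_def)
qed

end

section \<open>The forward process, the sampler and smooth fields\<close>

lemma forward_process_prob_space:
  assumes "forward_process M X \<alpha> \<sigma> q" "t \<in> {0..1}"
  shows "prob_space (law (\<lambda>x. q x t))"
proof -
  have M: "prob_space M" and X: "distributed M lborel (X t) (\<lambda>x. ennreal (q x t))"
    using assms unfolding forward_process_def by auto
  have "prob_space (distr M lborel (X t))"
    using X by (intro prob_space.prob_space_distr[OF M]) (auto simp: distributed_def)
  then show ?thesis by (simp add: law_def distributed_distr_eq_density[OF X])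
qed

text \<open>Every marginal is the image of the initial law under a composition of sampler steps and a partial
flow. The steps are measurable since each is the flow map over a whole step.\<close>

lemma sampler_marginals_prob_space:
  assumes sm: "sampler_marginals step T w p qh" and p: "prob_space (law p)"
    and T: "T > 0" and t: "t \<in> {0..1}"
  shows "prob_space (law (\<lambda>x. qh x t))"
proof -
  obtain \<Phi> where \<Phi>: "\<And>n. n \<in> {1..T} \<Longrightarrow>
      backward_flow w ((real n - 1) / real T) (real n / real T) (step n) (\<Phi> n)"
    and law: "\<And>n t. n \<in> {1..T} \<Longrightarrow> t \<in> {(real n - 1) / real T..real n / real T} \<Longrightarrow>
      distr (law p) borel (\<lambda>x. \<Phi> n t (sampler_iterate step T (T - n) x)) = law (\<lambda>x. qh x t)"
    using sm unfolding sampler_marginals_def by blast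
  have flow_meas: "\<Phi> n t \<in> borel_measurable borel"
    if "n \<in> {1..T}" "t \<in> {(real n - 1) / real T..real n / real T}" for n t
    using \<Phi>[OF that(1)] that(2) unfolding backward_flow_def by blast
  have step_meas: "step n \<in> borel_measurable borel" if n: "n \<in> {1..T}" for n
  proof -
    have a: "(real n - 1) / real T \<in> {(real n - 1) / real T..real n / real T}"
      using T by (simp add: divide_right_mono)
    have "\<Phi> n ((real n - 1) / real T) = step n"
      using \<Phi>[OF n] unfolding backward_flow_def by auto
    then show ?thesis using flow_meas[OF n a] by simp
  qed
  have iterate_meas: "k \<le> T \<Longrightarrow> sampler_iterate step T k \<in> borel_measurable borel" for k
  proof (induction k)
    case (Suc k)
    have "(\<lambda>x. step (T - k) (sampler_iterate step T k x)) \<in> borel_measurable borel"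
      using Suc by (intro measurable_compose[OF _ step_meas]) auto
    then show ?case by simp
  next
    case 0
    have "sampler_iterate step T 0 = (\<lambda>x. x)" by auto
    then show ?case by simp
  qed
  \<comment> \<open>the step whose time interval contains \<open>t\<close>; the ceiling would give index 0 at time 0\<close>
  define n where "n = (if t = 0 then 1 else nat \<lceil>t * real T\<rceil>)"
  have "n \<in> {1..T} \<and> t \<in> {(real n - 1) / real T..real n / real T}"
  proof (cases "t = 0")
    case True
    then show ?thesis using T by (auto simp: n_def)
  next
    case False
    then have tT: "0 < t * real T" "t * real T \<le> real T" using t T by (auto simp: mult_le_cancel_right1)
    have c: "\<lceil>t * real T\<rceil> \<ge> 1" "\<lceil>t * real T\<rceil> \<le> int T" using tT by (simp_all add: ceiling_le_iff)
    then have "real n = of_int \<lceil>t * real T\<rceil>" using False by (simp add: n_def)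
    then have "real n - 1 \<le> t * real T" "t * real T \<le> real n" by linarith+
    moreover have "1 \<le> n" using c(1) False by (simp add: n_def le_nat_iff)
    moreover have "n \<le> T" using c(2) False by (simp add: n_def nat_le_iff)
    ultimately show ?thesis using T by (simp add: divide_le_eq le_divide_eq)
  qed
  then have n: "n \<in> {1..T}" and tn: "t \<in> {(real n - 1) / real T..real n / real T}" by auto
  have "(\<lambda>x. \<Phi> n t (sampler_iterate step T (T - n) x)) \<in> borel_measurable borel"
    by (rule measurable_compose[OF iterate_meas flow_meas[OF n tn]]) simp
  then have "prob_space (distr (law p) borel (\<lambda>x. \<Phi> n t (sampler_iterate step T (T - n) x)))"
    by (intro prob_space.prob_space_distr[OF p]) (simp add: law_def)
  then show ?thesis unfolding law[OF n tn] .
qed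

lemma C2_on_imp_continuous_on:
  assumes "C2_on S F"
  shows "continuous_on S F"
proof -
  obtain D :: "'a \<Rightarrow> 'a \<Rightarrow>\<^sub>L 'b" where "\<forall>p\<in>S. (F has_derivative blinfun_apply (D p)) (at p within S)"
    using assms unfolding C2_on_def by blast
  then show ?thesis
    unfolding continuous_on_eq_continuous_within by (intro ballI has_derivative_continuous) (erule bspec)
qed

text \<open>At a time on the boundary of the strip the joint derivative is one-sided in time only. Restricting it
to the slice at that time gives a two-sided derivative in space.\<close>

lemma C2_space_time_spatial_derivative:
  fixes F :: "real^'n \<Rightarrow> real \<Rightarrow> real^'n"
  assumes "C2_space_time F" "t \<in> {0..1}"
  obtains D :: "real^'n \<Rightarrow> (real^'n) \<Rightarrow>\<^sub>L (real^'n)"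
  where "\<And>x. ((\<lambda>y. F y t) has_derivative blinfun_apply (D x)) (at x)" "continuous_on UNIV D"
proof -
  obtain D :: "(real^'n) \<times> real \<Rightarrow> ((real^'n) \<times> real) \<Rightarrow>\<^sub>L (real^'n)" and D2
    where D: "\<And>p. p \<in> UNIV \<times> {0..1} \<Longrightarrow> ((\<lambda>(x, t). F x t) has_derivative blinfun_apply (D p)) (at p within UNIV \<times> {0..1})"
      "\<And>p. p \<in> UNIV \<times> {0..1} \<Longrightarrow> (D has_derivative blinfun_apply (D2 p)) (at p within UNIV \<times> {0..1})"
    using assms(1) unfolding C2_on_def by blast
  define E :: "(real^'n) \<Rightarrow>\<^sub>L ((real^'n) \<times> real)" where "E = Blinfun (\<lambda>v. (v, 0))"
  have "bounded_linear (\<lambda>v :: real^'n. (v, 0 :: real))"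
    by (intro bounded_linear_Pair bounded_linear_ident bounded_linear_zero)
  then have E: "blinfun_apply E v = (v, 0)" for v by (simp add: E_def bounded_linear_Blinfun_apply)
  show thesis
  proof
    fix x :: "real^'n"
    have app: "blinfun_apply (D (x, t) o\<^sub>L E) = (\<lambda>v. blinfun_apply (D (x, t)) (v, 0))"
      by (rule ext) (simp add: E)
    have emb: "((\<lambda>y. (y, t)) has_derivative (\<lambda>v. (v, 0))) (at x)"
      by (intro has_derivative_Pair has_derivative_ident has_derivative_const)
    have "((\<lambda>(x, t). F x t) has_derivative blinfun_apply (D (x, t))) (at (x, t) within range (\<lambda>y. (y, t)))"
      by (rule has_derivative_subset[OF D(1)]) (use assms(2) in auto)
    then have "((\<lambda>y. (\<lambda>(x, t). F x t) (y, t)) has_derivative (\<lambda>v. blinfun_apply (D (x, t)) (v, 0))) (at x)"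
      by (rule has_derivative_in_compose[OF emb, of "\<lambda>(x, t). F x t"])
    then show "((\<lambda>y. F y t) has_derivative blinfun_apply (D (x, t) o\<^sub>L E)) (at x)"
      unfolding app prod.case .
  next
    have "continuous_on (UNIV \<times> {0..1}) D"
      unfolding continuous_on_eq_continuous_within by (intro ballI has_derivative_continuous[OF D(2)])
    moreover have "continuous_on UNIV (\<lambda>x :: real^'n. (x, t))" by (intro continuous_intros)
    ultimately have "continuous_on UNIV (\<lambda>x. D (x, t))"
      by (rule continuous_on_compose2) (use assms(2) in auto)
    then show "continuous_on UNIV (\<lambda>x. D (x, t) o\<^sub>L E)"
      by (rule bounded_bilinear.continuous_on[OF bounded_bilinear_blinfun_compose _ continuous_on_const])
  qed
qed

lemma C2_space_time_differentiable:
  assumes "C2_space_time F" "t \<in> {0..1}"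
  shows "(\<lambda>y. F y t) differentiable (at x)" "continuous_on UNIV (\<lambda>x. F x t)"
proof -
  obtain D where D: "\<And>x. ((\<lambda>y. F y t) has_derivative blinfun_apply (D x)) (at x)"
    and "continuous_on UNIV D"
    by (rule C2_space_time_spatial_derivative[OF assms]) (rule that)
  then show "(\<lambda>y. F y t) differentiable (at x)" unfolding differentiable_def by blast
  show "continuous_on UNIV (\<lambda>x. F x t)"
    by (intro continuous_at_imp_continuous_on ballI has_derivative_continuous[OF D])
qed

lemma C2_space_time_op_norm_continuous:
  assumes "C2_space_time F" "C2_space_time G" "t \<in> {0..1}"
  shows "continuous_on UNIV (\<lambda>x. op_norm (jacobian (\<lambda>y. F y t) (at x) - jacobian (\<lambda>y. G y t) (at x)))"
proof -
  obtain D D' where D: "\<And>x. ((\<lambda>y. F y t) has_derivative blinfun_apply (D x)) (at x)" "continuous_on UNIV D"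
    and D': "\<And>x. ((\<lambda>y. G y t) has_derivative blinfun_apply (D' x)) (at x)" "continuous_on UNIV D'"
  proof -
    obtain D where 1: "\<And>x. ((\<lambda>y. F y t) has_derivative blinfun_apply (D x)) (at x)" "continuous_on UNIV D"
      by (rule C2_space_time_spatial_derivative[OF assms(1,3)]) (rule that)
    obtain D' where 2: "\<And>x. ((\<lambda>y. G y t) has_derivative blinfun_apply (D' x)) (at x)" "continuous_on UNIV D'"
      by (rule C2_space_time_spatial_derivative[OF assms(2,3)]) (rule that)
    show thesis by (rule that[OF 1 2])
  qed
  have jac: "jacobian F (at x) *v v = blinfun_apply B v" if "(F has_derivative blinfun_apply B) (at x)"
    for F :: "real^'n \<Rightarrow> real^'n" and B x v
  proof -
    have "frechet_derivative F (at x) = blinfun_apply B" using frechet_derivative_at[OF that] by simp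
    then show ?thesis unfolding jacobian_def
      by (simp add: matrix_works has_derivative_linear[OF that])
  qed
  have "op_norm (jacobian (\<lambda>y. F y t) (at x) - jacobian (\<lambda>y. G y t) (at x)) = norm (D x - D' x)" for x
    unfolding op_norm_def norm_blinfun.rep_eq matrix_vector_mult_diff_rdistrib
    by (simp add: jac[OF D(1)] jac[OF D'(1)] minus_blinfun.rep_eq)
  then show ?thesis using continuous_on_norm[OF continuous_on_diff[OF D(2) D'(2)]] by simp
qed

lemma TV_le_1:
  assumes "integrable lborel p" "integrable lborel q" "\<And>x. p x \<ge> 0" "\<And>x. q x \<ge> 0"
    and "(\<integral>x. p x \<partial>lborel) = 1" "(\<integral>x. q x \<partial>lborel) = 1"
  shows "TV p q \<le> 1"
proof -
  have "(\<integral>x. \<bar>p x - q x\<bar> \<partial>lborel) \<le> (\<integral>x. p x + q x \<partial>lborel)"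
  proof (rule Bochner_Integration.integral_mono)
    show "\<bar>p x - q x\<bar> \<le> p x + q x" for x using assms(3,4)[of x] by linarith
  qed (use assms(1,2) in auto)
  then show ?thesis using assms by (simp add: TV_def)
qed

section \<open>Total variation error of the sampler\<close>

theorem theorem2:
  fixes M :: "'w measure" and X :: "real \<Rightarrow> 'w \<Rightarrow> real^'n"
    and \<alpha> \<sigma> f g :: "real \<Rightarrow> real"
    and q qh :: "real^'n \<Rightarrow> real \<Rightarrow> real"
    and s\<^sub>\<theta> s sh vh :: "real^'n \<Rightarrow> real \<Rightarrow> real^'n"
    and T :: nat
    and h d Ginf S\<^sub>0 S\<^sub>1 L\<^sub>1 C\<^sub>1 C\<^sub>2 C\<^sub>3 C\<^sub>r :: real
  assumes T: "T > 0" and h: "h = 1 / real T" and d: "d = real CARD('n)"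
    \<comment> \<open>forward process\<close>
    and "noise_schedule \<alpha> \<sigma> f g"
    and "forward_process M X \<alpha> \<sigma> q"
    and "is_score q s"
    and "continuity_equation q (pf_field f g s)"
    \<comment> \<open>sampler\<close>
    and "sampler_marginals (sampler_step f g s\<^sub>\<theta> h) T vh (\<lambda>x. q x 1) qh"
    and "continuity_equation qh vh"
    and "\<And>x. qh x 1 = q x 1"
    and "is_score qh sh"
    \<comment> \<open>(A1)\<close>
    and "C2_on {0..1} f" and "C2_on {0..1} g"
    and "Ginf > 0" and "\<And>t. t \<in> {0..1} \<Longrightarrow> (g t)\<^sup>2 \<le> Ginf"
    \<comment> \<open>(A2)\<close>
    and "C2_space_time s\<^sub>\<theta>" and "C2_space_time s" and "C2_space_time sh"
    and "S\<^sub>0 > 0" and "S\<^sub>1 > 0" and "L\<^sub>1 > 0"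
    and "\<And>x t. t \<in> {0..1} \<Longrightarrow> norm (s\<^sub>\<theta> x t) \<le> S\<^sub>0 + S\<^sub>1 * norm x"
    and "\<And>x t. t \<in> {0..1} \<Longrightarrow> norm (s x t) \<le> S\<^sub>0 + S\<^sub>1 * norm x"
    and "\<And>x t. t \<in> {0..1} \<Longrightarrow> norm (sh x t) \<le> S\<^sub>0 + S\<^sub>1 * norm x"
    and "\<And>x t. t \<in> {0..1} \<Longrightarrow> op_norm (jacobian (\<lambda>y. s\<^sub>\<theta> y t) (at x)) \<le> L\<^sub>1"
    and "\<And>x t. t \<in> {0..1} \<Longrightarrow> op_norm (jacobian (\<lambda>y. s y t) (at x)) \<le> L\<^sub>1"
    \<comment> \<open>(A3)\<close>
    and "\<And>t. t \<in> {0..1} \<Longrightarrow>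
           measure (law (\<lambda>x. q x t)) (- \<Omega>_trunc T) +
           measure (law (\<lambda>x. qh x t)) (- \<Omega>_trunc T) \<le> 1 / real T ^ 4"
    and "\<And>t k. t \<in> {0..1} \<Longrightarrow> k \<in> {1, 2, 3, 4::nat} \<Longrightarrow>
           integrable (law (\<lambda>x. q x t)) (\<lambda>x. norm x ^ k) \<and>
           expect (\<lambda>x. q x t) (\<lambda>x. norm x ^ k) \<le> C\<^sub>1 * d powr (real k / 2)"
    and "\<And>t k. t \<in> {0..1} \<Longrightarrow> k \<in> {1, 2, 3, 4::nat} \<Longrightarrow>
           integrable (law (\<lambda>x. qh x t)) (\<lambda>x. norm x ^ k) \<and>
           expect (\<lambda>x. qh x t) (\<lambda>x. norm x ^ k) \<le> C\<^sub>1 * d powr (real k / 2)"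
    \<comment> \<open>(A4)\<close>
    and "C\<^sub>2 > 0"
    and "\<And>t. t \<in> {0..1} \<Longrightarrow>
           sqrt (expect (\<lambda>x. q x t) (\<lambda>x. (norm (s x t))\<^sup>2 * indicator (\<Omega>_trunc T) x))
             \<le> C\<^sub>2 * sqrt d"
    and "\<And>t. t \<in> {0..1} \<Longrightarrow>
           sqrt (expect (\<lambda>x. qh x t) (\<lambda>x. (norm (sh x t))\<^sup>2 * indicator (\<Omega>_trunc T) x))
             \<le> C\<^sub>2 * sqrt d"
    \<comment> \<open>further constants\<close>
    and "C\<^sub>3 > 0"
    and "\<And>t \<zeta>. t \<in> {0..1} \<Longrightarrow> (\<And>x. \<zeta> x \<ge> 0) \<Longrightarrow>
           integrable (law (\<lambda>x. qh x t)) \<zeta> \<Longrightarrow> integrable (law (\<lambda>x. q x t)) \<zeta> \<Longrightarrow>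
           expect (\<lambda>x. qh x t) \<zeta> \<le> C\<^sub>3 * expect (\<lambda>x. q x t) \<zeta>"
    and "C\<^sub>r > 0"
    and "\<And>x t. t \<in> {0..1} \<Longrightarrow> norm (residual f g s\<^sub>\<theta> h vh x t) \<le> C\<^sub>r * (1 + norm x)"
    and "\<And>x t. t \<in> {0..1} \<Longrightarrow>
           \<bar>divergence (\<lambda>y. residual f g s\<^sub>\<theta> h vh y t) x\<bar> \<le> C\<^sub>r * (1 + norm x)"
  shows "let K = sqrt (C\<^sub>2 + 2 * sqrt (2 * S\<^sub>0 ^ 4 + 2 * S\<^sub>1 ^ 4 * C\<^sub>1));
             C\<^sub>M = max C\<^sub>3 (K * sqrt C\<^sub>3);
             C\<^sub>D = (C\<^sub>r + sqrt C\<^sub>1) * K;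
             C\<^sub>4 = max (1/2 * Ginf * C\<^sub>M) C\<^sub>D
         in TV (\<lambda>x. qh x 0) (\<lambda>x. q x 0)
              \<le> C\<^sub>4 * (d * eps_Jac q s\<^sub>\<theta> s + sqrt d * eps_score q s\<^sub>\<theta> s
                       + d * ((1 + 2 * sqrt (ln (real T))) / (real T)\<^sup>2))"
proof -
  note f_C2 = assms(12) and g_le = assms(15) and C2s = assms(16,17)
    and S0 = assms(19) and S1 = assms(20) and L1 = assms(21)
    and growth = assms(22-24) and jac_le = assms(25,26) and tail = assms(27)
    and moments = assms(28,29) and C2 = assms(30) and trunc = assms(32)
    and C3 = assms(33) and density_ratio = assms(34) and Cr = assms(35)
    and r_growth = assms(36) and div_r = assms(37)
  define R where "R = 2 * sqrt (ln (real T))"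
  define A where "A = 2 * sqrt (2 * S\<^sub>0 ^ 4 + 2 * S\<^sub>1 ^ 4 * C\<^sub>1)"
  define K where "K = sqrt (C\<^sub>2 + A)"
  let ?v = "pf_field f g s" and ?r = "residual f g s\<^sub>\<theta> h vh"
  let ?\<epsilon>J = "eps_Jac q s\<^sub>\<theta> s" and ?\<epsilon> = "eps_score q s\<^sub>\<theta> s"
  have h: "h > 0" "h \<le> 1" "h\<^sup>2 = 1 / (real T)\<^sup>2" using T h by (auto simp: power_divide)
  have d1: "d \<ge> 1" using d by (simp add: Suc_leI)
  have I0: "(0::real) \<in> {0..1}" and I1: "(1::real) \<in> {0..1}" by auto
  have pos: "q x t > 0" "qh x t > 0" if "t \<in> {0..1}" for x t
    using assms(6,11) that unfolding is_score_def by auto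
  have sd_q: "score_density (\<lambda>x. q x t) (\<lambda>x. s x t) d S\<^sub>0 S\<^sub>1 C\<^sub>1" if t: "t \<in> {0..1}" for t
  proof (rule score_density.intro)
    show "prob_space (law (\<lambda>x. q x t))" by (rule forward_process_prob_space[OF assms(5) t])
    show "continuous_on UNIV (\<lambda>x. s x t)" by (rule C2_space_time_differentiable(2)[OF C2s(2) t])
    show "GDERIV (\<lambda>y. ln (q y t)) x :> s x t" for x using assms(6) t unfolding is_score_def by auto
    show "integrable (law (\<lambda>x. q x t)) (\<lambda>x. norm x ^ 4)" using moments(1)[OF t, of 4] by simp
    show "expect (\<lambda>x. q x t) (\<lambda>x. norm x ^ 4) \<le> C\<^sub>1 * d\<^sup>2"
      using moments(1)[OF t, of 4] d1 by (simp add: powr_numeral)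
  qed (use d pos[OF t] S0 S1 growth(2)[OF t] in auto)
  have sd_h: "score_density (\<lambda>x. qh x t) (\<lambda>x. sh x t) d S\<^sub>0 S\<^sub>1 C\<^sub>1" if t: "t \<in> {0..1}" for t
  proof (rule score_density.intro)
    show "prob_space (law (\<lambda>x. qh x t))"
      by (rule sampler_marginals_prob_space[OF assms(8) forward_process_prob_space[OF assms(5) I1] T t])
    show "continuous_on UNIV (\<lambda>x. sh x t)" by (rule C2_space_time_differentiable(2)[OF assms(18) t])
    show "GDERIV (\<lambda>y. ln (qh y t)) x :> sh x t" for x using assms(11) t unfolding is_score_def by auto
    show "integrable (law (\<lambda>x. qh x t)) (\<lambda>x. norm x ^ 4)" using moments(2)[OF t, of 4] by simp
    show "expect (\<lambda>x. qh x t) (\<lambda>x. norm x ^ 4) \<le> C\<^sub>1 * d\<^sup>2"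
      using moments(2)[OF t, of 4] d1 by (simp add: powr_numeral)
  qed (use d pos[OF t] S0 S1 growth(3)[OF t] in auto)
  interpret Q0: score_density "\<lambda>x. q x 0" "\<lambda>x. s x 0" d S\<^sub>0 S\<^sub>1 C\<^sub>1 by (rule sd_q[OF I0])
  interpret H0: score_density "\<lambda>x. qh x 0" "\<lambda>x. sh x 0" d S\<^sub>0 S\<^sub>1 C\<^sub>1 by (rule sd_h[OF I0])
  have A_eq: "score_density.A S\<^sub>0 S\<^sub>1 C\<^sub>1 = A" unfolding A_def by (rule H0.A_def)
  have A0: "A \<ge> 0" using H0.A_nonneg unfolding A_eq .
  have C1: "C\<^sub>1 \<ge> 0" by (rule H0.C1_nonneg)
  \<comment> \<open>For \<open>T = 1\<close> the truncation set is a point, and the tail probabilities add up to 2.\<close>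
  have T2: "T \<ge> 2"
  proof (rule ccontr)
    assume "\<not> T \<ge> 2"
    then have T1: "T = 1" using T by simp
    have \<Omega>: "\<Omega>_trunc T = {0 :: real^'n}" by (auto simp: \<Omega>_trunc_def R_trunc_def T1)
    show False using tail[OF I0] Q0.prob_compl_singleton[of 0] H0.prob_compl_singleton[of 0]
      unfolding \<Omega> by (simp add: T1)
  qed
  have lnT: "ln (real T) \<ge> 0" using T2 by simp
  have R0: "R \<ge> 0" using lnT by (simp add: R_def)
  have \<Omega>: "\<Omega>_trunc T = {x :: real^'n. norm x \<le> R * sqrt d}"
    by (simp add: \<Omega>_trunc_def R_trunc_def R_def d)
  define e where "e = (\<lambda>x t. s\<^sub>\<theta> x t - s x t)"
  define J where "J = (\<lambda>x t. op_norm (jacobian (\<lambda>y. s\<^sub>\<theta> y t) (at x) - jacobian (\<lambda>y. s y t) (at x)))"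
  have J_bounds: "0 \<le> J x t" "J x t \<le> 2 * L\<^sub>1" if t: "t \<in> {0..1}" for x t
    using op_norm_diff_le[of "jacobian (\<lambda>y. s\<^sub>\<theta> y t) (at x)" "jacobian (\<lambda>y. s y t) (at x)"]
      jac_le(1)[OF t, of x] jac_le(2)[OF t, of x] by (auto simp: J_def op_norm_nonneg)
  have J_meas: "(\<lambda>x. J x t) \<in> borel_measurable borel" if t: "t \<in> {0..1}" for t
    unfolding J_def by (rule borel_measurable_continuous_onI[OF C2_space_time_op_norm_continuous[OF C2s t]])
  have e_growth: "norm (e x t) \<le> (2 * (S\<^sub>0 + S\<^sub>1)) * (1 + norm x)" if t: "t \<in> {0..1}" for x t
  proof -
    have "norm (e x t) \<le> (S\<^sub>0 + S\<^sub>1 * norm x) + (S\<^sub>0 + S\<^sub>1 * norm x)"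
      unfolding e_def using norm_triangle_ineq4[of "s\<^sub>\<theta> x t" "s x t"] growth(1)[OF t, of x] growth(2)[OF t, of x]
      by linarith
    moreover have "0 \<le> S\<^sub>0 * norm x" using S0 by simp
    ultimately show ?thesis using S1 by (simp add: algebra_simps)
  qed
  have e_meas: "(\<lambda>x. (norm (e x t))\<^sup>2) \<in> borel_measurable borel" if t: "t \<in> {0..1}" for t
    unfolding e_def
    by (intro borel_measurable_continuous_onI continuous_intros C2_space_time_differentiable(2)[OF _ t] C2s)
  have e_sq_le: "\<bar>(norm (e x t))\<^sup>2\<bar> \<le> (2 * (S\<^sub>0 + S\<^sub>1))\<^sup>2 * (1 + norm x)\<^sup>2" if t: "t \<in> {0..1}" for x t
    unfolding power_mult_distrib[symmetric, of "2 * (S\<^sub>0 + S\<^sub>1)"] using e_growth[OF t, of x] by (simp add: power_mono)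
  have int_q: "integrable (law (\<lambda>x. q x t)) (\<lambda>x. J x t)" "integrable (law (\<lambda>x. q x t)) (\<lambda>x. (norm (e x t))\<^sup>2)"
    and int_h: "integrable (law (\<lambda>x. qh x t)) (\<lambda>x. J x t)" "integrable (law (\<lambda>x. qh x t)) (\<lambda>x. (norm (e x t))\<^sup>2)"
    if t: "t \<in> {0..1}" for t
  proof -
    have J4: "\<bar>J x t\<bar> \<le> 2 * L\<^sub>1 * (1 + norm x) ^ 0" for x using J_bounds[OF t, of x] by simp
    show "integrable (law (\<lambda>x. q x t)) (\<lambda>x. J x t)"
      by (rule score_density.integrable_growth'[OF sd_q[OF t] J_meas[OF t] J4]) simp
    show "integrable (law (\<lambda>x. q x t)) (\<lambda>x. (norm (e x t))\<^sup>2)"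
      by (rule score_density.integrable_growth'[OF sd_q[OF t] e_meas[OF t] e_sq_le[OF t]]) simp
    show "integrable (law (\<lambda>x. qh x t)) (\<lambda>x. J x t)"
      by (rule score_density.integrable_growth'[OF sd_h[OF t] J_meas[OF t] J4]) simp
    show "integrable (law (\<lambda>x. qh x t)) (\<lambda>x. (norm (e x t))\<^sup>2)"
      by (rule score_density.integrable_growth'[OF sd_h[OF t] e_meas[OF t] e_sq_le[OF t]]) simp
  qed
  have eps_J: "expect (\<lambda>x. q x t) (\<lambda>x. J x t) \<le> ?\<epsilon>J" if t: "t \<in> {0..1}" for t
    unfolding eps_Jac_def J_def
    \<comment> \<open>The supremum is over a bounded set, so it is a genuine upper bound.\<close>
  proof (rule cSUP_upper[OF t], rule bdd_aboveI2)
    fix t :: real assume t: "t \<in> {0..1}"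
    interpret score_density "\<lambda>x. q x t" "\<lambda>x. s x t" d S\<^sub>0 S\<^sub>1 C\<^sub>1 by (rule sd_q[OF t])
    have "expect (\<lambda>x. q x t) (\<lambda>x. J x t) \<le> expect (\<lambda>x. q x t) (\<lambda>x. 2 * L\<^sub>1)"
      by (rule Bochner_Integration.integral_mono) (use int_q[OF t] J_bounds[OF t] in auto)
    then show "expect (\<lambda>x. q x t) (\<lambda>x. op_norm (jacobian (\<lambda>y. s\<^sub>\<theta> y t) (at x) - jacobian (\<lambda>y. s y t) (at x))) \<le> 2 * L\<^sub>1"
      by (simp add: J_def)
  qed
  have eps_e: "expect (\<lambda>x. q x t) (\<lambda>x. (norm (e x t))\<^sup>2) \<le> ?\<epsilon>\<^sup>2" and \<epsilon>0: "?\<epsilon> \<ge> 0"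
    if t: "t \<in> {0..1}" for t
  proof -
    let ?E = "SUP t\<in>{0..1}. expect (\<lambda>x. q x t) (\<lambda>x. (norm (s\<^sub>\<theta> x t - s x t))\<^sup>2)"
    have le: "expect (\<lambda>x. q x t) (\<lambda>x. (norm (s\<^sub>\<theta> x t - s x t))\<^sup>2) \<le> ?E"
    proof (rule cSUP_upper[OF t], rule bdd_aboveI2)
      fix t :: real assume t: "t \<in> {0..1}"
      interpret score_density "\<lambda>x. q x t" "\<lambda>x. s x t" d S\<^sub>0 S\<^sub>1 C\<^sub>1 by (rule sd_q[OF t])
      have "expect (\<lambda>x. q x t) (\<lambda>x. (norm (e x t))\<^sup>2) \<le> expect (\<lambda>x. q x t) (\<lambda>x. (2 * (S\<^sub>0 + S\<^sub>1))\<^sup>2 * (1 + norm x)\<^sup>2)"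
        by (rule Bochner_Integration.integral_mono)
          (use int_q[OF t] e_sq_le[OF t] integrable_growth'[of "\<lambda>x. (1 + norm x)\<^sup>2" 1 2] in auto)
      also have "\<dots> \<le> (2 * (S\<^sub>0 + S\<^sub>1))\<^sup>2 * (2 + 2 * (sqrt C\<^sub>1 * d))"
        using mult_left_mono[OF shifted_second_moment(3), of "(2 * (S\<^sub>0 + S\<^sub>1))\<^sup>2"] by simp
      finally show "expect (\<lambda>x. q x t) (\<lambda>x. (norm (s\<^sub>\<theta> x t - s x t))\<^sup>2) \<le> (2 * (S\<^sub>0 + S\<^sub>1))\<^sup>2 * (2 + 2 * (sqrt C\<^sub>1 * d))"
        by (simp add: e_def)
    qed
    have "0 \<le> expect (\<lambda>x. q x t) (\<lambda>x. (norm (s\<^sub>\<theta> x t - s x t))\<^sup>2)" by simp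
    then have "0 \<le> ?E" using le by linarith
    then have "?\<epsilon>\<^sup>2 = ?E" unfolding eps_score_def by (rule real_sqrt_pow2)
    then show "expect (\<lambda>x. q x t) (\<lambda>x. (norm (e x t))\<^sup>2) \<le> ?\<epsilon>\<^sup>2" using le by (simp add: e_def)
    show "?\<epsilon> \<ge> 0" unfolding eps_score_def using \<open>0 \<le> ?E\<close> by (rule real_sqrt_ge_zero)
  qed
  note \<epsilon>0 = \<epsilon>0[OF I0]
  have \<epsilon>J0: "?\<epsilon>J \<ge> 0"
  proof -
    have "0 \<le> expect (\<lambda>x. q x 0) (\<lambda>x. J x 0)" using J_bounds(1)[OF I0] by simp
    then show ?thesis using eps_J[OF I0] by linarith
  qed
  define C\<^sub>M where "C\<^sub>M = max C\<^sub>3 (K * sqrt C\<^sub>3)"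
  define C\<^sub>D where "C\<^sub>D = (C\<^sub>r + sqrt C\<^sub>1) * K"
  define C\<^sub>4 where "C\<^sub>4 = max (1/2 * Ginf * C\<^sub>M) C\<^sub>D"
  define \<tau> where "\<tau> = d * ((1 + R) / (real T)\<^sup>2)"
  have \<tau>0: "\<tau> \<ge> 0" using d1 R0 by (simp add: \<tau>_def)
  have K0: "K \<ge> sqrt A" "K \<ge> 0" using A0 C2 by (auto simp: K_def)
  have C40: "C\<^sub>4 \<ge> 0" "C\<^sub>4 \<ge> C\<^sub>D" "C\<^sub>4 \<ge> 1/2 * Ginf * C\<^sub>M"
  proof -
    have "0 \<le> C\<^sub>D" using Cr C1 K0 by (simp add: C\<^sub>D_def)
    then show "C\<^sub>4 \<ge> 0" by (simp add: C\<^sub>4_def)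
  qed (auto simp: C\<^sub>4_def)
  have "TV (\<lambda>x. qh x 0) (\<lambda>x. q x 0) \<le> C\<^sub>4 * (d * ?\<epsilon>J + sqrt d * ?\<epsilon> + \<tau>)"
  proof (cases "sqrt (sqrt C\<^sub>1) * d * (1 + R) < (real T)\<^sup>2")
    \<comment> \<open>Here the right-hand side is at least 1.\<close>
    case False
    define a where "a = sqrt (sqrt C\<^sub>1)"
    have a: "a \<ge> 0" "a * a = sqrt C\<^sub>1" using C1 by (auto simp: a_def)
    have aK: "1 \<le> a * K"
    proof -
      have "1 \<le> sqrt (A * sqrt C\<^sub>1)" using H0.A_times_sqrt_C1 unfolding A_eq by simp
      also have "\<dots> = a * sqrt A" by (simp add: a_def real_sqrt_mult)
      also have "\<dots> \<le> a * K" using K0 a by (intro mult_left_mono)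
      finally show ?thesis .
    qed
    have "TV (\<lambda>x. qh x 0) (\<lambda>x. q x 0) \<le> 1"
      using Q0.integral_p H0.integral_p pos[OF I0] by (intro TV_le_1) (auto simp: less_imp_le)
    also have "1 \<le> a * \<tau>"
      using False T2 by (simp add: \<tau>_def a_def field_simps)
    also have "\<dots> \<le> (a * K) * (a * \<tau>)" using mult_right_mono[OF aK, of "a * \<tau>"] a \<tau>0 by simp
    also have "\<dots> = (sqrt C\<^sub>1 * K) * \<tau>" by (simp add: a(2)[symmetric])
    also have "\<dots> \<le> C\<^sub>4 * \<tau>"
    proof (rule mult_right_mono[OF _ \<tau>0])
      have "sqrt C\<^sub>1 * K \<le> C\<^sub>D" using Cr K0 by (simp add: C\<^sub>D_def distrib_right)
      then show "sqrt C\<^sub>1 * K \<le> C\<^sub>4" using C40 by linarith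
    qed
    also have "\<dots> \<le> C\<^sub>4 * (d * ?\<epsilon>J + sqrt d * ?\<epsilon> + \<tau>)"
      using C40 \<epsilon>J0 \<epsilon>0 d1 by (intro mult_left_mono) auto
    finally show ?thesis .
  next
    case nontriv: True
    define j where "j = C\<^sub>3 * ?\<epsilon>J"
    define \<epsilon>' where "\<epsilon>' = sqrt C\<^sub>3 * ?\<epsilon>"
    define M where "M = Ginf / 2 * (d * j + sqrt (A * d) * \<epsilon>') + h\<^sup>2 * (C\<^sub>r * (2 * (K * d * (1 + R))))"
    have diff_q: "(\<lambda>y. s\<^sub>\<theta> y t) differentiable (at x)" "(\<lambda>y. s y t) differentiable (at x)" if "t \<in> {0..1}" for x t
      using C2_space_time_differentiable(1)[OF C2s(1) that] C2_space_time_differentiable(1)[OF C2s(2) that] by auto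
    have diff_vh: "(\<lambda>y. vh y t) differentiable (at x)" if t: "t \<in> {0..1}" for x t
    proof -
      have nz: "qh y t \<noteq> 0" for y using pos(2)[OF t, of y] by linarith
      have "(\<lambda>y. qh y t *\<^sub>R vh y t) differentiable (at x)"
        using assms(9) t unfolding continuity_equation_def by auto
      then show ?thesis
        by (rule differentiable_cancel_scaleR[OF score_density.gderiv[OF sd_h[OF t]] nz _ nz])
    qed
    have diff_r: "(\<lambda>y. ?r y t) differentiable (at x)" if t: "t \<in> {0..1}" for x t
      unfolding residual_def
      by (intro differentiable_scaleR differentiable_const differentiable_add differentiable_diff
          diff_vh[OF t] diff_q[OF t] differentiable_ident)
    have field_diff: "vh x t - ?v x t = (- ((g t)\<^sup>2 / 2)) *\<^sub>R e x t + h\<^sup>2 *\<^sub>R ?r x t" for x t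
      using h(1) by (simp add: residual_def pf_field_def e_def algebra_simps)
    have source: "integrable lborel (divergence (\<lambda>y. qh y t *\<^sub>R (vh y t - ?v y t)))"
      "(\<integral>x. \<bar>divergence (\<lambda>y. qh y t *\<^sub>R (vh y t - ?v y t)) x\<bar> \<partial>lborel) \<le> M" if t: "t \<in> {0..1}" for t
    proof -
      interpret H: score_density "\<lambda>x. qh x t" "\<lambda>x. sh x t" d S\<^sub>0 S\<^sub>1 C\<^sub>1 by (rule sd_h[OF t])
      have diff_e: "(\<lambda>y. e y t) differentiable (at x)" for x
        unfolding e_def by (intro differentiable_diff diff_q[OF t])
      have e_le: "expect (\<lambda>x. qh x t) (\<lambda>x. (norm (e x t))\<^sup>2) \<le> \<epsilon>'\<^sup>2"
      proof -
        have "expect (\<lambda>x. qh x t) (\<lambda>x. (norm (e x t))\<^sup>2) \<le> C\<^sub>3 * expect (\<lambda>x. q x t) (\<lambda>x. (norm (e x t))\<^sup>2)"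
          by (rule density_ratio[OF t _ int_h(2)[OF t] int_q(2)[OF t]]) simp
        also have "\<dots> \<le> C\<^sub>3 * ?\<epsilon>\<^sup>2" using C3 by (intro mult_left_mono eps_e[OF t]) auto
        finally show ?thesis using C3 by (simp add: \<epsilon>'_def power_mult_distrib)
      qed
      have J_le: "expect (\<lambda>x. qh x t) (\<lambda>x. J x t) \<le> j"
      proof -
        have "expect (\<lambda>x. qh x t) (\<lambda>x. J x t) \<le> C\<^sub>3 * expect (\<lambda>x. q x t) (\<lambda>x. J x t)"
          by (rule density_ratio[OF t J_bounds(1)[OF t] int_h(1)[OF t] int_q(1)[OF t]])
        also have "\<dots> \<le> j" unfolding j_def using C3 by (intro mult_left_mono eps_J[OF t]) auto
        finally show ?thesis .
      qed
      have div_e: "\<bar>divergence (\<lambda>y. e y t) x\<bar> \<le> d * J x t" for x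
        unfolding divergence_def e_def jacobian_diff[OF diff_q[OF t]] J_def d by (rule abs_trace_le_op_norm)
      have \<epsilon>'0: "\<epsilon>' \<ge> 0" using \<epsilon>0 C3 by (simp add: \<epsilon>'_def)
      have \<gamma>: "0 \<le> (g t)\<^sup>2 / 2" "(g t)\<^sup>2 / 2 \<le> Ginf / 2" using g_le[OF t] by auto
      have h2: "0 \<le> h\<^sup>2" by simp
      note bound = H.expect_source_bound[of "\<lambda>y. e y t" "\<lambda>y. ?r y t", OF diff_e diff_r[OF t] e_growth[OF t] e_le \<epsilon>'0
          int_h(1)[OF t] div_e J_le r_growth[OF t] div_r[OF t] \<gamma> h2]
      show "integrable lborel (divergence (\<lambda>y. qh y t *\<^sub>R (vh y t - ?v y t)))"
        unfolding field_diff by (rule bound(1))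
      have tail_t: "measure (law (\<lambda>x. qh x t)) (- {x. norm x \<le> R * sqrt d}) \<le> 1 / real T ^ 4"
        using tail[OF t] measure_nonneg[of "law (\<lambda>x. q x t)" "- \<Omega>_trunc T"] unfolding \<Omega> by linarith
      have "1 + expect (\<lambda>x. qh x t) norm + expect (\<lambda>x. qh x t) (\<lambda>x. norm (sh x t) * (1 + norm x))
          \<le> 2 * (K * d * (1 + R))"
        using H.residual_moment_bound[OF T2 R_def tail_t C2 _ nontriv] trunc[OF t]
        unfolding \<Omega> A_eq K_def by blast
      then have "h\<^sup>2 * (C\<^sub>r * (1 + expect (\<lambda>x. qh x t) norm + expect (\<lambda>x. qh x t) (\<lambda>x. norm (sh x t) * (1 + norm x))))
          \<le> h\<^sup>2 * (C\<^sub>r * (2 * (K * d * (1 + R))))"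
        using Cr by (intro mult_left_mono) auto
      then show "(\<integral>x. \<bar>divergence (\<lambda>y. qh y t *\<^sub>R (vh y t - ?v y t)) x\<bar> \<partial>lborel) \<le> M"
        using bound(2) unfolding field_diff M_def A_eq by linarith
    qed
    obtain F where F: "\<And>t. t \<in> {0..1} \<Longrightarrow> \<bar>f t\<bar> \<le> F"
    proof -
      have "bounded (f ` {0..1})"
        using C2_on_imp_continuous_on[OF f_C2] compact_continuous_image compact_imp_bounded compact_Icc by blast
      then obtain b where "\<forall>y\<in>f ` {0..1}. norm y \<le> b" unfolding bounded_iff by blast
      then show thesis by (intro that[of b]) auto
    qed
    have F0: "F \<ge> 0" using order_trans[OF abs_ge_zero F[OF I0]] .
    have G0: "Ginf > 0" by (rule assms(14))
    \<comment> \<open>one constant for all the growth and moment conditions of the stability estimate\<close>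
    define C where "C = (2 + 2 * (sqrt C\<^sub>1 * d)) + (S\<^sub>0 + S\<^sub>1) + F * d + Ginf * (S\<^sub>0 + S\<^sub>1) + Ginf * L\<^sub>1 * d + C\<^sub>r"
    have parts: "0 \<le> sqrt C\<^sub>1 * d" "0 \<le> S\<^sub>0 + S\<^sub>1" "0 \<le> F * d" "0 \<le> Ginf * (S\<^sub>0 + S\<^sub>1)" "0 \<le> Ginf * L\<^sub>1 * d" "0 \<le> C\<^sub>r"
      using C1 d1 S0 S1 F0 G0 L1 Cr by auto
    have Fd: "F \<le> F * d" "Ginf * L\<^sub>1 \<le> Ginf * L\<^sub>1 * d"
      using mult_left_mono[OF d1 F0] mult_left_mono[OF d1, of "Ginf * L\<^sub>1"] G0 L1 by auto
    have C_ge: "2 + 2 * (sqrt C\<^sub>1 * d) \<le> C \<and> S\<^sub>0 + S\<^sub>1 \<le> C \<and> F * d + Ginf * (S\<^sub>0 + S\<^sub>1) \<le> C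
        \<and> F * d + Ginf * (S\<^sub>0 + S\<^sub>1) + C\<^sub>r \<le> C \<and> F + Ginf * L\<^sub>1 \<le> C \<and> F * d + Ginf * L\<^sub>1 * d + C\<^sub>r \<le> C"
      unfolding C_def using parts Fd by argo
    have lin: "S\<^sub>0 + S\<^sub>1 * norm x \<le> (S\<^sub>0 + S\<^sub>1) * (1 + norm x)" for x :: "real^'n"
    proof -
      have "0 \<le> S\<^sub>0 * norm x" using S0 by simp
      then show ?thesis using S1 by (simp add: algebra_simps)
    qed
    have scale: "c * (1 + norm x) \<le> C * (1 + norm x)" if "c \<le> C" for c and x :: "real^'n"
      using that by (intro mult_right_mono) auto
    have half_g: "\<bar>(g t)\<^sup>2 / 2\<bar> \<le> Ginf" if "t \<in> {0..1}" for t
      using g_le[OF that] G0 by simp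
    have drift: "norm (f t *\<^sub>R x - ((g t)\<^sup>2 / 2) *\<^sub>R y) \<le> (F * d + Ginf * (S\<^sub>0 + S\<^sub>1)) * (1 + norm x)"
      if t: "t \<in> {0..1}" and y: "norm y \<le> S\<^sub>0 + S\<^sub>1 * norm x" for t and x y :: "real^'n"
    proof -
      have "norm (f t *\<^sub>R x - ((g t)\<^sup>2 / 2) *\<^sub>R y) \<le> \<bar>f t\<bar> * norm x + \<bar>(g t)\<^sup>2 / 2\<bar> * norm y"
        using norm_triangle_ineq4[of "f t *\<^sub>R x" "((g t)\<^sup>2 / 2) *\<^sub>R y"] by (simp only: norm_scaleR)
      also have "\<dots> \<le> (F * d) * (1 + norm x) + Ginf * ((S\<^sub>0 + S\<^sub>1) * (1 + norm x))"
      proof (intro add_mono mult_mono)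
        show "\<bar>f t\<bar> \<le> F * d" using F[OF t] Fd by linarith
        show "norm y \<le> (S\<^sub>0 + S\<^sub>1) * (1 + norm x)" using y lin[of x] by linarith
      qed (use half_g[OF t] G0 parts in auto)
      also have "\<dots> = (F * d + Ginf * (S\<^sub>0 + S\<^sub>1)) * (1 + norm x)" by (simp add: algebra_simps)
      finally show ?thesis .
    qed
    have vh_eq: "vh x t = (f t *\<^sub>R x - ((g t)\<^sup>2 / 2) *\<^sub>R s\<^sub>\<theta> x t) + h\<^sup>2 *\<^sub>R ?r x t" for x t
      using h(1) by (simp add: residual_def)
    have h2: "h\<^sup>2 \<le> 1" using h(1,2) by (intro power_le_one) auto
    have hr: "h\<^sup>2 * y \<le> C\<^sub>r * (1 + norm x)" if "y \<le> C\<^sub>r * (1 + norm x)" "0 \<le> y" for y and x :: "real^'n"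
      using mult_right_mono[OF h2 that(2)] that(1) by simp
    have L1_bound: "(\<integral>x. \<bar>qh x 0 - q x 0\<bar> \<partial>lborel) \<le> M"
    proof (rule continuity_equation_L1_stability[OF assms(6,11,7,9,10), where C = C])
      fix t :: real assume t: "t \<in> {0..1}"
      note sm = score_density.shifted_second_moment[OF sd_q[OF t]] score_density.shifted_second_moment[OF sd_h[OF t]]
      show "integrable lborel (\<lambda>x. q x t * (1 + norm x)\<^sup>2)" "integrable lborel (\<lambda>x. qh x t * (1 + norm x)\<^sup>2)"
        using sm(1) sm(4) by auto
      show "(\<integral>x. q x t * (1 + norm x)\<^sup>2 \<partial>lborel) \<le> C" using sm(2) C_ge by linarith
      show "(\<integral>x. qh x t * (1 + norm x)\<^sup>2 \<partial>lborel) \<le> C" using sm(5) C_ge by linarith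
      fix x :: "real^'n"
      have c1: "S\<^sub>0 + S\<^sub>1 \<le> C" "F * d + Ginf * (S\<^sub>0 + S\<^sub>1) \<le> C" "F * d + Ginf * (S\<^sub>0 + S\<^sub>1) + C\<^sub>r \<le> C"
        "F + Ginf * L\<^sub>1 \<le> C" "F * d + Ginf * L\<^sub>1 * d + C\<^sub>r \<le> C"
        using C_ge by blast+
      show "norm (s x t) \<le> C * (1 + norm x)" by (rule order_trans[OF growth(2)[OF t] order_trans[OF lin scale[OF c1(1)]]])
      show "norm (sh x t) \<le> C * (1 + norm x)" by (rule order_trans[OF growth(3)[OF t] order_trans[OF lin scale[OF c1(1)]]])
      show "norm (?v x t) \<le> C * (1 + norm x)"
        unfolding pf_field_def
        using order_trans[OF drift[OF t growth(2)[OF t]] scale[OF c1(2)], of x] by simp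
      have "norm (vh x t) \<le> norm (f t *\<^sub>R x - ((g t)\<^sup>2 / 2) *\<^sub>R s\<^sub>\<theta> x t) + norm (h\<^sup>2 *\<^sub>R ?r x t)"
        by (subst vh_eq[of x t]) (rule norm_triangle_ineq)
      also have "\<dots> \<le> (F * d + Ginf * (S\<^sub>0 + S\<^sub>1)) * (1 + norm x) + C\<^sub>r * (1 + norm x)"
      proof (rule add_mono)
        show "norm (f t *\<^sub>R x - ((g t)\<^sup>2 / 2) *\<^sub>R s\<^sub>\<theta> x t) \<le> (F * d + Ginf * (S\<^sub>0 + S\<^sub>1)) * (1 + norm x)"
          by (rule drift[OF t growth(1)[OF t]])
        have "norm (h\<^sup>2 *\<^sub>R ?r x t) = h\<^sup>2 * norm (?r x t)" by simp
        also have "\<dots> \<le> C\<^sub>r * (1 + norm x)" by (rule hr[OF r_growth[OF t] norm_ge_zero])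
        finally show "norm (h\<^sup>2 *\<^sub>R ?r x t) \<le> C\<^sub>r * (1 + norm x)" .
      qed
      also have "\<dots> = (F * d + Ginf * (S\<^sub>0 + S\<^sub>1) + C\<^sub>r) * (1 + norm x)"
        by (rule distrib_right[symmetric])
      also have "\<dots> \<le> C * (1 + norm x)" by (rule scale[OF c1(3)])
      finally show "norm (vh x t) \<le> C * (1 + norm x)" .
      show "\<bar>jacobian (\<lambda>y. ?v y t) (at x) $ i $ i\<bar> \<le> C" for i
      proof -
        let ?js = "jacobian (\<lambda>y. s y t) (at x)"
        have ds: "((\<lambda>y. s y t) has_derivative (\<lambda>v. ?js *v v)) (at x)"
          using diff_q(2)[OF t, of x] by (simp add: jacobian_works[symmetric])
        have "((\<lambda>y. ?v y t) has_derivative (\<lambda>v. f t *\<^sub>R v - ((g t)\<^sup>2 / 2) *\<^sub>R (?js *v v))) (at x)"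
          unfolding pf_field_def by (auto intro!: derivative_eq_intros ds)
        from frechet_derivative_at[OF this, symmetric]
        have "jacobian (\<lambda>y. ?v y t) (at x) $ i $ i = f t - (g t)\<^sup>2 / 2 * ?js $ i $ i"
          by (simp add: jacobian_def[of "\<lambda>y. ?v y t"] matrix_def matrix_vector_mult_basis column_def)
        also have "\<bar>\<dots>\<bar> \<le> \<bar>f t\<bar> + \<bar>(g t)\<^sup>2 / 2\<bar> * \<bar>?js $ i $ i\<bar>"
          unfolding abs_mult[symmetric] by (rule abs_triangle_ineq4)
        also have "\<dots> \<le> F + Ginf * L\<^sub>1"
          using F[OF t] half_g[OF t] G0 order_trans[OF abs_component_le_op_norm jac_le(2)[OF t, of x], of i i]
          by (intro add_mono mult_mono) auto
        finally show ?thesis using c1(4) by linarith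
      qed
      show "\<bar>divergence (\<lambda>y. vh y t) x\<bar> \<le> C * (1 + norm x)"
      proof -
        have d1': "(\<lambda>y. f t *\<^sub>R y) differentiable (at x)" "(\<lambda>y. (- ((g t)\<^sup>2 / 2)) *\<^sub>R s\<^sub>\<theta> y t) differentiable (at x)"
          "(\<lambda>y. h\<^sup>2 *\<^sub>R ?r y t) differentiable (at x)" "(\<lambda>y :: real^'n. y) differentiable (at x)"
          by (intro differentiable_scaleR differentiable_const differentiable_ident diff_q[OF t] diff_r[OF t])+
        have "(\<lambda>y. vh y t) = (\<lambda>y. (f t *\<^sub>R y + (- ((g t)\<^sup>2 / 2)) *\<^sub>R s\<^sub>\<theta> y t) + h\<^sup>2 *\<^sub>R ?r y t)"
          unfolding vh_eq[of _ t] by (simp only: scaleR_minus_left diff_conv_add_uminus)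
        then have "divergence (\<lambda>y. vh y t) x = divergence (\<lambda>y. (f t *\<^sub>R y + (- ((g t)\<^sup>2 / 2)) *\<^sub>R s\<^sub>\<theta> y t) + h\<^sup>2 *\<^sub>R ?r y t) x"
          by (rule arg_cong[where f = "\<lambda>G. divergence G x"])
        also have "\<dots> = f t * d - (g t)\<^sup>2 / 2 * divergence (\<lambda>y. s\<^sub>\<theta> y t) x + h\<^sup>2 * divergence (\<lambda>y. ?r y t) x"
          unfolding divergence_add[OF differentiable_add[OF d1'(1,2)] d1'(3)] divergence_add[OF d1'(1,2)]
            divergence_cmult[OF d1'(4)] divergence_cmult[OF diff_q(1)[OF t]] divergence_cmult[OF diff_r[OF t]]
            divergence_id d by simp
        finally have eq: "divergence (\<lambda>y. vh y t) x = \<dots>" .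
        have 1: "\<bar>f t * d\<bar> \<le> F * d" using F[OF t] d1 by (simp add: abs_mult mult_right_mono)
        have 2: "\<bar>(g t)\<^sup>2 / 2 * divergence (\<lambda>y. s\<^sub>\<theta> y t) x\<bar> \<le> Ginf * (L\<^sub>1 * d)"
          unfolding abs_mult
        proof (rule mult_mono[OF half_g[OF t]])
          have "\<bar>divergence (\<lambda>y. s\<^sub>\<theta> y t) x\<bar> \<le> d * op_norm (jacobian (\<lambda>y. s\<^sub>\<theta> y t) (at x))"
            unfolding divergence_def d by (rule abs_trace_le_op_norm)
          also have "\<dots> \<le> d * L\<^sub>1" using jac_le(1)[OF t, of x] d1 by (intro mult_left_mono) auto
          finally show "\<bar>divergence (\<lambda>y. s\<^sub>\<theta> y t) x\<bar> \<le> L\<^sub>1 * d" by (simp add: mult.commute)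
        qed (use G0 in auto)
        have 3: "\<bar>h\<^sup>2 * divergence (\<lambda>y. ?r y t) x\<bar> \<le> C\<^sub>r * (1 + norm x)"
          using hr[OF div_r[OF t, of x] abs_ge_zero] by (simp add: abs_mult)
        have "(F * d + Ginf * L\<^sub>1 * d) * 1 \<le> (F * d + Ginf * L\<^sub>1 * d) * (1 + norm x)"
          using parts by (intro mult_left_mono) auto
        then have "F * d + Ginf * (L\<^sub>1 * d) \<le> (F * d + Ginf * L\<^sub>1 * d) * (1 + norm x)"
          by (simp only: mult.assoc mult_1_right)
        then have "\<bar>divergence (\<lambda>y. vh y t) x\<bar> \<le> (F * d + Ginf * L\<^sub>1 * d) * (1 + norm x) + C\<^sub>r * (1 + norm x)"
          using 1 2 3 abs_triangle_ineq4[of "f t * d" "(g t)\<^sup>2 / 2 * divergence (\<lambda>y. s\<^sub>\<theta> y t) x"]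
            abs_triangle_ineq[of "f t * d - (g t)\<^sup>2 / 2 * divergence (\<lambda>y. s\<^sub>\<theta> y t) x" "h\<^sup>2 * divergence (\<lambda>y. ?r y t) x"]
          unfolding eq by argo
        also have "\<dots> = (F * d + Ginf * L\<^sub>1 * d + C\<^sub>r) * (1 + norm x)"
          by (rule distrib_right[symmetric])
        also have "\<dots> \<le> C * (1 + norm x)" by (rule scale[OF c1(5)])
        finally show ?thesis .
      qed
    next
      fix t :: real assume t: "t \<in> {0..1}"
      show "integrable lborel (divergence (\<lambda>y. qh y t *\<^sub>R (vh y t - ?v y t)))"
        "(\<integral>x. \<bar>divergence (\<lambda>y. qh y t *\<^sub>R (vh y t - ?v y t)) x\<bar> \<partial>lborel) \<le> M"
        by (rule source[OF t])+
    qed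
    have hM: "h\<^sup>2 * (C\<^sub>r * (2 * (K * d * (1 + R)))) = 2 * (C\<^sub>r * K * \<tau>)"
      unfolding h(3) \<tau>_def by simp
    have a1: "d * j \<le> C\<^sub>M * (d * ?\<epsilon>J)"
    proof -
      have "C\<^sub>3 * (d * ?\<epsilon>J) \<le> C\<^sub>M * (d * ?\<epsilon>J)"
        using d1 \<epsilon>J0 by (intro mult_right_mono) (auto simp: C\<^sub>M_def)
      then show ?thesis by (simp add: j_def mult_ac)
    qed
    have a2: "sqrt (A * d) * \<epsilon>' \<le> C\<^sub>M * (sqrt d * ?\<epsilon>)"
    proof -
      have "sqrt A * sqrt C\<^sub>3 \<le> K * sqrt C\<^sub>3" using K0 C3 by (intro mult_right_mono) auto
      then have "sqrt A * sqrt C\<^sub>3 \<le> C\<^sub>M" by (simp add: C\<^sub>M_def)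
      then have "(sqrt A * sqrt C\<^sub>3) * (sqrt d * ?\<epsilon>) \<le> C\<^sub>M * (sqrt d * ?\<epsilon>)"
        using d1 \<epsilon>0 by (intro mult_right_mono) auto
      then show ?thesis by (simp add: \<epsilon>'_def real_sqrt_mult mult_ac)
    qed
    have "Ginf / 2 * (d * j + sqrt (A * d) * \<epsilon>') \<le> Ginf / 2 * (C\<^sub>M * (d * ?\<epsilon>J) + C\<^sub>M * (sqrt d * ?\<epsilon>))"
      using G0 a1 a2 by (intro mult_left_mono add_mono) auto
    also have "\<dots> = (1/2 * Ginf * C\<^sub>M) * (d * ?\<epsilon>J + sqrt d * ?\<epsilon>)" by (simp add: algebra_simps)
    also have "\<dots> \<le> C\<^sub>4 * (d * ?\<epsilon>J + sqrt d * ?\<epsilon>)"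
      using C40 d1 \<epsilon>J0 \<epsilon>0 by (intro mult_right_mono) auto
    finally have b1: "Ginf / 2 * (d * j + sqrt (A * d) * \<epsilon>') \<le> C\<^sub>4 * (d * ?\<epsilon>J + sqrt d * ?\<epsilon>)" .
    have b1': "0 \<le> C\<^sub>4 * (d * ?\<epsilon>J + sqrt d * ?\<epsilon>)" using C40 d1 \<epsilon>J0 \<epsilon>0 by simp
    have b2: "C\<^sub>r * K * \<tau> \<le> C\<^sub>4 * \<tau>"
    proof (rule mult_right_mono[OF _ \<tau>0])
      have "C\<^sub>r * K \<le> C\<^sub>D" using C1 K0 by (simp add: C\<^sub>D_def distrib_right)
      then show "C\<^sub>r * K \<le> C\<^sub>4" using C40 by linarith
    qed
    \<comment> \<open>The factor 2 in the residual part of \<open>M\<close> is compensated by the factor 1/2 in \<open>TV\<close>.\<close>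
    have "TV (\<lambda>x. qh x 0) (\<lambda>x. q x 0) \<le> M / 2" using L1_bound by (simp add: TV_def)
    also have "\<dots> = Ginf / 2 * (d * j + sqrt (A * d) * \<epsilon>') / 2 + C\<^sub>r * K * \<tau>" unfolding M_def hM by simp
    also have "\<dots> \<le> C\<^sub>4 * (d * ?\<epsilon>J + sqrt d * ?\<epsilon>) + C\<^sub>4 * \<tau>" using b1 b1' b2 by linarith
    also have "\<dots> = C\<^sub>4 * (d * ?\<epsilon>J + sqrt d * ?\<epsilon> + \<tau>)" by (simp add: distrib_left)
    finally show ?thesis .
  qed
  then show ?thesis
    unfolding Let_def C\<^sub>4_def C\<^sub>M_def C\<^sub>D_def K_def A_def \<tau>_def R_def .
qed

end
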